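(* Let $\mathbf\Gamma=\{\Gamma(i)\}_{i\in\Lambda}$ be a finite collection of graphs that is stochastically strongly connected, whose edge maps are contracting similarities, and that is a non-trivial surviving collection of graphs, with associated non-trivial probability vector $\vec\pi=(\pi_i)_{i\in\Lambda}$. Let $F_v$, $v\in V$, be the attractor of the associated $\infty$-variable (random recursive) construction. Then, almost surely, the Hausdorff dimension and the upper box-counting dimension of $F_v$ agree, and thus $$\dim_H F_v=\dim_P F_v=\dim_B F_v,$$ where $\dim_P$ is packing dimension and $\dim_B$ box-counting dimension.
   Context: Setting. $\Lambda=\{1,\dots,N\}$; $\Gamma(i)=(V,E(i))$, $i\in\Lambda$, are finite directed multigraphs with a common finite vertex set $V$ (edges of different graphs are regarded as different letters). $\iota(e),\tau(e)$ are the initial and terminal vertices of an edge $e$; ${}_vE(i)$ is the set of $e\in E(i)$ with $\iota(e)=v$. The probability vector $\vec\pi$ has all $\pi_i>0$. To each edge $e$ a similarity $S_e:\mathbb R^d\to\mathbb R^d$ with ratio $c_e\in(0,1)$ is associated. $\Delta\subset\mathbb R^d$ is a fixed non-empty compact set with $\Delta=\overline{\operatorname{int}\Delta}$ and $S_e(\Delta)\subset\Delta$ for all edges $e$. Conditions. $\mathbf\Gamma$ is stochastically strongly connected if for all $v,w\in V$ there is a finite word $u\in\Lambda^k$ of positive probability and a path $(e_1,\dots,e_k)$ from $v$ to $w$ with $e_l\in E(u_l)$ and $\iota(e_{l+1})=\tau(e_l)$. $\mathbf\Gamma$ is a non-trivial surviving collection if for every $v\in V$, $\sum_{i\in\Lambda}\pi_i\,\#({}_vE(i))>1$,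 and there are edges $e_1,e_2$ (of possibly different graphs) with $S_{e_1}\ne S_{e_2}$. Random recursive construction. To every finite word $\mathbf w$ in the edge letters (including the empty word) is attached a random variable $\xi_{\mathbf w}$ with $\mathbb P(\xi_{\mathbf w}=i)=\pi_i$, all these being independent. For $v\in V$, $\mathbf F^0_v$ consists of the empty word, regarded as ending at $v$; inductively $\mathbf F^{k+1}_v$ is the set of words $\mathbf w e$ with $\mathbf w\in\mathbf F^k_v$ ending at a vertex $j$ and $e\in {}_jE(\xi_{\mathbf w})$, and $\mathbf we$ ends at $\tau(e)$. The attractor is $$F_v=\bigcap_{k=1}^\infty\ \bigcup_{\mathbf w\in\mathbf F^k_v}S_{w_1}\circ\dots\circ S_{w_k}(\Delta),$$ a random compact set which may be empty with positive probability; all dimensions of the empty set are assigned the same value. *)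

theory Defs
  imports "HOL-Probability.Probability" "Graph_Theory.Digraph"
begin

section \<open>Dimensions\<close>

text \<open>
  The gauge \<open>|U|\<^sup>s\<close>, with the conventions \<open>|{}|\<^sup>s = 0\<close> and \<open>|U|\<^sup>0 = 1\<close> for nonempty \<open>U\<close>.
  The case \<open>s = 0\<close> is separate because \<open>0 powr 0 = 0\<close> in HOL.
\<close>

definition diam_pow :: "real \<Rightarrow> 'a::metric_space set \<Rightarrow> ennreal" where
  "diam_pow s U = (if U = {} then 0 else if s = 0 then 1 else ennreal (diameter U powr s))"

text \<open>Boundedness is required explicitly since \<open>diameter\<close> is unspecified on unbounded sets.\<close>

definition diam_at_most :: "real \<Rightarrow> 'a::metric_space set \<Rightarrow> bool" where
  "diam_at_most \<delta> U \<longleftrightarrow> bounded U \<and> diameter U \<le> \<delta>"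

definition hausdorff_premeasure :: "real \<Rightarrow> real \<Rightarrow> 'a::metric_space set \<Rightarrow> ennreal" where
  "hausdorff_premeasure s \<delta> F =
     (INF U\<in>{U :: nat \<Rightarrow> 'a set. F \<subseteq> (\<Union>i. U i) \<and> (\<forall>i. diam_at_most \<delta> (U i))}. \<Sum>i. diam_pow s (U i))"

definition hausdorff_measure :: "real \<Rightarrow> 'a::metric_space set \<Rightarrow> ennreal" where
  "hausdorff_measure s F = (SUP \<delta>\<in>{0<..}. hausdorff_premeasure s \<delta> F)"

definition hausdorff_dim :: "'a::metric_space set \<Rightarrow> ereal" where
  "hausdorff_dim F = (INF s\<in>{s. 0 \<le> s \<and> hausdorff_measure s F = 0}. ereal s)"

text \<open>
  A packing is a set of pairs \<open>(x, r)\<close> standing for pairwise disjoint closed balls of radius \<open>r\<close>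
  centred at \<open>x \<in> F\<close>.  Its sum is a supremum of finite subsums, so no countability is needed.
\<close>

definition packings :: "real \<Rightarrow> 'a::metric_space set \<Rightarrow> ('a \<times> real) set set" where
  "packings \<delta> F = {P. P \<subseteq> F \<times> {0<..\<delta>} \<and> disjoint_family_on (\<lambda>(x, r). cball x r) P}"

definition packing_premeasure :: "real \<Rightarrow> 'a::metric_space set \<Rightarrow> ennreal" where
  "packing_premeasure s F =
     (INF \<delta>\<in>{0<..}. SUP P\<in>packings \<delta> F. \<Sum>\<^sub>\<infinity>(x, r)\<in>P. diam_pow s (cball x r))"

text \<open>The premeasure is not countably subadditive, hence the second step over countable covers.\<close>

definition packing_measure :: "real \<Rightarrow> 'a::metric_space set \<Rightarrow> ennreal" where
  "packing_measure s F =
     (INF A\<in>{A :: nat \<Rightarrow> 'a set. F \<subseteq> (\<Union>i. A i)}. \<Sum>i. packing_premeasure s (A i))"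

definition packing_dim :: "'a::metric_space set \<Rightarrow> ereal" where
  "packing_dim F = (INF s\<in>{s. 0 \<le> s \<and> packing_measure s F = 0}. ereal s)"

text \<open>The box-counting notions are meant for totally bounded \<open>F\<close>, where finite covers exist.\<close>

definition covering_number :: "real \<Rightarrow> 'a::metric_space set \<Rightarrow> nat" where
  "covering_number \<delta> F =
     (LEAST n. \<exists>C. finite C \<and> card C = n \<and> F \<subseteq> \<Union>C \<and> (\<forall>U\<in>C. diam_at_most \<delta> U))"

definition upper_box_dim :: "'a::metric_space set \<Rightarrow> ereal" where
  "upper_box_dim F =
     Limsup (at_right 0) (\<lambda>\<delta>. ereal (ln (real (covering_number \<delta> F)) / (- ln \<delta>)))"

definition lower_box_dim :: "'a::metric_space set \<Rightarrow> ereal" where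
  "lower_box_dim F =
     Liminf (at_right 0) (\<lambda>\<delta>. ereal (ln (real (covering_number \<delta> F)) / (- ln \<delta>)))"

definition has_box_dim :: "'a::metric_space set \<Rightarrow> ereal \<Rightarrow> bool" where
  "has_box_dim F s \<longleftrightarrow> lower_box_dim F = s \<and> upper_box_dim F = s"

text \<open>
  All these dimensions agree on the empty set; for the box dimensions this uses \<open>ln 0 = 0\<close>.
\<close>

lemma hausdorff_dim_empty: "hausdorff_dim ({} :: 'a::metric_space set) = 0"
proof -
  have z: "hausdorff_premeasure 0 \<delta> ({} :: 'a set) = 0" if "\<delta> > 0" for \<delta>
  proof -
    have "hausdorff_premeasure 0 \<delta> ({} :: 'a set) \<le> (\<Sum>i. diam_pow 0 ((\<lambda>_::nat. {} :: 'a set) i))"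
      unfolding hausdorff_premeasure_def
      by (rule INF_lower) (use that in \<open>auto simp: diam_at_most_def\<close>)
    then show ?thesis by (simp add: diam_pow_def)
  qed
  have "hausdorff_measure 0 ({} :: 'a set) = 0"
    by (simp add: hausdorff_measure_def z bot_ennreal SUP_eq_iff)
  then show ?thesis unfolding hausdorff_dim_def
    by (intro antisym INF_lower2[of 0] INF_greatest) auto
qed

lemma packing_dim_empty: "packing_dim ({} :: 'a::metric_space set) = 0"
proof -
  have "packings \<delta> ({} :: 'a set) = {{}}" for \<delta>
    by (auto simp: packings_def disjoint_family_on_def)
  then have z: "packing_premeasure 0 ({} :: 'a set) = 0"
    by (auto simp: packing_premeasure_def intro!: antisym INF_lower2[of 1])
  have "packing_measure 0 ({} :: 'a set) \<le> (\<Sum>i. packing_premeasure 0 ((\<lambda>_::nat. {} :: 'a set) i))"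
    unfolding packing_measure_def by (rule INF_lower) auto
  then have "packing_measure 0 ({} :: 'a set) = 0" by (simp add: z)
  then show ?thesis unfolding packing_dim_def
    by (intro antisym INF_lower2[of 0] INF_greatest) auto
qed

lemma has_box_dim_empty: "has_box_dim ({} :: 'a::metric_space set) 0"
proof -
  have "covering_number \<delta> ({} :: 'a set) = 0" for \<delta>
    unfolding covering_number_def by (rule Least_equality) auto
  then show ?thesis
    by (simp add: has_box_dim_def lower_box_dim_def upper_box_dim_def Liminf_const Limsup_const
        zero_ereal_def[symmetric])
qed

section \<open>Collections of graphs and the random recursive attractor\<close>

text \<open>
  The graphs are given by \<open>G :: 'i \<Rightarrow> ('v, 'e) pre_digraph\<close> on an index set \<open>\<Lambda>\<close>;
  \<open>out_arcs (G i) v\<close> is the set of edges of \<open>G i\<close> starting at \<open>v\<close>.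
\<close>

definition similarity :: "real \<Rightarrow> ('a::metric_space \<Rightarrow> 'a) \<Rightarrow> bool" where
  "similarity c f \<longleftrightarrow> 0 < c \<and> (\<forall>x y. dist (f x) (f y) = c * dist x y)"

text \<open>\<open>word_path G v u es w\<close>: \<open>es\<close> is a path from \<open>v\<close> to \<open>w\<close> whose \<open>l\<close>-th edge lies in \<open>G (u ! l)\<close>.\<close>

fun word_path ::
  "('i \<Rightarrow> ('v, 'e) pre_digraph) \<Rightarrow> 'v \<Rightarrow> 'i list \<Rightarrow> 'e list \<Rightarrow> 'v \<Rightarrow> bool" where
  "word_path G v [] [] w \<longleftrightarrow> v = w"
| "word_path G v (i # u) (e # es) w \<longleftrightarrow> e \<in> out_arcs (G i) v \<and> word_path G (head (G i) e) u es w"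
| "word_path G v _ _ w \<longleftrightarrow> False"

definition stochastically_strongly_connected ::
  "'i set \<Rightarrow> 'v set \<Rightarrow> ('i \<Rightarrow> ('v, 'e) pre_digraph) \<Rightarrow> ('i \<Rightarrow> real) \<Rightarrow> bool" where
  "stochastically_strongly_connected \<Lambda> V G \<pi> \<longleftrightarrow>
     (\<forall>v\<in>V. \<forall>w\<in>V. \<exists>u es. u \<in> lists \<Lambda> \<and> u \<noteq> [] \<and> prod_list (map \<pi> u) > 0 \<and> word_path G v u es w)"

definition nontrivial_surviving ::
  "'i set \<Rightarrow> 'v set \<Rightarrow> ('i \<Rightarrow> ('v, 'e) pre_digraph) \<Rightarrow> ('i \<Rightarrow> real) \<Rightarrow> ('e \<Rightarrow> 'a \<Rightarrow> 'a) \<Rightarrow> bool" where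
  "nontrivial_surviving \<Lambda> V G \<pi> S \<longleftrightarrow>
     (\<forall>v\<in>V. (\<Sum>i\<in>\<Lambda>. \<pi> i * real (card (out_arcs (G i) v))) > 1) \<and>
     (\<exists>e1\<in>(\<Union>i\<in>\<Lambda>. arcs (G i)). \<exists>e2\<in>(\<Union>i\<in>\<Lambda>. arcs (G i)). S e1 \<noteq> S e2)"

text \<open>
  The words of the \<open>k\<close>-th level of the construction started at \<open>v\<close>, each paired with the vertex at
  which it ends, for one realisation \<open>x\<close> of the labels.
\<close>

primrec level_words ::
  "('i \<Rightarrow> ('v, 'e) pre_digraph) \<Rightarrow> ('e list \<Rightarrow> 'i) \<Rightarrow> 'v \<Rightarrow> nat \<Rightarrow> ('e list \<times> 'v) set" where
  "level_words G x v 0 = {([], v)}"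
| "level_words G x v (Suc k) =
     {(w @ [e], head (G (x w)) e) | w j e. (w, j) \<in> level_words G x v k \<and> e \<in> out_arcs (G (x w)) j}"

definition word_map :: "('e \<Rightarrow> 'a \<Rightarrow> 'a) \<Rightarrow> 'e list \<Rightarrow> 'a \<Rightarrow> 'a" where
  "word_map S w = foldr (\<circ>) (map S w) id"

definition attractor ::
  "('i \<Rightarrow> ('v, 'e) pre_digraph) \<Rightarrow> ('e \<Rightarrow> 'a \<Rightarrow> 'a) \<Rightarrow> 'a set \<Rightarrow> ('e list \<Rightarrow> 'i) \<Rightarrow> 'v \<Rightarrow> 'a set" where
  "attractor G S \<Delta> x v =
     (\<Inter>k\<in>{1..}. \<Union>(w, j)\<in>level_words G x v k. word_map S w ` \<Delta>)"

text \<open>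
  A family of independent \<open>\<Lambda>\<close>-valued labels, one for every finite word over the alphabet \<open>E\<close>,
  each with distribution \<open>\<pi>\<close>.
\<close>

definition (in prob_space) iid_labels ::
  "'i set \<Rightarrow> ('i \<Rightarrow> real) \<Rightarrow> 'e set \<Rightarrow> ('e list \<Rightarrow> 'a \<Rightarrow> 'i) \<Rightarrow> bool" where
  "iid_labels \<Lambda> \<pi> E \<xi> \<longleftrightarrow>
     indep_vars (\<lambda>_. count_space \<Lambda>) \<xi> (lists E) \<and>
     (\<forall>w\<in>lists E. \<forall>i\<in>\<Lambda>. prob {\<omega>\<in>space M. \<xi> w \<omega> = i} = \<pi> i)"

end

(*
  For a scale r let L_r be the set of words whose ratio first drops to r or below, and let sel r v x
  be a maximal subset of the words of L_r present in the tree started at v, subject to the pieces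
  S_w(Delta) being more than r apart.  Its cardinality bounds the covering number of F_v at scale
  const * r from above, and it depends only on the labels of words of ratio above r.

  If the mean cardinality is at most r^(-t) for all vertices and all small r, then Markov's
  inequality and Borel-Cantelli along r = 2^(-k) bound the upper box dimension by any t' > t.
  Otherwise it exceeds r^(-t) at some vertex v0 for arbitrarily small r.  Joining the selected words
  to paths back to v0 gives a Galton-Watson tree of separated pieces.  For t1 < t and r small this
  tree, percolated with retention probability p = (ratio of a step)^t1, is still supercritical.  The
  conditional survival probability phi of the percolation given the tree satisfies
  phi(node) <= p * (sum of phi over the children), so it acts like a mass distribution and bounds
  the t1-dimensional Hausdorff content from below whenever it is positive, an event of positive
  probability.  A zero-one law (the generating function is strictly convex because every vertex has
  at least two offspring with positive probability) upgrades this to: almost surely F_v is empty or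
  has Hausdorff dimension at least t1.  Letting t1 < t < t' run through the rationals concludes.
*)
theory Submission
  imports Defs "HOL-Real_Asymp.Real_Asymp"
begin

section \<open>Comparison of the dimensions\<close>

text \<open>No separation of the pieces is assumed, so words of comparable ratio may describe
  overlapping or identical pieces, and counting words would overestimate covering numbers. Counting
  only mutually separated pieces repairs this, and the same mean count serves both bounds; the
  common value of the dimensions is never computed. The separated words end at different vertices,
  and the favourable vertex may change from scale to scale. The return paths make the process one of
  a single type. They cost a factor in probability and a factor in ratio that do not depend on r, so
  the gap between t1 and t pays for both once r is small. Percolation is used because its survival
  probability is bounded by 1 and obeys a recursion: positivity follows by induction on the
  generations, without moment bounds for a random mass. No percolation variables are constructed;
  the conditional probability is obtained by iterating the recursion on functions of the
  labels.\<close>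

lemma diam_pow_pos: "s > 0 \<Longrightarrow> diam_pow s U = ennreal (diameter U powr s)"
  by (auto simp: diam_pow_def diameter_def)

lemma hausdorff_premeasure_le:
  assumes "F \<subseteq> (\<Union>i. U i)" "\<And>i. diam_at_most \<delta> (U i)"
  shows "hausdorff_premeasure s \<delta> F \<le> (\<Sum>i. diam_pow s (U i))"
  unfolding hausdorff_premeasure_def by (rule INF_lower) (use assms in auto)

lemma hausdorff_premeasure_finite_cover:
  assumes "finite C" "F \<subseteq> \<Union>C" "\<And>U. U \<in> C \<Longrightarrow> diam_at_most \<eta> U" "0 < \<eta>" "\<eta> \<le> \<delta>" "s > 0"
  shows "hausdorff_premeasure s \<delta> F \<le> ennreal (real (card C) * \<eta> powr s)"
proof -
  obtain h where h: "bij_betw h {0..<card C} C"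
    using ex_bij_betw_nat_finite[OF assms(1)] by blast
  define U where "U = (\<lambda>i. if i < card C then h i else {})"
  have mem: "h i \<in> C" if "i < card C" for i
    using h that by (auto simp: bij_betw_def)
  have "\<Union>C = (\<Union>i. U i)"
  proof -
    have "C = h ` {0..<card C}" using h by (auto simp: bij_betw_def)
    then have "\<Union>C = (\<Union>i\<in>{0..<card C}. h i)" by metis
    also have "\<dots> = (\<Union>i. U i)" by (auto simp: U_def split: if_splits)
    finally show ?thesis .
  qed
  then have "hausdorff_premeasure s \<delta> F \<le> (\<Sum>i. diam_pow s (U i))"
    using assms(2,4,5) order_trans[OF _ assms(5)] assms(3)[OF mem]
    by (intro hausdorff_premeasure_le) (auto simp: U_def diam_at_most_def)
  also have "\<dots> = (\<Sum>i<card C. diam_pow s (U i))"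
    by (rule suminf_finite) (auto simp: U_def diam_pow_def)
  also have "\<dots> \<le> (\<Sum>i<card C. ennreal (\<eta> powr s))"
    using assms mem
    by (intro sum_mono)
       (auto simp: diam_pow_pos U_def diam_at_most_def intro!: ennreal_leI powr_mono2 diameter_ge_0)
  also have "\<dots> = ennreal (real (card C) * \<eta> powr s)"
    by (simp add: ennreal_mult ennreal_of_nat_eq_real_of_nat)
  finally show ?thesis .
qed

lemma hausdorff_measure_eq_0I:
  assumes "\<And>\<epsilon> \<delta>. \<epsilon> > 0 \<Longrightarrow> \<delta> > 0 \<Longrightarrow> hausdorff_premeasure s \<delta> F \<le> ennreal \<epsilon>"
  shows "hausdorff_measure s F = 0"
proof -
  have "hausdorff_premeasure s \<delta> F = 0" if "\<delta> > 0" for \<delta>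
  proof -
    have "hausdorff_premeasure s \<delta> F \<le> 0 + ennreal e" if "0 < e" for e :: real
      using assms[OF that \<open>\<delta> > 0\<close>] by simp
    then have "hausdorff_premeasure s \<delta> F \<le> 0"
      by (rule ennreal_le_epsilon)
    then show ?thesis by simp
  qed
  then show ?thesis by (simp add: hausdorff_measure_def bot_ennreal SUP_eq_iff)
qed

lemma hausdorff_measure_eq_0_premeasure:
  assumes "hausdorff_measure s F = 0" "\<delta> > 0"
  shows "hausdorff_premeasure s \<delta> F = 0"
proof -
  have "hausdorff_premeasure s \<delta> F \<le> hausdorff_measure s F"
    unfolding hausdorff_measure_def by (rule SUP_upper) (use assms in auto)
  then show ?thesis using assms by simp
qed

lemma hausdorff_dim_le: "0 \<le> s \<Longrightarrow> hausdorff_measure s F = 0 \<Longrightarrow> hausdorff_dim F \<le> ereal s"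
  unfolding hausdorff_dim_def by (rule INF_lower) auto

lemma ereal_le_if_less_real:
  fixes x y :: ereal
  assumes "\<And>s. y < ereal s \<Longrightarrow> x \<le> ereal s"
  shows "x \<le> y"
proof (rule dense_ge)
  fix z assume "y < z" then show "x \<le> z"
    using assms by (cases z) auto
qed

lemma covering_number_le:
  assumes "finite C" "F \<subseteq> \<Union>C" "\<And>U. U \<in> C \<Longrightarrow> diam_at_most \<delta> U"
  shows "covering_number \<delta> F \<le> card C"
  unfolding covering_number_def by (rule Least_le) (use assms in blast)

lemma diam_at_most_cball:
  fixes x :: "'a::euclidean_space"
  shows "0 \<le> r \<Longrightarrow> 2 * r \<le> \<delta> \<Longrightarrow> diam_at_most \<delta> (cball x r)"
  by (auto simp: diam_at_most_def)

text \<open>In a Euclidean space bounded sets are totally bounded, so some finite cover exists and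
  the \<open>LEAST\<close> in \<open>covering_number\<close> is attained.\<close>

lemma covering_number_attained:
  fixes F :: "'a::euclidean_space set"
  assumes "bounded F" "\<delta> > 0"
  obtains C where "finite C" "card C = covering_number \<delta> F" "F \<subseteq> \<Union>C"
    "\<And>U. U \<in> C \<Longrightarrow> diam_at_most \<delta> U"
proof -
  have "compact (closure F)" using assms by simp
  from this[unfolded compact_eq_totally_bounded, THEN conjunct2, rule_format, of "\<delta>/2"]
  obtain k where k: "finite k" "closure F \<subseteq> (\<Union>x\<in>k. ball x (\<delta>/2))"
    using assms(2) by auto
  let ?C = "(\<lambda>x. cball x (\<delta>/2)) ` k"
  have "F \<subseteq> \<Union>?C"
    using k(2) closure_subset[of F] by (auto simp: subset_iff less_imp_le) (meson less_imp_le)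
  moreover have "finite ?C" "\<forall>U\<in>?C. diam_at_most \<delta> U"
    using k assms by (auto intro!: diam_at_most_cball)
  ultimately have "\<exists>n C. finite C \<and> card C = n \<and> F \<subseteq> \<Union>C \<and> (\<forall>U\<in>C. diam_at_most \<delta> U)"
    by blast
  then have "\<exists>C. finite C \<and> card C = covering_number \<delta> F \<and> F \<subseteq> \<Union>C \<and> (\<forall>U\<in>C. diam_at_most \<delta> U)"
    unfolding covering_number_def by (rule LeastI_ex)
  then show ?thesis using that by blast
qed

lemma covering_number_le_powr:
  assumes "ln (real (covering_number \<delta> F)) / (- ln \<delta>) \<le> s" "0 < \<delta>" "\<delta> < 1" "s \<ge> 0"
  shows "real (covering_number \<delta> F) \<le> \<delta> powr (- s)"
proof (cases "covering_number \<delta> F = 0")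
  case False
  have "- ln \<delta> > 0" using assms by simp
  then have "ln (real (covering_number \<delta> F)) \<le> s * (- ln \<delta>)"
    using assms(1) by (subst (asm) pos_divide_le_eq) auto
  then have "real (covering_number \<delta> F) \<le> exp (s * (- ln \<delta>))"
    using False by (metis exp_le_cancel_iff exp_ln of_nat_0_less_iff gr0I)
  then show ?thesis using assms by (simp add: powr_def)
qed (auto)

text \<open>The case n = 0 rests on \<open>ln 0 = 0\<close>. Hence every real exponent above a box
  dimension is positive, and for such exponents \<open>diam_pow\<close> is a plain power.\<close>

lemma box_ratio_nonneg:
  assumes "0 < \<delta>" "\<delta> < 1"
  shows "0 \<le> ln (real n) / (- ln \<delta>)"
proof (rule divide_nonneg_nonneg)
  show "0 \<le> ln (real n)" by (cases n) auto
  show "0 \<le> - ln \<delta>" using assms by simp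
qed

text \<open>A cover by at most \<delta> powr (-s') sets of diameter at most \<delta> has s-sum at
  most \<delta> powr (s - s'), which tends to 0. Arbitrarily small scales suffice, and these are
  what the lower limit supplies.\<close>

lemma hausdorff_dim_le_lower_box_dim:
  fixes F :: "'a::euclidean_space set"
  assumes "bounded F"
  shows "hausdorff_dim F \<le> lower_box_dim F"
proof (rule ereal_le_if_less_real)
  let ?q = "\<lambda>\<delta>. ln (real (covering_number \<delta> F)) / (- ln \<delta>)"
  fix s assume s: "lower_box_dim F < ereal s"
  then obtain s' where s': "lower_box_dim F < ereal s'" "s' < s"
    using ereal_dense2 by force
  have small: "\<exists>\<delta>>0. \<delta> < \<eta> \<and> ?q \<delta> < s'" if "\<eta> > 0" for \<eta>
  proof (rule ccontr)
    assume "\<not> ?thesis"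
    then have "eventually (\<lambda>\<delta>. ereal s' \<le> ereal (?q \<delta>)) (at_right 0)"
      unfolding eventually_at_right_field using that by force
    then have "ereal s' \<le> lower_box_dim F"
      unfolding lower_box_dim_def by (rule Liminf_bounded)
    then show False using s' by simp
  qed
  have "s' > 0"
  proof -
    obtain \<delta> where "\<delta> > 0" "\<delta> < 1" "?q \<delta> < s'" using small[of 1] by auto
    then show ?thesis using box_ratio_nonneg[of \<delta> "covering_number \<delta> F"] by linarith
  qed
  have "hausdorff_measure s F = 0"
  proof (rule hausdorff_measure_eq_0I)
    fix \<epsilon> \<eta> :: real assume "\<epsilon> > 0" "\<eta> > 0"
    \<comment> \<open>Below \<open>m\<close> the scale respects \<eta> and satisfies \<delta> powr
      (s - s') \<le> \<epsilon>; the entry 1 makes the logarithm of \<delta> negative.\<close>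
    define m where "m = Min {1, \<eta>, \<epsilon> powr (1 / (s - s'))}"
    have "m > 0" using \<open>\<epsilon> > 0\<close> \<open>\<eta> > 0\<close> by (simp add: m_def)
    then obtain \<delta> where d: "\<delta> > 0" "\<delta> < m" "?q \<delta> < s'" using small by blast
    then have d': "\<delta> < 1" "\<delta> \<le> \<eta>" "\<delta> < \<epsilon> powr (1 / (s - s'))" by (auto simp: m_def)
    obtain C where C: "finite C" "card C = covering_number \<delta> F" "F \<subseteq> \<Union>C"
        "\<And>U. U \<in> C \<Longrightarrow> diam_at_most \<delta> U"
      using covering_number_attained[OF assms \<open>\<delta> > 0\<close>] by blast
    have "hausdorff_premeasure s \<eta> F \<le> ennreal (real (card C) * \<delta> powr s)"
      using C d d' \<open>s' > 0\<close> \<open>s' < s\<close> by (intro hausdorff_premeasure_finite_cover) auto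
    also have "real (card C) * \<delta> powr s \<le> \<delta> powr (- s') * \<delta> powr s"
      using covering_number_le_powr[of \<delta> F s'] d d' \<open>s' > 0\<close> C
      by (intro mult_right_mono) auto
    also have "\<dots> = \<delta> powr (s - s')" by (simp add: powr_add[symmetric])
    also have "\<dots> \<le> (\<epsilon> powr (1 / (s - s'))) powr (s - s')"
      using d d' s' by (intro powr_mono2) auto
    also have "\<dots> = \<epsilon>" using \<open>\<epsilon> > 0\<close> s' by (simp add: powr_powr)
    finally show "hausdorff_premeasure s \<eta> F \<le> ennreal \<epsilon>" by (simp add: ennreal_leI)
  qed
  then show "hausdorff_dim F \<le> ereal s"
    using \<open>s' > 0\<close> s' by (intro hausdorff_dim_le) auto
qed

lemma lower_box_dim_le_upper_box_dim: "lower_box_dim F \<le> upper_box_dim F"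
  unfolding lower_box_dim_def upper_box_dim_def by (rule Liminf_le_Limsup) simp

section \<open>Packing dimension against upper box dimension\<close>

lemma infsum_ennreal_le:
  fixes f :: "'b \<Rightarrow> ennreal"
  assumes "\<And>X. finite X \<Longrightarrow> X \<subseteq> P \<Longrightarrow> sum f X \<le> b"
  shows "infsum f P \<le> b"
  by (subst nonneg_infsum_complete) (auto intro!: SUP_least assms)

text \<open>Assign to each ball a covering set containing its centre. Two centres in one set are at
  distance at most \<rho>, less than either radius, so the balls would meet.\<close>

lemma packing_card_le:
  assumes P: "X \<subseteq> P" "P \<in> packings \<delta> F" "finite X" and r: "\<And>x r. (x, r) \<in> X \<Longrightarrow> r > \<rho>"
    and C: "finite C" "F \<subseteq> \<Union>C" "\<And>U. U \<in> C \<Longrightarrow> diam_at_most \<rho> U"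
  shows "card X \<le> card C"
proof -
  have "\<forall>z\<in>X. \<exists>U\<in>C. fst z \<in> U"
    using P C by (fastforce simp: packings_def)
  then obtain g where g: "\<And>z. z \<in> X \<Longrightarrow> g z \<in> C \<and> fst z \<in> g z" by metis
  have "inj_on g X"
  proof (rule inj_onI, rule ccontr)
    fix a b assume ab: "a \<in> X" "b \<in> X" "g a = g b" "a \<noteq> b"
    obtain x r y t where [simp]: "a = (x, r)" "b = (y, t)" by (cases a; cases b)
    have "dist x y \<le> diameter (g a)"
      using g[OF ab(1)] g[OF ab(2)] ab C(3) by (auto intro!: diameter_bounded_bound simp: diam_at_most_def)
    also have "\<dots> \<le> \<rho>" using C(3) g[OF ab(1)] by (auto simp: diam_at_most_def)
    also have "\<dots> < r" using r ab by auto
    finally have "y \<in> cball x r" by auto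
    moreover have "b \<in> F \<times> {0<..\<delta>}" using P(1,2) ab(2) unfolding packings_def by blast
    then have "y \<in> cball y t" by simp
    moreover have "disjoint_family_on (\<lambda>(x, r). cball x r) P" using P(2) by (simp add: packings_def)
    then have "cball x r \<inter> cball y t = {}"
      using disjoint_family_onD[of _ P a b] ab P(1) by auto
    ultimately show False by blast
  qed
  then show ?thesis using g C by (intro card_inj_on_le[of g]) auto
qed

lemma packing_sum_le:
  fixes F :: "'a::euclidean_space set"
  assumes F: "bounded F" and s: "0 < s'" "s' < s" and \<delta>: "0 < \<delta>"
    and N: "\<And>\<eta>. 0 < \<eta> \<Longrightarrow> \<eta> \<le> \<delta> \<Longrightarrow> real (covering_number \<eta> F) \<le> \<eta> powr (- s')"
    and P: "P \<in> packings \<delta> F"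
  shows "(\<Sum>\<^sub>\<infinity>(x, r)\<in>P. diam_pow s (cball x r)) \<le>
    ennreal (\<delta> powr (s - s') * (2 powr (s + s') / (1 - 2 powr (s' - s))))"
proof (rule infsum_ennreal_le)
  fix X assume X: "finite X" "X \<subseteq> P"
  \<comment> \<open>The balls are grouped dyadically by radius, and each group is counted by a covering at half its scale.\<close>
  define k where "k = (\<lambda>r. nat \<lfloor>log 2 (\<delta> / r)\<rfloor>)"
  have rad: "0 < r" "r \<le> \<delta>" if "(x, r) \<in> X" for x r using that X P by (auto simp: packings_def)
  have kr: "r \<le> \<delta> * 2 powr (- real (k r))" "\<delta> * 2 powr (- real (k r) - 1) < r"
    if "(x, r) \<in> X" for x r
  proof -
    note r = rad[OF that]
    have l0: "log 2 (\<delta> / r) \<ge> 0" using r by (subst zero_le_log_cancel_iff) auto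
    then have "real (k r) \<le> log 2 (\<delta> / r)" "log 2 (\<delta> / r) < real (k r) + 1"
      unfolding k_def by linarith+
    then have "2 powr real (k r) \<le> \<delta> / r" "\<delta> / r < 2 powr (real (k r) + 1)"
      using r \<delta> by (auto simp: le_log_iff log_less_iff)
    then show "r \<le> \<delta> * 2 powr (- real (k r))" "\<delta> * 2 powr (- real (k r) - 1) < r"
      using r by (auto simp: powr_minus powr_diff powr_add field_simps)
  qed
  \<comment> \<open>The radii of group n lie above \<rho> = \<delta> 2^(-n-1) and are at most
    \<delta> 2^(-n). The bound \<open>b n\<close> is the count \<rho> powr (-s') times the largest
    possible summand; it is geometric with ratio 2 powr (s' - s) < 1.\<close>
  define b where "b = (\<lambda>n::nat. \<delta> powr (s - s') * 2 powr (s + s') * (2 powr (s' - s)) ^ n)"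
  have bk: "(\<Sum>(x, r)\<in>{z \<in> X. k (snd z) = n}. (2 * r) powr s) \<le> b n" for n
  proof -
    let ?Y = "{z \<in> X. k (snd z) = n}" and ?\<rho> = "\<delta> * 2 powr (- real n - 1)"
    have "?\<rho> \<le> \<delta> * 2 powr 0" using \<delta> by (intro mult_left_mono powr_mono) auto
    then have \<rho>: "?\<rho> > 0" "?\<rho> \<le> \<delta>" using \<delta> by simp_all
    obtain C where C: "finite C" "card C = covering_number ?\<rho> F" "F \<subseteq> \<Union>C"
        "\<And>U. U \<in> C \<Longrightarrow> diam_at_most ?\<rho> U"
      using covering_number_attained[OF F \<rho>(1)] by blast
    have "card ?Y \<le> card C"
      by (rule packing_card_le[OF _ P, where \<rho> = ?\<rho>]) (use X C kr in auto)
    then have cY: "real (card ?Y) \<le> ?\<rho> powr (- s')"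
      using N[OF \<rho>] C by linarith
    have "(2 * r) powr s \<le> (2 * (\<delta> * 2 powr (- real n))) powr s" if "(x, r) \<in> ?Y" for x r
      using kr[of x r] rad[of x r] s that by (intro powr_mono2) auto
    then have "(\<Sum>(x, r)\<in>?Y. (2 * r) powr s) \<le> (\<Sum>(x, r)\<in>?Y. (2 * (\<delta> * 2 powr (- real n))) powr s)"
      by (intro sum_mono) auto
    also have "\<dots> = real (card ?Y) * (2 * (\<delta> * 2 powr (- real n))) powr s"
      by (simp add: case_prod_unfold)
    also have "\<dots> \<le> ?\<rho> powr (- s') * (2 * (\<delta> * 2 powr (- real n))) powr s"
      using cY by (rule mult_right_mono) auto
    also have "\<dots> = b n"
    proof -
      have "?\<rho> powr (- s') = \<delta> powr (- s') * 2 powr (s' * real n + s')"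
        using \<delta> by (simp add: powr_mult powr_powr algebra_simps)
      moreover have "(2 * (\<delta> * 2 powr (- real n))) powr s = 2 powr s * (\<delta> powr s * 2 powr (- s * real n))"
        using \<delta> by (simp add: powr_mult powr_powr algebra_simps)
      moreover have "(2 powr (s' - s)) ^ n = 2 powr ((s' - s) * real n)"
        by (simp add: powr_realpow[symmetric] powr_powr)
      ultimately show ?thesis unfolding b_def
        by (simp add: powr_add powr_diff powr_minus left_diff_distrib) (simp add: field_simps)
    qed
    finally show ?thesis .
  qed
  have "2 powr (s' - s) < 2 powr (0::real)" using s by (intro powr_less_mono) auto
  then have q: "2 powr (s' - s) < (1::real)" by simp
  have "(\<Sum>(x, r)\<in>X. diam_pow s (cball x r)) = (\<Sum>(x, r)\<in>X. ennreal ((2 * r) powr s))"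
  proof (intro sum.cong refl)
    fix z assume "z \<in> X"
    then show "(case z of (x, r) \<Rightarrow> diam_pow s (cball x r)) = (case z of (x, r) \<Rightarrow> ennreal ((2 * r) powr s))"
      using rad[of "fst z" "snd z"] s by (cases z) (simp add: diam_pow_pos)
  qed
  also have "\<dots> = ennreal (\<Sum>(x, r)\<in>X. (2 * r) powr s)"
    by (simp add: case_prod_unfold)
  also have "(\<Sum>(x, r)\<in>X. (2 * r) powr s) = (\<Sum>n\<in>(k \<circ> snd) ` X. \<Sum>(x, r)\<in>{z \<in> X. k (snd z) = n}. (2 * r) powr s)"
    using X by (subst sum.image_gen[of X _ "k \<circ> snd"]) auto
  also have "\<dots> \<le> (\<Sum>n\<in>(k \<circ> snd) ` X. b n)" by (intro sum_mono bk)
  also have "\<dots> \<le> (\<Sum>n. b n)"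
    using X q by (intro sum_le_suminf) (auto simp: b_def)
  also have "\<dots> = \<delta> powr (s - s') * (2 powr (s + s') / (1 - 2 powr (s' - s)))"
    unfolding b_def using q by (subst suminf_mult) (auto simp: suminf_geometric)
  finally show "(\<Sum>(x, r)\<in>X. diam_pow s (cball x r)) \<le>
    ennreal (\<delta> powr (s - s') * (2 powr (s + s') / (1 - 2 powr (s' - s))))"
    by (simp add: ennreal_leI)
qed

lemma packing_dim_le_upper_box_dim:
  fixes F :: "'a::euclidean_space set"
  assumes "bounded F"
  shows "packing_dim F \<le> upper_box_dim F"
proof (rule ereal_le_if_less_real)
  let ?q = "\<lambda>\<delta>. ln (real (covering_number \<delta> F)) / (- ln \<delta>)"
  fix s assume s: "upper_box_dim F < ereal s"
  then obtain s' where s': "upper_box_dim F < ereal s'" "s' < s"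
    using ereal_dense2 by force
  have "eventually (\<lambda>\<delta>. ereal (?q \<delta>) < ereal s') (at_right 0)"
    using s'(1) unfolding upper_box_dim_def by (rule Limsup_lessD)
  then obtain \<eta>0 where e0: "\<eta>0 > 0" "\<And>\<delta>. 0 < \<delta> \<Longrightarrow> \<delta> < \<eta>0 \<Longrightarrow> ?q \<delta> < s'"
    unfolding eventually_at_right_field by auto
  define \<eta>1 where "\<eta>1 = min \<eta>0 1 / 2"
  have e1: "\<eta>1 > 0" "\<eta>1 < 1" "\<eta>1 < \<eta>0" using e0 by (auto simp: \<eta>1_def min_def)
  have "s' > 0"
    using e0(2)[OF e1(1,3)] box_ratio_nonneg[OF e1(1,2), of "covering_number \<eta>1 F"] by linarith
  have N: "real (covering_number \<eta> F) \<le> \<eta> powr (- s')" if "0 < \<eta>" "\<eta> \<le> \<eta>1" for \<eta>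
    using that e0(2)[of \<eta>] e1 \<open>s' > 0\<close> by (intro covering_number_le_powr) auto
  let ?c = "2 powr (s + s') / (1 - 2 powr (s' - s))"
  have "packing_premeasure s F \<le> ennreal (\<delta> powr (s - s') * ?c)" if "0 < \<delta>" "\<delta> \<le> \<eta>1" for \<delta>
    unfolding packing_premeasure_def
    using that N \<open>s' > 0\<close> s' assms
    by (intro INF_lower2[of \<delta>] SUP_least packing_sum_le) auto
  moreover have "((\<lambda>\<delta>. ennreal (\<delta> powr (s - s') * ?c)) \<longlongrightarrow> ennreal (0 * ?c)) (at_right 0)"
  proof (intro tendsto_intros)
    show "((\<lambda>\<delta>. \<delta> powr (s - s')) \<longlongrightarrow> 0) (at_right 0)" 
      using s' by real_asymp
  qed
  ultimately have "packing_premeasure s F \<le> ennreal (0 * ?c)"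
    using e1 by (intro tendsto_lowerbound[where F = "at_right (0::real)"])
      (auto simp: eventually_at_right_field intro!: exI[of _ \<eta>1])
  then have z: "packing_premeasure s F = 0" by simp
  \<comment> \<open>The premeasure of the whole set already vanishes, so the constant family is a
    cover with sum 0.\<close>
  have "packing_measure s F \<le> (\<Sum>i. packing_premeasure s ((\<lambda>_::nat. F) i))"
    unfolding packing_measure_def by (rule INF_lower) auto
  then have "packing_measure s F = 0" by (simp add: z)
  then show "packing_dim F \<le> ereal s"
    unfolding packing_dim_def using \<open>s' > 0\<close> s' by (intro INF_lower) auto
qed

section \<open>Hausdorff dimension against packing dimension\<close>

text \<open>Take a maximal family of disjoint r-balls centred in A. The finite premeasure bounds its
  size by K (2 r) powr (-s), and by maximality the balls of radius 2 r cover A. The t-sum is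
  therefore at most K 2^t (2 r) powr (t - s), which is small for small r.\<close>

lemma hausdorff_measure_eq_0_if_packing_finite:
  fixes A :: "'a::euclidean_space set"
  assumes fin: "packing_premeasure s A < top" and s: "0 \<le> s" "s < t"
  shows "hausdorff_measure t A = 0"
proof (rule hausdorff_measure_eq_0I)
  fix \<epsilon> \<delta> :: real assume "\<epsilon> > 0" "\<delta> > 0"
  obtain \<eta> where \<eta>: "\<eta> > 0"
      "(SUP P\<in>packings \<eta> A. \<Sum>\<^sub>\<infinity>(x, r)\<in>P. diam_pow s (cball x r)) < top"
    using fin unfolding packing_premeasure_def INF_less_iff by auto
  then obtain K where K: "K \<ge> 0"
      "(SUP P\<in>packings \<eta> A. \<Sum>\<^sub>\<infinity>(x, r)\<in>P. diam_pow s (cball x r)) = ennreal K"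
    by (cases "SUP P\<in>packings \<eta> A. \<Sum>\<^sub>\<infinity>(x, r)\<in>P. diam_pow s (cball x r)") auto
  have "((\<lambda>r. K * 2 powr t * (2 * r) powr (t - s)) \<longlongrightarrow> K * 2 powr t * 0) (at_right 0)"
  proof (intro tendsto_intros)
    show "((\<lambda>r. (2 * r) powr (t - s)) \<longlongrightarrow> 0) (at_right 0)"
      using s by real_asymp
  qed
  then have "eventually (\<lambda>r. K * 2 powr t * (2 * r) powr (t - s) < \<epsilon>) (at_right 0)"
    using \<open>\<epsilon> > 0\<close> by (intro order_tendstoD) auto
  moreover have "eventually (\<lambda>r. r < min \<eta> (\<delta> / 4)) (at_right 0)"
    unfolding eventually_at_right_field
    using \<eta> \<open>\<delta> > 0\<close> by (intro exI[of _ "min \<eta> (\<delta> / 4)"]) simp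
  moreover have "eventually (\<lambda>r. r > 0) (at_right (0::real))"
    by (rule eventually_at_right_less)
  ultimately have "eventually (\<lambda>r. K * 2 powr t * (2 * r) powr (t - s) < \<epsilon> \<and> r < min \<eta> (\<delta> / 4) \<and> r > 0) (at_right 0)"
    by eventually_elim blast
  then obtain r where r: "K * 2 powr t * (2 * r) powr (t - s) < \<epsilon>" "r < \<eta>" "r < \<delta> / 4" "r > 0"
    using eventually_happens'[of "at_right (0::real)"] by auto
  define Q where "Q = (\<lambda>X. finite X \<and> X \<subseteq> A \<and> disjoint_family_on (\<lambda>x. cball x r) X)"
  have cardK: "real (card X) * (2 * r) powr s \<le> K" if "Q X" for X
  proof -
    let ?P = "(\<lambda>x. (x, r)) ` X"
    have P: "?P \<in> packings \<eta> A"
      using that r by (auto simp: packings_def Q_def disjoint_family_on_def)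
    have "ennreal (real (card X) * (2 * r) powr s) = (\<Sum>x\<in>X. ennreal ((2 * r) powr s))"
      using r by (simp add: ennreal_mult ennreal_of_nat_eq_real_of_nat)
    also have "\<dots> = (\<Sum>x\<in>X. diam_pow s (cball x r))"
      using r s by (intro sum.cong) (auto simp: diam_pow_def)
    also have "\<dots> = (\<Sum>(x, r)\<in>?P. diam_pow s (cball x r))"
      by (subst sum.reindex) (auto simp: inj_on_def)
    also have "\<dots> = (\<Sum>\<^sub>\<infinity>(x, r)\<in>?P. diam_pow s (cball x r))"
      using that by (subst infsum_finite) (auto simp: Q_def)
    also have "\<dots> \<le> ennreal K"
      unfolding K(2)[symmetric] using P by (rule SUP_upper)
    finally show ?thesis using K by (simp add: ennreal_le_iff)
  qed
  have pr: "(2 * r) powr s > 0" using r by simp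
  have bd: "\<forall>X. Q X \<longrightarrow> card X < Suc (nat \<lceil>K / (2 * r) powr s\<rceil>)"
  proof (intro allI impI)
    fix X assume "Q X"
    then have "real (card X) \<le> K / (2 * r) powr s"
      using cardK pr by (simp add: pos_le_divide_eq)
    then show "card X < Suc (nat \<lceil>K / (2 * r) powr s\<rceil>)" by linarith
  qed
  have "Q {}" by (simp add: Q_def disjoint_family_on_def)
  from ex_has_greatest_nat[of Q, OF this bd]
  obtain X where X: "Q X" "\<And>Y. Q Y \<Longrightarrow> card Y \<le> card X" by blast
  have cov: "A \<subseteq> (\<Union>x\<in>X. cball x (2 * r))"
  proof
    fix y assume "y \<in> A"
    show "y \<in> (\<Union>x\<in>X. cball x (2 * r))"
    proof (rule ccontr)
      assume n: "y \<notin> (\<Union>x\<in>X. cball x (2 * r))"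
      have dj: "cball x r \<inter> cball y r = {}" if "x \<in> X" for x
      proof (rule disjoint_cballI)
        show "r + r < dist x y" using n that by (auto simp: not_le)
      qed
      then have "Q (insert y X)"
        using X(1) \<open>y \<in> A\<close> unfolding Q_def disjoint_family_on_def by blast
      moreover have "y \<notin> X" using n r by auto
      ultimately show False using X(1) X(2)[of "insert y X"] by (simp add: Q_def)
    qed
  qed
  have "hausdorff_premeasure t \<delta> A \<le> ennreal (real (card ((\<lambda>x. cball x (2 * r)) ` X)) * (4 * r) powr t)"
    using X(1) cov r s
    by (intro hausdorff_premeasure_finite_cover) (auto simp: Q_def intro!: diam_at_most_cball)
  also have "\<dots> \<le> ennreal (real (card X) * (4 * r) powr t)"
    using X(1) by (intro ennreal_leI mult_right_mono) (auto simp: Q_def card_image_le)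
  also have "\<dots> \<le> ennreal \<epsilon>"
  proof (rule ennreal_leI)
    have "(4 * r) powr t = 2 powr t * (2 * r) powr (t - s) * (2 * r) powr s"
      using r by (simp add: powr_mult[symmetric] powr_add[symmetric] mult.assoc)
    then have "real (card X) * (4 * r) powr t = (real (card X) * (2 * r) powr s) * (2 powr t * (2 * r) powr (t - s))"
      by simp
    also have "\<dots> \<le> K * (2 powr t * (2 * r) powr (t - s))"
      using cardK[OF X(1)] by (intro mult_right_mono) auto
    also have "\<dots> \<le> \<epsilon>" using r by simp
    finally show "real (card X) * (4 * r) powr t \<le> \<epsilon>" .
  qed
  finally show "hausdorff_premeasure t \<delta> A \<le> ennreal \<epsilon>" .
qed

lemma hausdorff_measure_eq_0_UN:
  assumes F: "F \<subseteq> (\<Union>i::nat. A i)" and A: "\<And>i. hausdorff_measure t (A i) = 0"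
  shows "hausdorff_measure t F = 0"
proof (rule hausdorff_measure_eq_0I)
  fix \<epsilon> \<delta> :: real assume "\<epsilon> > 0" "\<delta> > 0"
  have "\<exists>U. A i \<subseteq> (\<Union>n::nat. U n) \<and> (\<forall>n. diam_at_most \<delta> (U n)) \<and>
      (\<Sum>n. diam_pow t (U n)) < ennreal (\<epsilon> * (1/2) ^ Suc i)" for i
  proof -
    have "hausdorff_premeasure t \<delta> (A i) < ennreal (\<epsilon> * (1/2) ^ Suc i)"
      using hausdorff_measure_eq_0_premeasure[OF A \<open>\<delta> > 0\<close>] \<open>\<epsilon> > 0\<close> by simp
    then show ?thesis unfolding hausdorff_premeasure_def INF_less_iff by auto
  qed
  then obtain U where U: "\<And>i. A i \<subseteq> (\<Union>n::nat. U i n)" "\<And>i n. diam_at_most \<delta> (U i n)"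
      "\<And>i. (\<Sum>n. diam_pow t (U i n)) < ennreal (\<epsilon> * (1/2) ^ Suc i)"
    by metis
  define W where "W = (\<lambda>k. case_prod U (prod_decode k))"
  have "F \<subseteq> (\<Union>k. W k)"
  proof
    fix y assume "y \<in> F"
    then obtain i n where "y \<in> U i n" using F U(1) by blast
    then have "y \<in> W (prod_encode (i, n))" by (simp add: W_def)
    then show "y \<in> (\<Union>k. W k)" by blast
  qed
  then have "hausdorff_premeasure t \<delta> F \<le> (\<Sum>k. diam_pow t (W k))"
    using U(2) by (intro hausdorff_premeasure_le) (auto simp: W_def split: prod.split)
  also have "\<dots> = (\<Sum>k. (\<lambda>(i, n). diam_pow t (U i n)) (prod_decode k))"
    by (simp add: W_def case_prod_unfold)
  also have "\<dots> = (\<Sum>i. \<Sum>n. diam_pow t (U i n))"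
    by (rule suminf_ennreal_2dimen) simp
  also have "\<dots> \<le> (\<Sum>i. ennreal (\<epsilon> * (1/2) ^ Suc i))"
    using U(3) by (intro suminf_le) (auto intro: less_imp_le)
  also have "\<dots> = ennreal (\<Sum>i. \<epsilon> * (1/2) ^ Suc i)"
    using \<open>\<epsilon> > 0\<close> power_half_series by (intro suminf_ennreal2 summable_mult) (auto simp: sums_iff)
  also have "(\<Sum>i. \<epsilon> * (1/2) ^ Suc i) = \<epsilon>"
    using sums_mult[OF power_half_series, of \<epsilon>] by (simp add: sums_iff)
  finally show "hausdorff_premeasure t \<delta> F \<le> ennreal \<epsilon>" .
qed

text \<open>A packing measure below 1 yields a countable cover by sets of finite packing premeasure.
  On each of them the Hausdorff measure vanishes for every larger exponent, and null sets are stable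
  under countable unions.\<close>

lemma hausdorff_dim_le_packing_dim:
  fixes F :: "'a::euclidean_space set"
  shows "hausdorff_dim F \<le> packing_dim F"
  unfolding packing_dim_def
proof (rule INF_greatest)
  fix s assume "s \<in> {s. 0 \<le> s \<and> packing_measure s F = 0}"
  then have s: "0 \<le> s" "packing_measure s F < 1" by auto
  then obtain A where A: "F \<subseteq> (\<Union>i. A i)" "(\<Sum>i. packing_premeasure s (A i)) < 1"
    unfolding packing_measure_def INF_less_iff by auto
  have "packing_premeasure s (A i) < top" for i
    using ennreal_suminf_lessD[OF A(2), of i] by (rule order_less_trans) simp
  note fin = this
  show "hausdorff_dim F \<le> ereal s"
  proof (rule ereal_le_if_less_real)
    fix t assume "ereal s < ereal t"
    then have "s < t" by simp
    have "hausdorff_measure t F = 0"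
      by (rule hausdorff_measure_eq_0_UN[OF A(1)])
        (rule hausdorff_measure_eq_0_if_packing_finite[OF fin s(1) \<open>s < t\<close>])
    then show "hausdorff_dim F \<le> ereal t" using s \<open>s < t\<close> by (intro hausdorff_dim_le) auto
  qed
qed

text \<open>Dyadic scales suffice: passing from \<delta> to the next finer scale C 2^(-k) changes
  the bound on the count by a constant factor only, which disappears on division by - ln
  \<delta>.\<close>

lemma upper_box_dim_leI:
  assumes C: "C > 0" and t: "t \<ge> 0"
    and ev: "eventually (\<lambda>k. \<exists>\<C>. finite \<C> \<and> F \<subseteq> \<Union>\<C> \<and> (\<forall>U\<in>\<C>. diam_at_most (C * (1/2) ^ k) U) \<and>
      real (card \<C>) \<le> 2 powr (real k * t)) sequentially"
  shows "upper_box_dim F \<le> ereal t"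
proof -
  let ?q = "\<lambda>\<delta>. ln (real (covering_number \<delta> F)) / (- ln \<delta>)"
  let ?g = "\<lambda>\<delta>. t * (ln C + ln 2 - ln \<delta>) / (- ln \<delta>)"
  obtain K where K: "\<And>k. k \<ge> K \<Longrightarrow> \<exists>\<C>. finite \<C> \<and> F \<subseteq> \<Union>\<C> \<and>
      (\<forall>U\<in>\<C>. diam_at_most (C * (1/2) ^ k) U) \<and> real (card \<C>) \<le> 2 powr (real k * t)"
    using ev unfolding eventually_sequentially by blast
  have le: "?q \<delta> \<le> ?g \<delta>" if \<delta>: "0 < \<delta>" "\<delta> < 1" "\<delta> < C / 2 ^ K" for \<delta>
  proof (rule divide_right_mono)
    define k where "k = nat \<lceil>log 2 (C / \<delta>)\<rceil>"
    have "2 ^ K < C / \<delta>" using \<delta> by (simp add: field_simps)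
    then have l: "real K < log 2 (C / \<delta>)"
      using \<delta> C by (simp add: less_log_iff powr_realpow)
    then have k: "log 2 (C / \<delta>) \<le> real k" "real k \<le> log 2 (C / \<delta>) + 1" "k \<ge> K"
      unfolding k_def by linarith+
    obtain \<C> where \<C>: "finite \<C>" "F \<subseteq> \<Union>\<C>" "\<And>U. U \<in> \<C> \<Longrightarrow> diam_at_most (C * (1/2) ^ k) U"
        "real (card \<C>) \<le> 2 powr (real k * t)"
      using K[OF k(3)] by blast
    have "C / \<delta> \<le> 2 ^ k"
      using k(1) \<delta> C by (simp add: log_le_iff powr_realpow)
    then have "C * (1/2) ^ k \<le> \<delta>" using \<delta> by (simp add: field_simps power_one_over)
    then have "covering_number \<delta> F \<le> card \<C>"
      using \<C> by (intro covering_number_le) (auto simp: diam_at_most_def intro: order_trans)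
    then have c: "real (covering_number \<delta> F) \<le> 2 powr (real k * t)" using \<C>(4) by linarith
    have "ln (real (covering_number \<delta> F)) \<le> real k * t * ln 2"
    proof (cases "covering_number \<delta> F = 0")
      case False
      then have "ln (real (covering_number \<delta> F)) \<le> ln (2 powr (real k * t))" using c by (subst ln_le_cancel_iff) auto
      then show ?thesis by (simp add: ln_powr)
    qed (use t in auto)
    also have "\<dots> = t * (real k * ln 2)" by simp
    also have "\<dots> \<le> t * ((log 2 (C / \<delta>) + 1) * ln 2)"
      using k t by (intro mult_left_mono mult_right_mono) auto
    also have "(log 2 (C / \<delta>) + 1) * ln 2 = ln C + ln 2 - ln \<delta>"
      using C \<delta> by (simp add: log_def ln_div field_simps)
    finally show "ln (real (covering_number \<delta> F)) \<le> t * (ln C + ln 2 - ln \<delta>)" .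
    show "0 \<le> - ln \<delta>" using \<delta> by simp
  qed
  have "eventually (\<lambda>\<delta>. ereal (?q \<delta>) \<le> ereal (?g \<delta>)) (at_right 0)"
    unfolding eventually_at_right_field
    using le C by (intro exI[of _ "min 1 (C / 2 ^ K)"]) auto
  then have "upper_box_dim F \<le> Limsup (at_right 0) (\<lambda>\<delta>. ereal (?g \<delta>))"
    unfolding upper_box_dim_def by (rule Limsup_mono)
  also have "\<dots> = ereal t"
  proof (rule lim_imp_Limsup)
    have "(?g \<longlongrightarrow> t) (at_right 0)" by real_asymp
    then show "((\<lambda>\<delta>. ereal (?g \<delta>)) \<longlongrightarrow> ereal t) (at_right 0)" by simp
  qed simp
  finally show ?thesis .
qed

section \<open>A lower bound for the content of the limit set of a tree\<close>

text \<open>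
  If the covering sets were too small, one could keep choosing children for which \<open>p\<^sup>n \<mu>\<close>
  exceeds the total weight of the covering sets meeting the piece, where \<open>p = r\<^sup>s\<close>; a set still met
  at depth \<open>n\<close> is then too small to meet two children.  The limit point of such a branch is
  uncovered.
\<close>

lemma tree_content:
  fixes child :: "'n \<Rightarrow> 'n set" and P :: "'n \<Rightarrow> 'a::heine_borel set" and \<mu> :: "'n \<Rightarrow> real"
    and depth :: "'n \<Rightarrow> nat"
  assumes root: "z \<in> T" "depth z = 0"
    and child: "\<And>m c. m \<in> T \<Longrightarrow> c \<in> child m \<Longrightarrow> c \<in> T \<and> depth c = Suc (depth m) \<and> P c \<subseteq> P m"
    and fin: "\<And>m. m \<in> T \<Longrightarrow> finite (child m)"
    and \<mu>: "\<And>m. m \<in> T \<Longrightarrow> 0 \<le> \<mu> m \<and> \<mu> m \<le> 1 \<and> \<mu> m \<le> r powr s * (\<Sum>c\<in>child m. \<mu> c)"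
    and cpt: "\<And>m. m \<in> T \<Longrightarrow> compact (P m) \<and> P m \<noteq> {}"
    and sep: "\<And>m c c' x y. m \<in> T \<Longrightarrow> c \<in> child m \<Longrightarrow> c' \<in> child m \<Longrightarrow> c \<noteq> c' \<Longrightarrow>
      x \<in> P c \<Longrightarrow> y \<in> P c' \<Longrightarrow> b * r ^ depth m < dist x y"
    and pos: "0 < r" "r < 1" "0 < s" "0 < b"
    and limit: "\<And>f y. f 0 = z \<Longrightarrow> (\<And>n. f n \<in> T \<and> f (Suc n) \<in> child (f n)) \<Longrightarrow>
      (\<And>n. y \<in> P (f n)) \<Longrightarrow> y \<in> K"
    and cover: "K \<subseteq> (\<Union>i. U i)" "\<And>i. bounded (U i)"
  shows "ennreal (b powr s * \<mu> z) \<le> (\<Sum>i. diam_pow s (U i))"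
proof (rule ccontr)
  assume "\<not> ?thesis"
  then have less: "(\<Sum>i. diam_pow s (U i)) < ennreal (b powr s * \<mu> z)" by simp
  define d where "d = (\<lambda>i. diameter (U i) powr s)"
  have d0: "d i \<ge> 0" for i by (simp add: d_def)
  have dd: "(\<Sum>i. diam_pow s (U i)) = (\<Sum>i. ennreal (d i))"
    using pos by (simp add: diam_pow_pos d_def)
  have sd: "summable d"
    using less unfolding dd by (intro summable_suminf_not_top d0) auto
  have "ennreal (\<Sum>i. d i) < ennreal (b powr s * \<mu> z)"
    using less unfolding dd by (subst (asm) suminf_ennreal2[OF d0 sd])
  then have D: "(\<Sum>i. d i) < b powr s * \<mu> z"
    using d0 by (subst (asm) ennreal_less_iff) (auto intro!: suminf_nonneg sd)
  define \<eta> where "\<eta> = \<mu> z - (\<Sum>i. d i) / b powr s"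
  have bs: "b powr s > 0" using pos by simp
  have \<eta>: "\<eta> > 0" using D bs by (simp add: \<eta>_def pos_divide_less_eq mult.commute)
  \<comment> \<open>The second summand gives a positive weight to sets of diameter \<open>0\<close> as well.\<close>
  define a where "a = (\<lambda>i. d i / b powr s + \<eta> / 2 * (1/2) ^ Suc i)"
  have a_pos: "a i > 0" for i
    using \<eta> d0[of i] bs by (auto simp: a_def intro!: add_nonneg_pos divide_nonneg_pos)
  have a_sums: "a sums ((\<Sum>i. d i) / b powr s + \<eta> / 2 * 1)"
    unfolding a_def by (intro sums_add sums_divide sums_mult summable_sums[OF sd] power_half_series)
  \<comment> \<open>The total weight of the covering sets that meet the piece of m. The predicate
    \<open>inv\<close> below says that this is less than the mass p^n \<mu> carried by the piece at
    depth n.\<close>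
  define A where "A = (\<lambda>m. \<Sum>i. if U i \<inter> P m \<noteq> {} then a i else 0)"
  have sa: "summable a" and suma: "(\<Sum>i. a i) = (\<Sum>i. d i) / b powr s + \<eta> / 2"
    using a_sums by (simp_all add: sums_iff)
  note a0 = less_imp_le[OF a_pos] abs_of_pos[OF a_pos]
  have sm: "summable (\<lambda>i. if Q i then a i else 0)" for Q
    by (rule summable_comparison_test'[OF sa, of 0]) (simp add: a0)
  have A_ge: "a i \<le> A m" if "U i \<inter> P m \<noteq> {}" for i m
    using sum_le_suminf[OF sm[of "\<lambda>i. U i \<inter> P m \<noteq> {}"], of "{i}"] that
    by (simp add: A_def a0)
  let ?p = "r powr s"
  have p: "0 < ?p" "?p < 1" using pos powr_less_mono2[of s r 1] by auto
  define inv where "inv = (\<lambda>m. m \<in> T \<and> A m < ?p ^ depth m * \<mu> m)"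
  have inv_z: "inv z"
  proof -
    have "A z \<le> (\<Sum>i. a i)" unfolding A_def
      by (rule suminf_le[OF _ sm sa]) (simp add: a0)
    also have "\<dots> < \<mu> z" using \<eta> suma \<eta>_def by linarith
    finally show ?thesis using root by (simp add: inv_def)
  qed
  have a_less: "a i < ?p ^ depth m" if "inv m" "U i \<inter> P m \<noteq> {}" for i m
  proof -
    have "a i < ?p ^ depth m * \<mu> m" using A_ge[OF that(2)] that(1) by (auto simp: inv_def)
    also have "\<dots> \<le> ?p ^ depth m * 1"
      using that \<mu> p by (intro mult_left_mono) (auto simp: inv_def)
    finally show ?thesis by simp
  qed
  have step: "\<exists>c. c \<in> child m \<and> inv c" if m: "inv m" for m
  proof (rule ccontr)
    assume n: "\<not> ?thesis"
    have mT: "m \<in> T" using m by (simp add: inv_def)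
    have nc: "?p ^ Suc (depth m) * \<mu> c \<le> A c" if "c \<in> child m" for c
      using n that child[OF mT that] by (auto simp: inv_def not_less)
    \<comment> \<open>The separation enters here: a covering set passes its weight on to at most one
      child, so summing over the children cannot increase the total.\<close>
    have one: "(\<Sum>c\<in>child m. if U i \<inter> P c \<noteq> {} then a i else 0) \<le> (if U i \<inter> P m \<noteq> {} then a i else 0)" for i
    proof (cases "U i \<inter> P m = {}")
      case True
      then have "U i \<inter> P c = {}" if "c \<in> child m" for c using child[OF mT that] by blast
      then show ?thesis by (simp add: a0)
    next
      case False
      have "d i / b powr s < a i" using \<eta> by (simp add: a_def)
      also have "\<dots> < ?p ^ depth m" using a_less[OF m False] .
      also have "\<dots> = (r ^ depth m) powr s"
        using pos by (simp add: powr_realpow[symmetric] powr_powr mult.commute)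
      finally have "d i < b powr s * (r ^ depth m) powr s" using bs by (simp add: pos_divide_less_eq mult.commute)
      then have "diameter (U i) powr s < (b * r ^ depth m) powr s"
        using pos by (simp add: powr_mult d_def)
      then have dm: "diameter (U i) < b * r ^ depth m"
        using pos powr_mono2[of s "b * r ^ depth m" "diameter (U i)"]
        by (cases "diameter (U i) < b * r ^ depth m") auto
      have uniq: "c = c'" if "c \<in> child m" "c' \<in> child m" "U i \<inter> P c \<noteq> {}" "U i \<inter> P c' \<noteq> {}" for c c'
      proof (rule ccontr)
        assume "c \<noteq> c'"
        from that(3,4) obtain x y where xy: "x \<in> U i" "x \<in> P c" "y \<in> U i" "y \<in> P c'" by blast
        have "dist x y \<le> diameter (U i)" using xy cover by (intro diameter_bounded_bound)
        moreover have "b * r ^ depth m < dist x y"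
          using sep[OF mT that(1,2) \<open>c \<noteq> c'\<close>] xy by blast
        ultimately show False using dm by linarith
      qed
      let ?H = "{c \<in> child m. U i \<inter> P c \<noteq> {}}"
      have "card ?H \<le> 1" using uniq fin[OF mT] unfolding One_nat_def by (subst card_le_Suc0_iff_eq) auto
      have "(\<Sum>c\<in>child m. if U i \<inter> P c \<noteq> {} then a i else 0) = (\<Sum>c\<in>?H. a i)"
        by (rule sum.inter_filter[symmetric]) (rule fin[OF mT])
      also have "\<dots> = real (card ?H) * a i" by simp
      also have "\<dots> \<le> 1 * a i" using \<open>card ?H \<le> 1\<close> a_pos[of i] by (intro mult_right_mono) auto
      finally show ?thesis using False by simp
    qed
    have "?p ^ depth m * \<mu> m \<le> ?p ^ depth m * (?p * (\<Sum>c\<in>child m. \<mu> c))"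
      using \<mu>[OF mT] p by (intro mult_left_mono) auto
    also have "\<dots> = (\<Sum>c\<in>child m. ?p ^ Suc (depth m) * \<mu> c)"
      by (simp add: sum_distrib_left mult.assoc mult.left_commute)
    also have "\<dots> \<le> (\<Sum>c\<in>child m. A c)" by (intro sum_mono nc)
    also have "\<dots> = (\<Sum>i. \<Sum>c\<in>child m. if U i \<inter> P c \<noteq> {} then a i else 0)"
      unfolding A_def by (rule suminf_sum[symmetric]) (rule sm)
    also have "\<dots> \<le> A m"
      unfolding A_def by (intro suminf_le one sm summable_sum)
    finally show False using m by (simp add: inv_def)
  qed
  have "\<exists>f. \<forall>n. (inv (f n) \<and> (n = 0 \<longrightarrow> f n = z)) \<and> f (Suc n) \<in> child (f n)"
  proof (rule dependent_nat_choice)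
    show "\<exists>x. inv x \<and> (0 = 0 \<longrightarrow> x = z)" using inv_z by blast
    show "\<exists>y. (inv y \<and> (Suc n = 0 \<longrightarrow> y = z)) \<and> y \<in> child x"
      if "inv x \<and> (n = 0 \<longrightarrow> x = z)" for x n
      using step[of x] that by auto
  qed
  then obtain f where f: "\<And>n. inv (f n) \<and> (n = 0 \<longrightarrow> f n = z)" "\<And>n. f (Suc n) \<in> child (f n)"
    by blast
  have fT: "f n \<in> T" for n using f(1) by (auto simp: inv_def)
  have depth_f: "depth (f n) = n" for n
  proof (induction n)
    case (Suc n) then show ?case using child[OF fT f(2)[of n]] by simp
  qed (use f(1)[of 0] root in simp)
  have dec: "P (f (Suc n)) \<subseteq> P (f n)" for n using child[OF fT f(2)] by blast
  have "P (f n) \<subseteq> P (f m)" if "m \<le> n" for m n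
    using that by (rule lift_Suc_antimono_le[of "\<lambda>n. P (f n)", rotated]) (rule dec)
  moreover have "compact (P (f n))" "P (f n) \<noteq> {}" for n using cpt[OF fT] by blast+
  ultimately have "\<Inter>(range (\<lambda>n. P (f n))) \<noteq> {}"
    by (intro compact_nest[of "\<lambda>n. P (f n)"]) 
  then obtain y where y: "\<And>n. y \<in> P (f n)" by blast
  have "f 0 = z" using f(1)[of 0] by simp
  then have "y \<in> K" by (rule limit) (use fT f(2) y in blast)+
  then obtain i where i: "y \<in> U i" using cover by auto
  \<comment> \<open>The set containing the limit point meets every piece of the branch, so its
    weight lies below p^n for all n. This is impossible because every weight is positive.\<close>
  have "a i < ?p ^ n" for n
  proof -
    have "U i \<inter> P (f n) \<noteq> {}" using i y[of n] by blast
    then show ?thesis using a_less[of "f n" i] f(1)[of n] depth_f[of n] by simp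
  qed
  moreover obtain n where "?p ^ n < a i" using real_arch_pow_inv[OF a_pos p(2)] by blast
  ultimately show False by (meson less_asym)
qed

section \<open>Words and pieces of the construction\<close>

locale random_recursive =
  fixes \<Lambda> :: "'i set"
    and V :: "'v set"
    and G :: "'i \<Rightarrow> ('v, 'e) pre_digraph"
    and \<pi> :: "'i \<Rightarrow> real"
    and c :: "'e \<Rightarrow> real"
    and S :: "'e \<Rightarrow> 'a::euclidean_space \<Rightarrow> 'a"
    and \<Delta> :: "'a set"
  assumes fin_\<Lambda>: "finite \<Lambda>"
    and graphs: "\<And>i. i \<in> \<Lambda> \<Longrightarrow> fin_digraph (G i) \<and> verts (G i) = V"
    and distinct_letters: "disjoint_family_on (\<lambda>i. arcs (G i)) \<Lambda>"
    and prob_pos: "\<And>i. i \<in> \<Lambda> \<Longrightarrow> \<pi> i > 0"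
    and prob_sum: "(\<Sum>i\<in>\<Lambda>. \<pi> i) = 1"
    and similarities: "\<And>e. e \<in> (\<Union>i\<in>\<Lambda>. arcs (G i)) \<Longrightarrow> c e \<in> {0<..<1} \<and> similarity (c e) (S e)"
    and compact_\<Delta>: "compact \<Delta>" and \<Delta>_ne: "\<Delta> \<noteq> {}"
    and seed_invariant: "\<And>e. e \<in> (\<Union>i\<in>\<Lambda>. arcs (G i)) \<Longrightarrow> S e ` \<Delta> \<subseteq> \<Delta>"
    and connected: "stochastically_strongly_connected \<Lambda> V G \<pi>"
    and offspring: "\<And>v. v \<in> V \<Longrightarrow> (\<Sum>i\<in>\<Lambda>. \<pi> i * real (card (out_arcs (G i) v))) > 1"
    and V_ne: "V \<noteq> {}"
begin

definition E :: "'e set" where "E = (\<Union>i\<in>\<Lambda>. arcs (G i))"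

definition W :: "'e list set" where "W = lists E"

text \<open>Edge sets of different graphs are disjoint, so a letter determines its graph. Hence
  \<open>tgt\<close> and \<open>endv\<close> depend on the word alone, not on the realisation of the
  labels.\<close>

definition lab :: "'e \<Rightarrow> 'i" where "lab e = (THE i. i \<in> \<Lambda> \<and> e \<in> arcs (G i))"

definition tgt :: "'e \<Rightarrow> 'v" where "tgt e = head (G (lab e)) e"

definition endv :: "'v \<Rightarrow> 'e list \<Rightarrow> 'v" where "endv j w = (if w = [] then j else tgt (last w))"

text \<open>Presence of w in the tree, written over prefixes instead of level by level. In this form
  it visibly reads only the labels of proper prefixes of w, which is the source of the independence
  arguments.\<close>

definition T :: "('e list \<Rightarrow> 'i) \<Rightarrow> 'v \<Rightarrow> 'e list \<Rightarrow> bool" where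
  "T x j w \<longleftrightarrow> (\<forall>k<length w. w ! k \<in> out_arcs (G (x (take k w))) (endv j (take k w)))"

text \<open>The labels of the subtree at w. The restriction to \<open>W\<close> makes the result
  extensional, hence again a point of the product space with carrier \<open>X0\<close>.\<close>

definition sh :: "'e list \<Rightarrow> ('e list \<Rightarrow> 'i) \<Rightarrow> 'e list \<Rightarrow> 'i" where
  "sh w x = (\<lambda>u\<in>W. x (w @ u))"

definition X0 :: "('e list \<Rightarrow> 'i) set" where "X0 = (\<Pi>\<^sub>E w\<in>W. \<Lambda>)"

definition cw :: "'e list \<Rightarrow> real" where "cw w = prod_list (map c w)"

lemma W_simps [simp]: "[] \<in> W" "w @ u \<in> W \<longleftrightarrow> w \<in> W \<and> u \<in> W" "e # w \<in> W \<longleftrightarrow> e \<in> E \<and> w \<in> W"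
  by (auto simp: W_def)

lemma take_W: "w \<in> W \<Longrightarrow> take k w \<in> W"
  unfolding W_def by (auto dest: in_set_takeD)

lemma finite_E: "finite E"
  unfolding E_def using fin_\<Lambda> graphs fin_digraph.finite_arcs by blast

lemma countable_W: "countable W"
  unfolding W_def using finite_E by (intro countable_lists countable_finite)

lemma lab_eq: "i \<in> \<Lambda> \<Longrightarrow> e \<in> arcs (G i) \<Longrightarrow> lab e = i"
  unfolding lab_def using distinct_letters by (auto simp: disjoint_family_on_def)

lemma tgt_V: "e \<in> E \<Longrightarrow> tgt e \<in> V"
proof -
  assume "e \<in> E"
  then obtain i where i: "i \<in> \<Lambda>" "e \<in> arcs (G i)" by (auto simp: E_def)
  then interpret fin_digraph "G i" using graphs by blast
  show ?thesis using head_in_verts[OF i(2)] graphs[OF i(1)] lab_eq[OF i] by (simp add: tgt_def)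
qed

lemma out_arcs_E: "i \<in> \<Lambda> \<Longrightarrow> out_arcs (G i) j \<subseteq> E"
  by (auto simp: E_def)

lemma finite_out: "i \<in> \<Lambda> \<Longrightarrow> finite (out_arcs (G i) j)"
  using out_arcs_E finite_E finite_subset by blast

lemma endv_simps [simp]: "endv j [] = j" "endv j (w @ u) = endv (endv j w) u" "endv j (e # u) = endv (tgt e) u"
  by (auto simp: endv_def)

lemma endv_V: "w \<in> W \<Longrightarrow> j \<in> V \<Longrightarrow> endv j w \<in> V"
  using last_in_set[of w] tgt_V by (auto simp: endv_def W_def)

lemma X0_D: "x \<in> X0 \<Longrightarrow> w \<in> W \<Longrightarrow> x w \<in> \<Lambda>"
  by (auto simp: X0_def)

lemma sh_X0: "x \<in> X0 \<Longrightarrow> w \<in> W \<Longrightarrow> sh w x \<in> X0"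
  by (auto simp: X0_def sh_def)

lemma sh_apply [simp]: "u \<in> W \<Longrightarrow> sh w x u = x (w @ u)"
  by (simp add: sh_def)

lemma sh_sh: "w \<in> W \<Longrightarrow> u \<in> W \<Longrightarrow> sh u (sh w x) = sh (w @ u) x"
  by (auto simp: sh_def fun_eq_iff)

lemma sh_Nil: "x \<in> X0 \<Longrightarrow> sh [] x = x"
  by (auto simp: sh_def X0_def PiE_def extensional_def fun_eq_iff)

lemma T_Nil [simp]: "T x j []"
  by (simp add: T_def)

lemma T_cong:
  assumes "\<And>k. k < length w \<Longrightarrow> x (take k w) = y (take k w)"
  shows "T x j w = T y j w"
  using assms by (auto simp: T_def)

lemma T_snoc: "T x j (w @ [e]) \<longleftrightarrow> T x j w \<and> e \<in> out_arcs (G (x w)) (endv j w)"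
  by (auto simp: T_def less_Suc_eq nth_append)

lemma T_append:
  assumes "w \<in> W" "u \<in> W"
  shows "T x j (w @ u) \<longleftrightarrow> T x j w \<and> T (sh w x) (endv j w) u"
  using assms(2)
proof (induction u rule: rev_induct)
  case (snoc e u)
  then have "T x j (w @ u @ [e]) \<longleftrightarrow> T x j (w @ u) \<and> e \<in> out_arcs (G (x (w @ u))) (endv j (w @ u))"
    using T_snoc[of x j "w @ u" e] by simp
  then show ?case using snoc by (simp add: T_snoc)
qed simp

lemma T_Cons:
  assumes "e \<in> E" "u \<in> W"
  shows "T x j (e # u) \<longleftrightarrow> e \<in> out_arcs (G (x [])) j \<and> T (sh [e] x) (tgt e) u"
  using T_append[of "[e]" u x j] T_snoc[of x j "[]" e] assms by simp

text \<open>The labels are assumed to be valid on \<open>W\<close> only, without extensionality, so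
  that this covers both the points of \<open>X0\<close> and the labels of an arbitrary probability
  space.\<close>

lemma T_W:
  assumes x: "\<forall>u\<in>W. x u \<in> \<Lambda>" and "T x j w"
  shows "w \<in> W"
  using assms(2)
proof (induction w rule: rev_induct)
  case (snoc e w)
  then have "w \<in> W" "e \<in> out_arcs (G (x w)) (endv j w)" by (auto simp: T_snoc)
  then show ?case using bspec[OF x, of w] out_arcs_E[of "x w" "endv j w"] by auto
qed simp

lemma T_prefix: "T x j w \<Longrightarrow> T x j (take k w)"
  by (auto simp: T_def min_def split: if_splits)

lemma level_words_eq:
  assumes x: "\<forall>u\<in>W. x u \<in> \<Lambda>"
  shows "level_words G x v k = {(w, endv v w) | w. T x v w \<and> length w = k}"
proof (induction k)
  case (Suc k)
  have hd: "head (G (x w)) e = tgt e" if "T x v w" "e \<in> out_arcs (G (x w)) j" for w e j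
    using lab_eq[OF bspec[OF x T_W[OF x that(1)]]] that(2) by (simp add: tgt_def)
  show ?case
  proof (intro equalityI subsetI)
    fix z assume "z \<in> level_words G x v (Suc k)"
    then obtain w e where "z = (w @ [e], head (G (x w)) e)" "T x v w" "length w = k"
        "e \<in> out_arcs (G (x w)) (endv v w)"
      by (auto simp: Suc)
    then show "z \<in> {(w, endv v w) | w. T x v w \<and> length w = Suc k}"
      using hd by (auto simp: T_snoc)
  next
    fix z assume "z \<in> {(w, endv v w) | w. T x v w \<and> length w = Suc k}"
    then obtain w where w: "z = (w, endv v w)" "T x v w" "length w = Suc k" by blast
    then obtain u e where [simp]: "w = u @ [e]" by (cases w rule: rev_cases) auto
    have "(u, endv v u) \<in> level_words G x v k" "e \<in> out_arcs (G (x u)) (endv v u)"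
      using w by (auto simp: Suc T_snoc)
    moreover have "z = (u @ [e], head (G (x u)) e)"
      using w hd by (auto simp: T_snoc)
    ultimately show "z \<in> level_words G x v (Suc k)" by (simp only: level_words.simps) blast
  qed
qed (auto)

lemma attractor_eq:
  assumes x: "\<forall>u\<in>W. x u \<in> \<Lambda>"
  shows "attractor G S \<Delta> x v = (\<Inter>k\<in>{1..}. \<Union>w\<in>{w. T x v w \<and> length w = k}. word_map S w ` \<Delta>)"
  unfolding attractor_def level_words_eq[OF x] by (intro INF_cong refl) auto

lemma word_map_simps [simp]: "word_map S [] = id" "word_map S (e # w) = S e \<circ> word_map S w"
  by (auto simp: word_map_def)

lemma word_map_append: "word_map S (w @ u) = word_map S w \<circ> word_map S u"
  by (induction w) (auto simp: o_assoc)

lemma cw_simps [simp]: "cw [] = 1" "cw (e # w) = c e * cw w" "cw (w @ u) = cw w * cw u"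
  by (auto simp: cw_def)

lemma c_E: "e \<in> E \<Longrightarrow> 0 < c e" "e \<in> E \<Longrightarrow> c e < 1"
  using similarities by (auto simp: E_def)

lemma dist_word_map: "w \<in> W \<Longrightarrow> dist (word_map S w a) (word_map S w b) = cw w * dist a b"
proof (induction w)
  case (Cons e w)
  then have "similarity (c e) (S e)" using similarities by (auto simp: E_def)
  then show ?case using Cons by (simp add: similarity_def)
qed simp

lemma cw_pos: "w \<in> W \<Longrightarrow> 0 < cw w"
  by (induction w) (auto simp: c_E)

lemma cw_le_1: "w \<in> W \<Longrightarrow> cw w \<le> 1"
proof (induction w)
  case (Cons e w)
  then show ?case using c_E[of e] cw_pos[of w] by (auto intro!: mult_le_one)
qed simp

lemma word_map_\<Delta>: "w \<in> W \<Longrightarrow> word_map S w ` \<Delta> \<subseteq> \<Delta>"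
proof (induction w)
  case (Cons e w)
  then have "S e ` \<Delta> \<subseteq> \<Delta>" "word_map S w ` \<Delta> \<subseteq> \<Delta>" using seed_invariant by (auto simp: E_def)
  then show ?case by auto
qed simp

lemma word_map_prefix: "u \<in> W \<Longrightarrow> word_map S (w @ u) ` \<Delta> \<subseteq> word_map S w ` \<Delta>"
  using word_map_\<Delta>[of u] by (auto simp: word_map_append)

lemma compact_word_map: 
  assumes "w \<in> W" shows "compact (word_map S w ` \<Delta>)"
proof (rule compact_continuous_image[OF _ compact_\<Delta>])
  have "(cw w)-lipschitz_on UNIV (word_map S w)"
    using cw_pos[OF assms] by (intro lipschitz_onI) (auto simp: dist_word_map[OF assms])
  then show "continuous_on \<Delta> (word_map S w)"
    using lipschitz_on_continuous_on continuous_on_subset by blast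
qed

lemma E_ne: "E \<noteq> {}"
proof
  assume "E = {}"
  then have "out_arcs (G i) v = {}" if "i \<in> \<Lambda>" for i v using out_arcs_E[OF that] by blast
  moreover obtain v where "v \<in> V" using V_ne by blast
  ultimately show False using offspring[of v] by simp
qed

lemma c_bounds:
  obtains cm cn where "0 < cn" "cm < 1" "\<And>e. e \<in> E \<Longrightarrow> cn \<le> c e \<and> c e \<le> cm"
proof
  show "0 < Min (c ` E)" "Max (c ` E) < 1" using finite_E E_ne c_E by auto
  show "\<And>e. e \<in> E \<Longrightarrow> Min (c ` E) \<le> c e \<and> c e \<le> Max (c ` E)" using finite_E by auto
qed

lemma cw_le_power:
  assumes "\<And>e. e \<in> E \<Longrightarrow> c e \<le> cm" "w \<in> W"
  shows "cw w \<le> cm ^ length w"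
  using assms(2)
proof (induction w)
  case (Cons e w)
  then show ?case using assms(1)[of e] cw_pos[of w] c_E[of e] by (auto intro!: mult_mono)
qed simp

end

section \<open>The law of the labels\<close>

context random_recursive
begin

definition D :: "'i measure" where "D = point_measure \<Lambda> (\<lambda>i. ennreal (\<pi> i))"

text \<open>The canonical label space. The shifts \<open>sh w\<close> act on it and preserve its
  law.\<close>

definition Om :: "('e list \<Rightarrow> 'i) measure" where "Om = (\<Pi>\<^sub>M w\<in>W. D)"

lemma space_D [simp]: "space D = \<Lambda>" and sets_D [simp, measurable_cong]: "sets D = sets (count_space \<Lambda>)"
  by (auto simp: D_def space_point_measure sets_point_measure)

lemma prob_space_D: "prob_space D"
proof
  have "emeasure D (space D) = (\<Sum>i\<in>\<Lambda>. ennreal (\<pi> i))"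
    unfolding space_D by (simp add: D_def emeasure_point_measure_finite fin_\<Lambda>)
  also have "\<dots> = ennreal (\<Sum>i\<in>\<Lambda>. \<pi> i)" using prob_pos by (intro sum_ennreal) (auto intro: less_imp_le)
  finally show "emeasure D (space D) = 1" by (simp add: prob_sum)
qed

lemma emeasure_D: "i \<in> \<Lambda> \<Longrightarrow> emeasure D {i} = ennreal (\<pi> i)"
  by (simp add: D_def emeasure_point_measure_finite fin_\<Lambda>)

lemma space_Om: "space Om = X0"
  by (simp add: Om_def space_PiM X0_def)

lemma prob_space_Om: "prob_space Om"
  unfolding Om_def by (intro prob_space_PiM prob_space_D)

sublocale Om: prob_space Om by (rule prob_space_Om)

lemma measurable_component_Om [measurable]: "w \<in> W \<Longrightarrow> (\<lambda>x. x w) \<in> Om \<rightarrow>\<^sub>M D"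
  unfolding Om_def by (rule measurable_component_singleton)

lemma measurable_sh [measurable]: "w \<in> W \<Longrightarrow> sh w \<in> Om \<rightarrow>\<^sub>M Om"
  unfolding sh_def[abs_def] using measurable_component_Om
  by (subst (2) Om_def) (intro measurable_restrict, simp)

text \<open>Prepending w is an injection of \<open>W\<close>, and an iid product is invariant under
  injective renaming of its coordinates.\<close>

lemma distr_sh: "w \<in> W \<Longrightarrow> distr Om Om (sh w) = Om"
  using distr_PiM_reindex[of W "\<lambda>_. D" "\<lambda>u. w @ u" W] prob_space_D
  unfolding Om_def sh_def[abs_def] by (auto simp: inj_on_def)

lemma indep_coordinates: "Om.indep_vars (\<lambda>_. D) (\<lambda>w x. x w) W"
proof (subst Om.indep_vars_iff_distr_eq_PiM')
  have "distr Om (Pi\<^sub>M W (\<lambda>i. D)) (\<lambda>x. \<lambda>i\<in>W. x i) = distr Om Om (sh [])"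
    by (simp add: Om_def[symmetric] sh_def[abs_def])
  also have "\<dots> = Pi\<^sub>M W (\<lambda>i. D)" by (simp add: distr_sh) (simp add: Om_def)
  also have "\<dots> = Pi\<^sub>M W (\<lambda>i. distr Om D (\<lambda>x. x i))"
    unfolding Om_def
    by (intro PiM_cong refl distr_PiM_component[symmetric] prob_space_D)
  finally show "distr Om (Pi\<^sub>M W (\<lambda>i. D)) (\<lambda>x. \<lambda>i\<in>W. x i) = Pi\<^sub>M W (\<lambda>i. distr Om D (\<lambda>x. x i))" .
qed (auto intro: W_simps(1))

section \<open>Functions of finitely many labels and the branching property\<close>

text \<open>Cylinder functions, with values compared on \<open>X0\<close> only. Since \<Lambda> is
  finite, such functions are measurable into any space that contains their values.\<close>

definition depends :: "'e list set \<Rightarrow> (('e list \<Rightarrow> 'i) \<Rightarrow> 'b) \<Rightarrow> bool" where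
  "depends Q f \<longleftrightarrow> finite Q \<and> Q \<subseteq> W \<and> (\<forall>x\<in>X0. \<forall>y\<in>X0. (\<forall>q\<in>Q. x q = y q) \<longrightarrow> f x = f y)"

lemma dependsD: "depends Q f \<Longrightarrow> finite Q" "depends Q f \<Longrightarrow> Q \<subseteq> W"
  unfolding depends_def by blast+

lemma depends_comp: "depends Q f \<Longrightarrow> depends Q (\<lambda>x. h (f x))"
  unfolding depends_def by (intro conjI ballI impI arg_cong[where f = h]) blast+

text \<open>Fills the coordinates outside Q with a fixed label. Through it a function depending on Q
  factors over the finite product on Q, where every set is measurable.\<close>

definition ext0 :: "'e list set \<Rightarrow> ('e list \<Rightarrow> 'i) \<Rightarrow> 'e list \<Rightarrow> 'i" where
  "ext0 Q y = (\<lambda>w\<in>W. if w \<in> Q then y w else (SOME i. i \<in> \<Lambda>))"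

lemma \<Lambda>_ne: "\<Lambda> \<noteq> {}" using prob_sum by auto

lemma depends_ext0:
  assumes "depends Q f" "x \<in> X0"
  shows "f (ext0 Q (restrict x Q)) = f x"
proof -
  have "(SOME i. i \<in> \<Lambda>) \<in> \<Lambda>" using \<Lambda>_ne by (simp add: some_in_eq)
  then have "ext0 Q (restrict x Q) \<in> X0" using assms(2) by (auto simp: ext0_def X0_def)
  moreover have "\<forall>q\<in>Q. ext0 Q (restrict x Q) q = x q"
    using dependsD(2)[OF assms(1)] by (auto simp: ext0_def)
  ultimately show ?thesis using assms unfolding depends_def by blast
qed

lemma sets_PiM_finite:
  assumes "finite Q" shows "sets (Pi\<^sub>M Q (\<lambda>_. D)) = Pow (PiE Q (\<lambda>_. \<Lambda>))"
proof -
  have "sets (Pi\<^sub>M Q (\<lambda>_. D)) = sets (Pi\<^sub>M Q (\<lambda>_. count_space \<Lambda>))"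
    by (intro sets_PiM_cong) auto
  also have "\<dots> = Pow (PiE Q (\<lambda>_. \<Lambda>))"
    using assms fin_\<Lambda> by (subst count_space_PiM_finite) (auto simp: countable_finite)
  finally show ?thesis .
qed

lemma measurable_PiM_finite:
  assumes "finite Q" "f \<in> PiE Q (\<lambda>_. \<Lambda>) \<rightarrow> space N"
  shows "f \<in> Pi\<^sub>M Q (\<lambda>_. D) \<rightarrow>\<^sub>M N"
proof (rule measurableI)
  have sp: "space (Pi\<^sub>M Q (\<lambda>_. D)) = PiE Q (\<lambda>_. \<Lambda>)" by (simp add: space_PiM)
  show "f x \<in> space N" if "x \<in> space (Pi\<^sub>M Q (\<lambda>_. D))" for x
    using that assms(2) unfolding sp by (rule funcset_mem[rotated])
  show "f -` A \<inter> space (Pi\<^sub>M Q (\<lambda>_. D)) \<in> sets (Pi\<^sub>M Q (\<lambda>_. D))" for A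
    unfolding sp sets_PiM_finite[OF assms(1)] by blast
qed

lemma measurable_depends:
  assumes "depends Q f" "f \<in> X0 \<rightarrow> space N"
  shows "f \<in> Om \<rightarrow>\<^sub>M N"
proof -
  note Q = dependsD[OF assms(1)]
  have "(\<lambda>x. restrict x Q) \<in> Om \<rightarrow>\<^sub>M Pi\<^sub>M Q (\<lambda>_. D)"
    unfolding Om_def by (rule measurable_restrict_subset[OF Q(2)])
  moreover have "(\<lambda>y. f (ext0 Q y)) \<in> Pi\<^sub>M Q (\<lambda>_. D) \<rightarrow>\<^sub>M N"
  proof (rule measurable_PiM_finite[OF Q(1)], rule)
    fix y assume y: "y \<in> PiE Q (\<lambda>_. \<Lambda>)"
    have "(SOME i. i \<in> \<Lambda>) \<in> \<Lambda>" using \<Lambda>_ne by (simp add: some_in_eq)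
    then have "ext0 Q y \<in> X0" using y by (auto simp: ext0_def X0_def)
    then show "f (ext0 Q y) \<in> space N" using assms(2) by (rule funcset_mem[rotated])
  qed
  ultimately have "(\<lambda>x. f (ext0 Q (restrict x Q))) \<in> Om \<rightarrow>\<^sub>M N"
    by (rule measurable_compose)
  then show ?thesis
    by (subst measurable_cong[of _ _ "\<lambda>x. f (ext0 Q (restrict x Q))"])
      (auto simp: space_Om depends_ext0[OF assms(1)])
qed

text \<open>
  Under this condition the label families below the words of \<open>L\<close> are independent of each other and
  of the labels on \<open>Q\<close>.
\<close>

definition stop_line :: "'e list set \<Rightarrow> 'e list set \<Rightarrow> bool" where
  "stop_line Q L \<longleftrightarrow> finite L \<and> L \<subseteq> W \<and> (\<forall>w\<in>L. \<forall>u\<in>W. w @ u \<notin> Q) \<and>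
     (\<forall>w\<in>L. \<forall>w'\<in>L. \<forall>u\<in>W. \<forall>u'\<in>W. w @ u = w' @ u' \<longrightarrow> w = w')"

text \<open>Only finitely many values of the random set B x are possible. Summing over them replaces
  the random index set by fixed ones, to which independence of finite families applies.\<close>

lemma branch_decomp:
  fixes h :: "'e list \<Rightarrow> ('e list \<Rightarrow> 'i) \<Rightarrow> real"
  assumes L: "finite L" "B x \<subseteq> L"
  shows "(\<Prod>w\<in>B x. h w x) = (\<Sum>b\<in>Pow L. (if B x = b then 1 else 0) * (\<Prod>w\<in>b. h w x))"
proof -
  have "(\<Sum>b\<in>Pow L. (if B x = b then 1 else 0) * (\<Prod>w\<in>b. h w x)) =
      (\<Sum>b\<in>Pow L. if B x = b then (\<Prod>w\<in>b. h w x) else 0)"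
    by (intro sum.cong) auto
  also have "\<dots> = (\<Prod>w\<in>B x. h w x)"
    using L by (subst sum.delta') auto
  finally show ?thesis by simp
qed

lemma branch_measurable:
  fixes g :: "'e list \<Rightarrow> ('e list \<Rightarrow> 'i) \<Rightarrow> real"
  assumes dep: "depends Q B" and L: "finite L" "L \<subseteq> W" "\<And>x. x \<in> X0 \<Longrightarrow> B x \<subseteq> L"
    and g: "\<And>w. w \<in> L \<Longrightarrow> g w \<in> borel_measurable Om"
  shows "(\<lambda>x. \<Prod>w\<in>B x. g w (sh w x)) \<in> borel_measurable Om"
proof -
  have "(\<lambda>x. \<Sum>b\<in>Pow L. (if B x = b then 1 else 0) * (\<Prod>w\<in>b. g w (sh w x))) \<in> borel_measurable Om"
  proof (intro borel_measurable_sum borel_measurable_times borel_measurable_prod)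
    fix b assume b: "b \<in> Pow L"
    show "(\<lambda>x. if B x = b then 1 else 0 :: real) \<in> borel_measurable Om"
    proof (rule measurable_depends)
      show "depends Q (\<lambda>x. if B x = b then 1 else 0 :: real)"
        using dep unfolding depends_def by fastforce
    qed simp
    show "(\<lambda>x. g w (sh w x)) \<in> borel_measurable Om" if "w \<in> b" for w
      using that b L g by (intro measurable_compose[OF measurable_sh]) auto
  qed
  then show ?thesis
    by (subst measurable_cong[OF branch_decomp[where L = L and h = "\<lambda>w x. g w (sh w x)"]])
      (use L in \<open>auto simp: space_Om\<close>)
qed

lemma integral_sh:
  fixes f :: "('e list \<Rightarrow> 'i) \<Rightarrow> real"
  assumes "w \<in> W" "f \<in> borel_measurable Om"
  shows "(\<integral>x. f (sh w x) \<partial>Om) = (\<integral>x. f x \<partial>Om)"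
  using integral_distr[OF measurable_sh[OF assms(1)] assms(2)] by (simp add: distr_sh assms)

text \<open>The event B x = b is decided by the labels on Q, and the factor of w by those at w and
  below. By \<open>stop_line\<close> these coordinate blocks are disjoint, so the factors are
  independent; shift invariance then removes \<open>sh w\<close>.\<close>

lemma branch_integral_fixed:
  fixes g :: "'e list \<Rightarrow> ('e list \<Rightarrow> 'i) \<Rightarrow> real"
  assumes dep: "depends Q B" and L: "stop_line Q L" and b: "b \<subseteq> L"
    and g: "\<And>w. w \<in> L \<Longrightarrow> g w \<in> borel_measurable Om"
    and g01: "\<And>w x. w \<in> L \<Longrightarrow> x \<in> X0 \<Longrightarrow> 0 \<le> g w x \<and> g w x \<le> 1"
  shows "(\<integral>x. (if B x = b then 1 else 0) * (\<Prod>w\<in>b. g w (sh w x)) \<partial>Om) =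
    (\<integral>x. (if B x = b then 1 else 0) \<partial>Om) * (\<Prod>w\<in>b. \<integral>x. g w x \<partial>Om)"
    and "integrable Om (\<lambda>x. (if B x = b then 1 else 0) * (\<Prod>w\<in>b. g w (sh w x)))"
proof -
  \<comment> \<open>The factors form one family over an option type: \<open>None\<close> is the
    event, \<open>Some w\<close> the branch at w. \<open>K\<close> is the coordinate block of each,
    and \<open>Y\<close> writes each factor as a function of the labels in its block.\<close>
  define X where "X = (\<lambda>zz x. case zz of None \<Rightarrow> (if B x = b then 1 else 0 :: real) | Some w \<Rightarrow> g w (sh w x))"
  define K where "K = (\<lambda>zz. case zz of None \<Rightarrow> Q | Some w \<Rightarrow> (\<lambda>u. w @ u) ` W)"
  define Y where "Y = (\<lambda>zz y. case zz of None \<Rightarrow> (if B (ext0 Q y) = b then 1 else 0 :: real) | Some w \<Rightarrow> g w (sh w y))"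
  define Z where "Z = (\<lambda>zz x. Y zz (restrict x (K zz)))"
  define I where "I = insert None (Some ` b)"
  note Q = dependsD[OF dep]
  have LW: "finite L" "L \<subseteq> W" "\<And>w u. w \<in> L \<Longrightarrow> u \<in> W \<Longrightarrow> w @ u \<notin> Q"
    "\<And>w w' u u'. w \<in> L \<Longrightarrow> w' \<in> L \<Longrightarrow> u \<in> W \<Longrightarrow> u' \<in> W \<Longrightarrow> w @ u = w' @ u' \<Longrightarrow> w = w'"
    using L unfolding stop_line_def by blast+
  have finI: "finite I" using finite_subset[OF b LW(1)] by (simp add: I_def)
  have "Om.indep_vars (\<lambda>zz. Pi\<^sub>M (K zz) (\<lambda>_. D)) (\<lambda>zz x. restrict (\<lambda>w. x w) (K zz)) I"
  proof (rule Om.indep_vars_restrict[OF indep_coordinates])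
    show "K zz \<subseteq> W" if "zz \<in> I" for zz
      using that Q(2) subsetD[OF subset_trans[OF b LW(2)]] by (auto simp: I_def K_def)
    show "disjoint_family_on K I"
      unfolding disjoint_family_on_def
    proof (intro ballI impI)
      fix m n assume "m \<in> I" "n \<in> I" "m \<noteq> n"
      then show "K m \<inter> K n = {}"
        using LW(3,4) b by (auto simp: I_def K_def) blast+
    qed
  qed
  then have "Om.indep_vars (\<lambda>_. borel) (\<lambda>zz x. Y zz (restrict (\<lambda>w. x w) (K zz))) I"
  proof (rule Om.indep_vars_compose2)
    fix zz assume "zz \<in> I"
    show "Y zz \<in> borel_measurable (Pi\<^sub>M (K zz) (\<lambda>_. D))"
    proof (cases zz)
      case None
      then show ?thesis unfolding Y_def K_def by (auto intro!: measurable_PiM_finite Q)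
    next
      case (Some w)
      then have w: "w \<in> L" "w \<in> W" using \<open>zz \<in> I\<close> b LW(2) by (auto simp: I_def)
      have "sh w \<in> Pi\<^sub>M ((\<lambda>u. w @ u) ` W) (\<lambda>_. D) \<rightarrow>\<^sub>M Om"
        unfolding sh_def[abs_def] Om_def
        by (intro measurable_restrict measurable_component_singleton) auto
      then have "(\<lambda>y. g w (sh w y)) \<in> borel_measurable (Pi\<^sub>M ((\<lambda>u. w @ u) ` W) (\<lambda>_. D))"
        by (rule measurable_compose) (rule g[OF w(1)])
      then show ?thesis using Some unfolding Y_def K_def by simp
    qed
  qed
  moreover have YX: "Y zz (restrict (\<lambda>w. x w) (K zz)) = X zz x" if "x \<in> X0" for zz x
  proof (cases zz)
    case None
    have "B (ext0 Q (restrict x Q)) = B x" by (rule depends_ext0[OF dep that])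
    then show ?thesis using None by (simp add: X_def Y_def K_def)
  next
    case (Some w)
    have "sh w (restrict x ((\<lambda>u. w @ u) ` W)) = sh w x"
      by (auto simp: sh_def fun_eq_iff)
    then show ?thesis using Some by (simp add: X_def Y_def K_def)
  qed
  ultimately have ind: "Om.indep_vars (\<lambda>_. borel) Z I" and ZX: "\<And>zz x. x \<in> X0 \<Longrightarrow> Z zz x = X zz x"
    by (simp_all add: Z_def)
  have int: "integrable Om (Z zz)" if "zz \<in> I" for zz
  proof (rule Om.integrable_const_bound[of _ 1])
    show "Z zz \<in> borel_measurable Om"
      using ind that by (auto simp: Om.indep_vars_def)
    show "AE x in Om. norm (Z zz x) \<le> 1"
    proof (rule AE_I2)
      fix x assume "x \<in> space Om"
      then have x: "x \<in> X0" by (simp add: space_Om)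
      show "norm (Z zz x) \<le> 1"
      proof (cases zz)
        case (Some w)
        then have "w \<in> L" "w \<in> W" using that b LW(2) by (auto simp: I_def)
        then show ?thesis using Some g01[of w "sh w x"] sh_X0[OF x] by (simp add: X_def ZX[OF x])
      qed (simp add: X_def ZX[OF x])
    qed
  qed
  have prod: "(\<Prod>zz\<in>I. f zz) = f None * (\<Prod>w\<in>b. f (Some w))" for f :: "'e list option \<Rightarrow> real"
    unfolding I_def using finI
    by (subst prod.insert) (auto simp: I_def prod.reindex)
  have "integrable Om (\<lambda>x. X None x * (\<Prod>w\<in>b. X (Some w) x))"
    using Om.indep_vars_integrable[OF finI ind int] unfolding prod
    by (subst Bochner_Integration.integrable_cong[OF refl, where g = "\<lambda>x. Z None x * (\<Prod>w\<in>b. Z (Some w) x)"])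
      (simp_all add: ZX space_Om)
  then show "integrable Om (\<lambda>x. (if B x = b then 1 else 0) * (\<Prod>w\<in>b. g w (sh w x)))"
    by (simp add: X_def)
  have XZ: "(\<integral>x. X zz x \<partial>Om) = (\<integral>x. Z zz x \<partial>Om)" for zz
    by (rule Bochner_Integration.integral_cong) (simp_all add: ZX space_Om)
  have "(\<integral>x. X None x * (\<Prod>w\<in>b. X (Some w) x) \<partial>Om) = (\<integral>x. Z None x * (\<Prod>w\<in>b. Z (Some w) x) \<partial>Om)"
    by (rule Bochner_Integration.integral_cong) (simp_all add: ZX space_Om)
  also have "\<dots> = (\<integral>x. X None x \<partial>Om) * (\<Prod>w\<in>b. \<integral>x. X (Some w) x \<partial>Om)"
    using Om.indep_vars_lebesgue_integral[OF finI ind int] unfolding prod XZ .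
  finally have "(\<integral>x. (if B x = b then 1 else 0) * (\<Prod>w\<in>b. g w (sh w x)) \<partial>Om) =
      (\<integral>x. (if B x = b then 1 else 0) \<partial>Om) * (\<Prod>w\<in>b. \<integral>x. g w (sh w x) \<partial>Om)"
    by (simp add: X_def)
  also have "(\<Prod>w\<in>b. \<integral>x. g w (sh w x) \<partial>Om) = (\<Prod>w\<in>b. \<integral>x. g w x \<partial>Om)"
    using b LW(2) g by (intro prod.cong refl integral_sh) auto
  finally show "(\<integral>x. (if B x = b then 1 else 0) * (\<Prod>w\<in>b. g w (sh w x)) \<partial>Om) =
    (\<integral>x. (if B x = b then 1 else 0) \<partial>Om) * (\<Prod>w\<in>b. \<integral>x. g w x \<partial>Om)" .
qed

text \<open>The branching property: given the labels on Q, the subtrees at the words of B x are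
  independent copies of the whole, so functions of them may be replaced by their means.\<close>

lemma branch_integral:
  fixes g :: "'e list \<Rightarrow> ('e list \<Rightarrow> 'i) \<Rightarrow> real"
  assumes dep: "depends Q B" and L: "stop_line Q L" and B: "\<And>x. x \<in> X0 \<Longrightarrow> B x \<subseteq> L"
    and g: "\<And>w. w \<in> L \<Longrightarrow> g w \<in> borel_measurable Om"
    and g01: "\<And>w x. w \<in> L \<Longrightarrow> x \<in> X0 \<Longrightarrow> 0 \<le> g w x \<and> g w x \<le> 1"
  shows "(\<integral>x. (\<Prod>w\<in>B x. g w (sh w x)) \<partial>Om) = (\<integral>x. (\<Prod>w\<in>B x. \<integral>y. g w y \<partial>Om) \<partial>Om)"
proof -
  have finL: "finite L" using L by (simp add: stop_line_def)
  have ind: "integrable Om (\<lambda>x. if B x = b then 1 else 0 :: real)" if "b \<subseteq> L" for b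
    using branch_integral_fixed(2)[OF dep L that, of "\<lambda>_ _. 1"] by simp
  have "(\<integral>x. (\<Prod>w\<in>B x. g w (sh w x)) \<partial>Om) =
      (\<integral>x. (\<Sum>b\<in>Pow L. (if B x = b then 1 else 0) * (\<Prod>w\<in>b. g w (sh w x))) \<partial>Om)"
    by (rule Bochner_Integration.integral_cong[OF refl], rule branch_decomp[OF finL])
      (simp add: B space_Om)
  also have "\<dots> = (\<Sum>b\<in>Pow L. \<integral>x. (if B x = b then 1 else 0) * (\<Prod>w\<in>b. g w (sh w x)) \<partial>Om)"
    by (rule Bochner_Integration.integral_sum) (rule branch_integral_fixed(2)[OF dep L _ g g01], auto)
  also have "\<dots> = (\<Sum>b\<in>Pow L. (\<integral>x. (if B x = b then 1 else 0) \<partial>Om) * (\<Prod>w\<in>b. \<integral>x. g w x \<partial>Om))"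
    by (intro sum.cong refl branch_integral_fixed(1)[OF dep L _ g g01]) auto
  also have "\<dots> = (\<Sum>b\<in>Pow L. (\<integral>x. (if B x = b then 1 else 0) * (\<Prod>w\<in>b. \<integral>x. g w x \<partial>Om) \<partial>Om))"
    by simp
  also have "\<dots> = (\<integral>x. (\<Sum>b\<in>Pow L. (if B x = b then 1 else 0) * (\<Prod>w\<in>b. \<integral>x. g w x \<partial>Om)) \<partial>Om)"
    by (rule Bochner_Integration.integral_sum[symmetric]) (auto intro!: ind)
  also have "\<dots> = (\<integral>x. (\<Prod>w\<in>B x. \<integral>y. g w y \<partial>Om) \<partial>Om)"
    by (rule Bochner_Integration.integral_cong[OF refl], rule branch_decomp[OF finL, symmetric])
      (simp add: B space_Om)
  finally show ?thesis .
qed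

end

section \<open>Separated pieces and the upper bound\<close>

context random_recursive
begin

definition line :: "real \<Rightarrow> 'e list set" where
  "line \<rho> = {w \<in> W. w \<noteq> [] \<and> cw w \<le> \<rho> \<and> \<rho> < cw (butlast w)}"

definition pre :: "real \<Rightarrow> 'e list set" where "pre \<rho> = {w \<in> W. \<rho> < cw w}"

lemma cw_append_le: "w \<in> W \<Longrightarrow> u \<in> W \<Longrightarrow> cw (w @ u) \<le> cw w"
  using cw_pos[of w] cw_le_1[of u] by simp

lemma butlast_W: "w \<in> W \<Longrightarrow> butlast w \<in> W"
  unfolding W_def by (auto dest: in_set_butlastD)

lemma drop_W: "w \<in> W \<Longrightarrow> drop k w \<in> W"
  unfolding W_def by (auto dest: in_set_dropD)

lemma finite_pre:
  assumes "\<rho> > 0" shows "finite (pre \<rho>)"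
proof -
  obtain cm cn where cm: "0 < cn" "cm < 1" "\<And>e. e \<in> E \<Longrightarrow> cn \<le> c e \<and> c e \<le> cm"
    by (rule c_bounds) (rule that)
  obtain e where "e \<in> E" using E_ne by blast
  then have "cm > 0" using cm(3)[of e] cm(1) by linarith
  obtain n where n: "cm ^ n < \<rho>" using real_arch_pow_inv[OF assms cm(2)] by blast
  have "length w \<le> n" if "w \<in> pre \<rho>" for w
  proof (rule ccontr)
    assume "\<not> length w \<le> n"
    then have "cm ^ length w \<le> cm ^ n" using cm \<open>cm > 0\<close> by (intro power_decreasing) auto
    moreover have "cw w \<le> cm ^ length w" using that cm by (intro cw_le_power) (auto simp: pre_def)
    ultimately show False using that n by (auto simp: pre_def)
  qed
  then have "pre \<rho> \<subseteq> {w. set w \<subseteq> E \<and> length w \<le> n}" by (auto simp: pre_def W_def)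
  then show ?thesis by (rule finite_subset) (rule finite_lists_length_le[OF finite_E])
qed

lemma finite_line:
  assumes "\<rho> > 0" shows "finite (line \<rho>)"
proof (rule finite_subset)
  show "line \<rho> \<subseteq> (\<lambda>(w, e). w @ [e]) ` (pre \<rho> \<times> E)"
  proof
    fix w assume w: "w \<in> line \<rho>"
    then have "w = butlast w @ [last w]" "butlast w \<in> pre \<rho>" "last w \<in> E"
      using butlast_W by (auto simp: line_def pre_def W_def)
    then show "w \<in> (\<lambda>(w, e). w @ [e]) ` (pre \<rho> \<times> E)"
      by (intro image_eqI[of _ _ "(butlast w, last w)"]) auto
  qed
  show "finite ((\<lambda>(w, e). w @ [e]) ` (pre \<rho> \<times> E))" using finite_pre[OF assms] finite_E by simp
qed

lemma line_W: "w \<in> line \<rho> \<Longrightarrow> w \<in> W"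
  by (simp add: line_def)

text \<open>If us were nonempty, the long word without its last letter would still extend w, so its
  ratio would be at most that of w and hence at most \<rho>. This makes the line
  prefix-free.\<close>

lemma line_prefix:
  assumes "w \<in> line \<rho>" "w @ us \<in> line \<rho>" shows "us = []"
proof (rule ccontr)
  assume "us \<noteq> []"
  then have "butlast (w @ us) = w @ butlast us" by (simp add: butlast_append)
  moreover have "cw (w @ butlast us) \<le> cw w"
    using assms by (intro cw_append_le) (auto simp: line_def intro!: butlast_W)
  ultimately show False using assms by (simp add: line_def)
qed

lemma stop_line_line: assumes "\<rho> > 0" shows "stop_line (pre \<rho>) (line \<rho>)"
  unfolding stop_line_def
proof (intro conjI ballI impI finite_line[OF assms])
  show "line \<rho> \<subseteq> W" by (auto simp: line_def)
  fix w u assume w: "w \<in> line \<rho>" "u \<in> W"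
  then have "cw (w @ u) \<le> cw w" by (intro cw_append_le) (auto simp: line_def)
  then show "w @ u \<notin> pre \<rho>" using w by (simp add: pre_def line_def)
  fix w' u' assume w': "w' \<in> line \<rho>" "w @ u = w' @ u'"
  then obtain us where "w = w' @ us \<or> w @ us = w'"
    unfolding append_eq_append_conv2 by blast
  then show "w = w'" using line_prefix[of w \<rho> us] line_prefix[of w' \<rho> us] w w' by auto
qed

lemma take_line_pre:
  assumes "w \<in> line \<rho>" "k < length w" shows "take k w \<in> pre \<rho>"
proof -
  have "take k (butlast w) = take k w" using assms(2) by (rule take_butlast)
  then have "butlast w = take k w @ drop k (butlast w)"
    using append_take_drop_id[of k "butlast w"] by simp
  moreover have "take k w \<in> W" "drop k (butlast w) \<in> W"
    using assms by (auto simp: line_def intro!: take_W drop_W butlast_W)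
  ultimately have "cw (butlast w) \<le> cw (take k w)"
    using cw_append_le[of "take k w" "drop k (butlast w)"] by simp
  then show ?thesis using assms \<open>take k w \<in> W\<close> by (simp add: line_def pre_def)
qed

definition cut :: "real \<Rightarrow> 'v \<Rightarrow> ('e list \<Rightarrow> 'i) \<Rightarrow> 'e list set" where
  "cut \<rho> v x = {w \<in> line \<rho>. T x v w}"

definition pt :: 'a where "pt = (SOME p. p \<in> \<Delta>)"

text \<open>
  The constant is chosen so that the pieces of words that are not near, and not only the images of
  \<open>pt\<close>, are more than \<open>\<rho>\<close> apart.
\<close>

definition near :: "real \<Rightarrow> 'e list \<Rightarrow> 'e list \<Rightarrow> bool" where
  "near \<rho> w w' \<longleftrightarrow> dist (word_map S w pt) (word_map S w' pt) \<le> \<rho> * (2 * diameter \<Delta> + 1)"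

definition net :: "real \<Rightarrow> 'e list set \<Rightarrow> 'e list set \<Rightarrow> bool" where
  "net \<rho> A B \<longleftrightarrow> B \<subseteq> A \<and> (\<forall>w\<in>B. \<forall>w'\<in>B. near \<rho> w w' \<longrightarrow> w = w') \<and> (\<forall>w\<in>A. \<exists>w'\<in>B. near \<rho> w w')"

text \<open>The choice refers to x only through \<open>cut\<close>. Equal cuts give equal
  selections, so dependence on finitely many labels survives the choice.\<close>

definition sel :: "real \<Rightarrow> 'v \<Rightarrow> ('e list \<Rightarrow> 'i) \<Rightarrow> 'e list set" where
  "sel \<rho> v x = (SOME B. net \<rho> (cut \<rho> v x) B)"

lemma pt_\<Delta>: "pt \<in> \<Delta>" unfolding pt_def using \<Delta>_ne by (simp add: some_in_eq)

lemma bounded_\<Delta>: "bounded \<Delta>" using compact_\<Delta> by (rule compact_imp_bounded)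

lemma diameter_\<Delta>: "diameter \<Delta> \<ge> 0" using bounded_\<Delta> by (rule diameter_ge_0)

lemma ex_net: "finite A \<Longrightarrow> \<rho> > 0 \<Longrightarrow> \<exists>B. net \<rho> A B"
proof (induction A rule: finite_induct)
  case empty
  then show ?case by (auto simp: net_def)
next
  case (insert w A)
  then obtain B where B: "net \<rho> A B" by blast
  have ww: "near \<rho> w w" using insert diameter_\<Delta> by (simp add: near_def)
  show ?case
  proof (cases "\<exists>w'\<in>B. near \<rho> w w'")
    case True
    then have "net \<rho> (insert w A) B" using B unfolding net_def by blast
    then show ?thesis by blast
  next
    case False
    moreover have "near \<rho> w' w \<longleftrightarrow> near \<rho> w w'" for w' by (simp add: near_def dist_commute)
    ultimately have "net \<rho> (insert w A) (insert w B)"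
      using B ww unfolding net_def by blast
    then show ?thesis by blast
  qed
qed

lemma net_sel: "\<rho> > 0 \<Longrightarrow> net \<rho> (cut \<rho> v x) (sel \<rho> v x)" (is "_ \<Longrightarrow> ?thesis")
proof -
  assume "\<rho> > 0"
  then have "finite (cut \<rho> v x)" using finite_line[of \<rho>] by (simp add: cut_def)
  from ex_net[OF this \<open>\<rho> > 0\<close>] show ?thesis unfolding sel_def by (rule someI_ex)
qed

lemma sel_line: "\<rho> > 0 \<Longrightarrow> sel \<rho> v x \<subseteq> line \<rho>"
  using net_sel[of \<rho> v x] unfolding net_def cut_def by blast

lemma sel_T: "\<rho> > 0 \<Longrightarrow> w \<in> sel \<rho> v x \<Longrightarrow> T x v w"
  using net_sel[of \<rho> v x] unfolding net_def cut_def by blast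

lemma finite_sel: "\<rho> > 0 \<Longrightarrow> finite (sel \<rho> v x)"
  by (rule finite_subset[OF sel_line finite_line])

lemma depends_sel:
  assumes "\<rho> > 0" shows "depends (pre \<rho>) (sel \<rho> v)"
  unfolding depends_def
proof (intro conjI ballI impI finite_pre[OF assms])
  show "pre \<rho> \<subseteq> W" by (auto simp: pre_def)
  fix x y :: "'e list \<Rightarrow> 'i" assume xy: "\<forall>q\<in>pre \<rho>. x q = y q"
  have "T x v w = T y v w" if "w \<in> line \<rho>" for w
    using take_line_pre[OF that] xy by (intro T_cong) blast
  then have "cut \<rho> v x = cut \<rho> v y" unfolding cut_def by blast
  then show "sel \<rho> v x = sel \<rho> v y" by (simp add: sel_def)
qed

lemma dist_piece:
  assumes "w \<in> W" "cw w \<le> \<rho>" "y \<in> word_map S w ` \<Delta>"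
  shows "dist y (word_map S w pt) \<le> \<rho> * diameter \<Delta>"
proof -
  obtain a where a: "a \<in> \<Delta>" "y = word_map S w a" using assms by blast
  have "dist y (word_map S w pt) = cw w * dist a pt" using a dist_word_map[OF assms(1)] by simp
  also have "\<dots> \<le> \<rho> * diameter \<Delta>"
    using assms cw_pos[OF assms(1)] diameter_bounded_bound[OF bounded_\<Delta> a(1) pt_\<Delta>]
    by (intro mult_mono) auto
  finally show ?thesis .
qed

lemma sel_separated:
  assumes "\<rho> > 0" "u \<in> sel \<rho> v x" "u' \<in> sel \<rho> v x" "u \<noteq> u'"
    and "y \<in> word_map S u ` \<Delta>" "y' \<in> word_map S u' ` \<Delta>"
  shows "\<rho> < dist y y'"
proof -
  have u: "u \<in> line \<rho>" "u' \<in> line \<rho>" using sel_line assms by blast+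
  have "\<not> near \<rho> u u'" using net_sel[OF assms(1), of v x] assms unfolding net_def by blast
  then have "\<rho> * (2 * diameter \<Delta> + 1) < dist (word_map S u pt) (word_map S u' pt)"
    by (simp add: near_def)
  moreover have "dist y (word_map S u pt) \<le> \<rho> * diameter \<Delta>"
    using u assms by (intro dist_piece) (auto simp: line_def)
  moreover have "dist y' (word_map S u' pt) \<le> \<rho> * diameter \<Delta>"
    using u assms by (intro dist_piece) (auto simp: line_def)
  moreover have "dist (word_map S u pt) (word_map S u' pt) \<le>
      dist y (word_map S u pt) + dist y y' + dist y' (word_map S u' pt)"
    by metric
  ultimately show ?thesis by (simp add: algebra_simps)
qed

text \<open>Cut a long word through the point at its first prefix of ratio at most \<rho>. The point
  is within \<rho> diam \<Delta> of the image of \<open>pt\<close> under that prefix, which in turn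
  is within \<rho> (2 diam \<Delta> + 1) of a selected one; the sum gives the radius.\<close>

lemma attractor_cover:
  assumes x: "x \<in> X0" and \<rho>: "0 < \<rho>" "\<rho> < 1"
  shows "attractor G S \<Delta> x v \<subseteq> (\<Union>w\<in>sel \<rho> v x. cball (word_map S w pt) (\<rho> * (3 * diameter \<Delta> + 1)))"
proof
  fix y assume y: "y \<in> attractor G S \<Delta> x v"
  obtain cm cn where cm: "0 < cn" "cm < 1" "\<And>e. e \<in> E \<Longrightarrow> cn \<le> c e \<and> c e \<le> cm"
    by (rule c_bounds) (rule that)
  \<comment> \<open>A word of length k has ratio below \<rho>, so the crossing happens within the
    word.\<close>
  obtain k where k: "cm ^ k < \<rho>" using real_arch_pow_inv[OF \<rho>(1) cm(2)] by blast
  have "k \<noteq> 0" using k \<rho> by (intro notI) simp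
  then have "y \<in> (\<Union>w\<in>{w. T x v w \<and> length w = k}. word_map S w ` \<Delta>)"
    using y x by (subst (asm) attractor_eq) (auto simp: X0_D)
  then obtain w where w: "T x v w" "length w = k" "y \<in> word_map S w ` \<Delta>" by blast
  have wW: "w \<in> W" using T_W[OF _ w(1)] x X0_D by blast
  have cwk: "cw (take k w) \<le> \<rho>" using cw_le_power[of cm w] cm wW w(2) k by auto
  define n where "n = (LEAST n. cw (take n w) \<le> \<rho>)"
  have n: "cw (take n w) \<le> \<rho>" unfolding n_def using cwk by (rule LeastI)
  have "n \<noteq> 0" using n \<rho> by (intro notI) simp
  then have n': "\<rho> < cw (take (n - 1) w)"
    using not_less_Least[of "n - 1" "\<lambda>n. cw (take n w) \<le> \<rho>"] by (simp add: n_def[symmetric])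
  have "n \<le> length w" unfolding n_def w(2) using cwk by (rule Least_le)
  then have "take n w \<in> line \<rho>"
    using n n' \<open>n \<noteq> 0\<close> wW by (auto simp: line_def take_W butlast_take)
  then have c: "take n w \<in> cut \<rho> v x" using T_prefix[OF w(1)] by (simp add: cut_def)
  have "word_map S (take n w @ drop n w) ` \<Delta> \<subseteq> word_map S (take n w) ` \<Delta>"
    by (rule word_map_prefix[OF drop_W[OF wW]])
  then have "y \<in> word_map S (take n w) ` \<Delta>" using w by auto
  then have d1: "dist y (word_map S (take n w) pt) \<le> \<rho> * diameter \<Delta>"
    using n wW by (intro dist_piece take_W)
  obtain w' where w': "w' \<in> sel \<rho> v x" "near \<rho> (take n w) w'"
    using net_sel[OF \<rho>(1), of v x] c unfolding net_def by blast
  have "dist y (word_map S w' pt) \<le> \<rho> * diameter \<Delta> + \<rho> * (2 * diameter \<Delta> + 1)"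
    using dist_triangle[of y "word_map S w' pt" "word_map S (take n w) pt"] d1 w'(2)
    by (simp add: near_def)
  then have "y \<in> cball (word_map S w' pt) (\<rho> * (3 * diameter \<Delta> + 1))"
    by (simp add: dist_commute algebra_simps)
  then show "y \<in> (\<Union>w\<in>sel \<rho> v x. cball (word_map S w pt) (\<rho> * (3 * diameter \<Delta> + 1)))"
    using w' by blast
qed

definition mean_sel :: "real \<Rightarrow> 'v \<Rightarrow> real" where
  "mean_sel \<rho> v = (\<integral>x. real (card (sel \<rho> v x)) \<partial>Om)"

lemma measurable_fun_sel:
  fixes f :: "'e list set \<Rightarrow> real"
  assumes "\<rho> > 0" shows "(\<lambda>x. f (sel \<rho> v x)) \<in> borel_measurable Om"
  by (rule measurable_depends[OF depends_comp[OF depends_sel[OF assms]]]) simp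

lemma integrable_card_sel:
  assumes "\<rho> > 0" shows "integrable Om (\<lambda>x. real (card (sel \<rho> v x)))"
proof (rule Om.integrable_const_bound[of _ "real (card (line \<rho>))"])
  show "(\<lambda>x. real (card (sel \<rho> v x))) \<in> borel_measurable Om"
    by (rule measurable_fun_sel[OF assms])
qed (auto intro!: card_mono finite_line[OF assms] sel_line[OF assms])

lemma AE_upper_box_dim_le:
  assumes t: "0 \<le> t" "t < t'" and \<rho>0: "\<rho>0 > 0"
    and m: "\<And>\<rho>. 0 < \<rho> \<Longrightarrow> \<rho> < \<rho>0 \<Longrightarrow> mean_sel \<rho> v \<le> \<rho> powr (- t)"
  shows "AE x in Om. upper_box_dim (attractor G S \<Delta> x v) \<le> ereal t'"
proof -
  let ?r = "\<lambda>k::nat. (1/2::real) ^ k"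
  define A where "A = (\<lambda>k. {x \<in> space Om. 2 powr (real k * t') \<le> real (card (sel (?r k) v x))})"
  have A_sets: "A k \<in> sets Om" for k
    unfolding A_def using measurable_fun_sel[of "?r k" "\<lambda>B. real (card B)" v] by measurable
  obtain K where K: "?r K < \<rho>0" using real_arch_pow_inv[OF \<rho>0, of "1/2"] by auto
  have bound: "measure Om (A k) \<le> (2 powr (t - t')) ^ k" if "k \<ge> K" for k
  proof -
    have "?r k < \<rho>0" using K power_decreasing[OF that, of "1/2::real"] by linarith
    have "measure Om (A k) \<le> mean_sel (?r k) v / 2 powr (real k * t')"
      unfolding A_def mean_sel_def
      by (rule integral_Markov_inequality_measure[OF integrable_card_sel, where A = "{}"]) auto
    also have "\<dots> \<le> ?r k powr (- t) / 2 powr (real k * t')"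
      using m[of "?r k"] \<open>?r k < \<rho>0\<close> by (intro divide_right_mono) auto
    also have "?r k powr (- t) = 2 powr (real k * t)"
      by (simp add: power_one_over powr_realpow[symmetric] powr_minus_divide[symmetric] powr_powr
          flip: powr_minus)
    also have "2 powr (real k * t) / 2 powr (real k * t') = (2 powr (t - t')) ^ k"
      by (simp add: powr_realpow[symmetric] powr_powr powr_diff[symmetric] algebra_simps)
    finally show ?thesis .
  qed
  have "2 powr (t - t') < 2 powr (0::real)" using t by (intro powr_less_mono) auto
  then have "summable (\<lambda>k. (2 powr (t - t')) ^ k)" by (intro summable_geometric) simp
  then have "summable (\<lambda>k. measure Om (A k))"
    by (rule summable_comparison_test'[where N = K]) (use bound in simp)
  then have "AE x in Om. eventually (\<lambda>k. x \<in> space Om - A k) sequentially"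
    by (intro borel_cantelli_AE1 A_sets) (auto simp: Om.emeasure_eq_measure)
  then show ?thesis
  proof (eventually_elim)
    fix x assume ev: "eventually (\<lambda>k. x \<in> space Om - A k) sequentially"
    then obtain k where "x \<in> space Om - A k" using eventually_happens'[OF _ ev] by auto
    then have x: "x \<in> X0" by (simp add: space_Om)
    \<comment> \<open>Twice the radius factor of \<open>attractor_cover\<close>.\<close>
    let ?C = "2 * (3 * diameter \<Delta> + 1)"
    show "upper_box_dim (attractor G S \<Delta> x v) \<le> ereal t'"
    proof (rule upper_box_dim_leI[of ?C])
      show "eventually (\<lambda>k. \<exists>\<C>. finite \<C> \<and> attractor G S \<Delta> x v \<subseteq> \<Union>\<C> \<and>
          (\<forall>U\<in>\<C>. diam_at_most (?C * (1/2) ^ k) U) \<and> real (card \<C>) \<le> 2 powr (real k * t')) sequentially"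
        using ev eventually_ge_at_top[of 1]
      proof eventually_elim
        fix k :: nat assume k: "x \<in> space Om - A k" "1 \<le> k"
        let ?\<C> = "(\<lambda>w. cball (word_map S w pt) (?r k * (3 * diameter \<Delta> + 1))) ` sel (?r k) v x"
        have rk: "?r k > 0" "?r k < 1" using k by (auto intro: power_less_one_iff[THEN iffD2])
        have "finite ?\<C>" using finite_sel[OF rk(1)] by simp
        moreover have "attractor G S \<Delta> x v \<subseteq> \<Union>?\<C>" using attractor_cover[OF x rk] by simp
        moreover have "\<forall>U\<in>?\<C>. diam_at_most (?C * ?r k) U"
          using diameter_\<Delta> by (auto intro!: diam_at_most_cball)
        moreover have "real (card ?\<C>) \<le> real (card (sel (?r k) v x))"
          using finite_sel[OF rk(1)] by (simp add: card_image_le)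
        then have "real (card ?\<C>) \<le> 2 powr (real k * t')" using k unfolding A_def by auto
        ultimately show "\<exists>\<C>. finite \<C> \<and> attractor G S \<Delta> x v \<subseteq> \<Union>\<C> \<and>
          (\<forall>U\<in>\<C>. diam_at_most (?C * (1/2) ^ k) U) \<and> real (card \<C>) \<le> 2 powr (real k * t')"
          by blast
      qed
    qed (use t diameter_\<Delta> in auto)
  qed
qed

end

section \<open>Percolation on the separated pieces and the lower bound\<close>

text \<open>If the measure vanished for some s' < s, there would be covers by sets of diameter at
  most 1 with arbitrarily small s'-sum, and for such sets the s-sum is no larger.\<close>

lemma hausdorff_dim_ge:
  assumes s: "s > 0" and a: "a > 0"
    and content: "\<And>U :: nat \<Rightarrow> 'a::metric_space set. F \<subseteq> (\<Union>i. U i) \<Longrightarrow> (\<And>i. bounded (U i)) \<Longrightarrow>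
      ennreal a \<le> (\<Sum>i. diam_pow s (U i))"
  shows "ereal s \<le> hausdorff_dim F"
  unfolding hausdorff_dim_def
proof (rule INF_greatest, rule ccontr)
  fix s' assume s': "s' \<in> {s. 0 \<le> s \<and> hausdorff_measure s F = 0}" and "\<not> ereal s \<le> ereal s'"
  then have "s' < s" "0 \<le> s'" "hausdorff_measure s' F = 0" by auto
  then have "hausdorff_premeasure s' 1 F < ennreal a"
    using hausdorff_measure_eq_0_premeasure[of s' F 1] a by simp
  then obtain U where U: "F \<subseteq> (\<Union>i. U i)" "\<And>i. diam_at_most 1 (U i)" "(\<Sum>i. diam_pow s' (U i)) < ennreal a"
    unfolding hausdorff_premeasure_def INF_less_iff by auto
  have "diam_pow s (U i) \<le> diam_pow s' (U i)" for i
  proof -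
    have d: "0 \<le> diameter (U i)" "diameter (U i) \<le> 1"
      using U(2)[of i] by (auto simp: diam_at_most_def diameter_ge_0)
    have "diameter (U i) powr s \<le> 1" using s d by (intro powr_le1) auto
    moreover have "diameter (U i) powr s \<le> diameter (U i) powr s'"
      using d \<open>s' < s\<close> by (intro powr_mono') auto
    ultimately show ?thesis using s by (auto simp: diam_pow_def intro: ennreal_leI)
  qed
  then have "(\<Sum>i. diam_pow s (U i)) \<le> (\<Sum>i. diam_pow s' (U i))" by (intro suminf_le) auto
  moreover have "ennreal a \<le> (\<Sum>i. diam_pow s (U i))"
    using U by (intro content) (auto simp: diam_at_most_def)
  ultimately show False using U(3) by simp
qed

text \<open>The union bound for independent events of probabilities a w.\<close>

lemma one_minus_prod_le_sum:
  fixes a :: "'b \<Rightarrow> real"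
  assumes "finite A" "\<And>w. w \<in> A \<Longrightarrow> 0 \<le> a w \<and> a w \<le> 1"
  shows "1 - (\<Prod>w\<in>A. 1 - a w) \<le> (\<Sum>w\<in>A. a w)"
  using assms
proof (induction A rule: finite_induct)
  case (insert w A)
  have "0 \<le> (\<Prod>w\<in>A. 1 - a w)" "(\<Prod>w\<in>A. 1 - a w) \<le> 1"
    using insert by (auto intro!: prod_nonneg prod_le_1)
  then have "a w * (\<Prod>w\<in>A. 1 - a w) \<le> a w * 1" using insert by (intro mult_left_mono) auto
  then show ?case using insert by (simp add: algebra_simps)
qed simp

text \<open>By Bernoulli, (1 - z)^n (1 + n z) \<le> (1 - z^2)^n \<le> 1. The probability of at least
  one success in n trials thus stays close to n z while n z is small.\<close>

lemma one_minus_power_ge: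
  fixes z :: real
  assumes "0 \<le> z" "z \<le> 1"
  shows "real n * z / (1 + real n * z) \<le> 1 - (1 - z) ^ n"
proof -
  have pos: "1 + real n * z > 0" using assms by (intro add_pos_nonneg) auto
  have "(1 - z) ^ n * (1 + real n * z) \<le> (1 - z) ^ n * (1 + z) ^ n"
    using assms by (intro mult_left_mono Bernoulli_inequality) auto
  also have "\<dots> = (1 - z\<^sup>2) ^ n"
    by (simp add: power_mult_distrib[symmetric] power2_eq_square algebra_simps)
  also have "\<dots> \<le> 1" using assms by (intro power_le_one) (auto simp: power_le_one)
  finally have "(1 - z) ^ n \<le> 1 / (1 + real n * z)" using pos by (simp add: pos_le_divide_eq)
  moreover have "1 - 1 / (1 + real n * z) = real n * z / (1 + real n * z)"
    using pos by (simp add: field_simps)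
  ultimately show ?thesis by linarith
qed

context random_recursive
begin

section \<open>Paths and their probabilities\<close>

definition hits :: "'v \<Rightarrow> 'e list \<Rightarrow> real" where
  "hits j u = (\<integral>x. (if T x j u then 1 else 0) \<partial>Om)"

lemma integral_label:
  assumes "i \<in> \<Lambda>" shows "(\<integral>x. (if x [] = i then 1 else 0) \<partial>Om) = \<pi> i"
proof -
  have "(\<integral>x. (if x [] = i then 1 else 0) \<partial>Om) = (\<integral>x. indicator {i} (x []) \<partial>Om :: real)"
    by (rule Bochner_Integration.integral_cong) (auto simp: indicator_def)
  also have "\<dots> = (\<integral>y. indicator {i} y \<partial>distr Om D (\<lambda>x. x []))"
    using assms by (subst integral_distr) auto
  also have "distr Om D (\<lambda>x. x []) = D"
    unfolding Om_def by (rule distr_PiM_component) (auto simp: prob_space_D)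
  also have "(\<integral>y. indicator {i} y \<partial>D) = measure D {i}"
    using assms by (simp add: Int_absorb1)
  also have "\<dots> = \<pi> i"
    using assms prob_pos[OF assms] by (simp add: measure_def emeasure_D)
  finally show ?thesis .
qed

lemma depends_T: "u \<in> W \<Longrightarrow> depends {take k u | k. k < length u} (\<lambda>x. T x j u)"
  unfolding depends_def
  by (intro conjI ballI impI T_cong) (auto simp: take_W)

lemma stop_line_single: "u \<in> W \<Longrightarrow> stop_line {take k u | k. k < length u} {u}"
  unfolding stop_line_def by (auto dest!: arg_cong[where f = length])

definition unit_fun :: "(('e list \<Rightarrow> 'i) \<Rightarrow> real) \<Rightarrow> bool" where
  "unit_fun f \<longleftrightarrow> f \<in> borel_measurable Om \<and> (\<forall>x\<in>X0. 0 \<le> f x \<and> f x \<le> 1)"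

lemma unit_funD:
  "unit_fun f \<Longrightarrow> f \<in> borel_measurable Om" "unit_fun f \<Longrightarrow> x \<in> X0 \<Longrightarrow> 0 \<le> f x"
  "unit_fun f \<Longrightarrow> x \<in> X0 \<Longrightarrow> f x \<le> 1"
  unfolding unit_fun_def by blast+

lemma integrable_unit_fun: "unit_fun f \<Longrightarrow> integrable Om f"
  by (rule Om.integrable_const_bound[of _ 1])
    (auto simp: space_Om unit_funD intro!: AE_I2)

lemma integral_unit_fun: 
  assumes "unit_fun f" shows "0 \<le> (\<integral>x. f x \<partial>Om)" "(\<integral>x. f x \<partial>Om) \<le> 1"
proof -
  show "0 \<le> (\<integral>x. f x \<partial>Om)"
    by (rule Bochner_Integration.integral_nonneg) (simp add: unit_funD(2)[OF assms] space_Om)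
  have "(\<integral>x. f x \<partial>Om) \<le> (\<integral>x. 1 \<partial>Om)"
    by (rule integral_mono[OF integrable_unit_fun[OF assms]]) (simp_all add: unit_funD(3)[OF assms] space_Om)
  then show "(\<integral>x. f x \<partial>Om) \<le> 1" by (simp add: Om.prob_space)
qed

lemma unit_fun_T: 
  assumes "u \<in> W" shows "unit_fun (\<lambda>x. if T x j u then 1 else 0)"
  unfolding unit_fun_def
proof
  have "depends {take k u | k. k < length u} (\<lambda>x. if T x j u then 1 else 0 :: real)"
    by (rule depends_comp[OF depends_T[OF assms]])
  then show "(\<lambda>x. if T x j u then 1 else 0 :: real) \<in> borel_measurable Om"
    by (rule measurable_depends) simp
qed simp

lemma unit_fun_mult: "unit_fun f \<Longrightarrow> unit_fun g \<Longrightarrow> unit_fun (\<lambda>x. f x * g x)"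
  unfolding unit_fun_def by (auto intro: mult_le_one)

lemma unit_fun_sh: "u \<in> W \<Longrightarrow> unit_fun f \<Longrightarrow> unit_fun (\<lambda>x. f (sh u x))"
  unfolding unit_fun_def using measurable_compose[OF measurable_sh] sh_X0 by blast

text \<open>Presence of u is decided by the labels of proper prefixes of u, while
  \<open>sh u x\<close> consists of the labels of u and its extensions; the two are
  independent.\<close>

lemma integral_path:
  assumes u: "u \<in> W" and f: "unit_fun f"
  shows "(\<integral>x. (if T x j u then f (sh u x) else 0) \<partial>Om) = hits j u * (\<integral>x. f x \<partial>Om)"
    and "unit_fun (\<lambda>x. if T x j u then f (sh u x) else 0)"
proof -
  let ?B = "\<lambda>x. if T x j u then {u} else {}"
  have "depends {take k u | k. k < length u} ?B"
    by (rule depends_comp[OF depends_T[OF u]])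
  from branch_integral_fixed(1)[OF this stop_line_single[OF u] subset_refl, of "\<lambda>_. f"]
  have "(\<integral>x. (if ?B x = {u} then 1 else 0) * (\<Prod>w\<in>{u}. f (sh w x)) \<partial>Om) =
    (\<integral>x. (if ?B x = {u} then 1 else 0) \<partial>Om) * (\<Prod>w\<in>{u}. \<integral>x. f x \<partial>Om)"
    using f by (auto simp: unit_funD)
  moreover have "(if ?B x = {u} then 1 else 0 :: real) = (if T x j u then 1 else 0)" for x by simp
  moreover have "(if T x j u then f (sh u x) else 0) = (if T x j u then 1 else 0) * f (sh u x)" for x by simp
  ultimately show "(\<integral>x. (if T x j u then f (sh u x) else 0) \<partial>Om) = hits j u * (\<integral>x. f x \<partial>Om)"
    by (simp add: hits_def)
  show "unit_fun (\<lambda>x. if T x j u then f (sh u x) else 0)"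
    using unit_fun_mult[OF unit_fun_T[OF u, of j] unit_fun_sh[OF u f]]
    by (rule back_subst[of unit_fun]) auto
qed

lemma hits_Nil [simp]: "hits j [] = 1"
  by (simp add: hits_def Om.prob_space)

text \<open>The letter e belongs to one graph only, so it can start the word exactly when the root
  label is i. The rest of the path is read from the independent subtree at
  \<open>[e]\<close>.\<close>

lemma hits_Cons:
  assumes i: "i \<in> \<Lambda>" "e \<in> out_arcs (G i) j" and u: "u \<in> W"
  shows "hits j (e # u) = \<pi> i * hits (tgt e) u"
proof -
  have e: "e \<in> E" using i out_arcs_E by blast
  have lab: "e \<in> out_arcs (G (x [])) j \<longleftrightarrow> x [] = i" if "x \<in> X0" for x
  proof
    assume "e \<in> out_arcs (G (x [])) j"
    then have "lab e = x []" using lab_eq[OF X0_D[OF that W_simps(1)], of e] by simp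
    then show "x [] = i" using lab_eq[OF i(1), of e] i(2) by simp
  qed (use i(2) in simp)
  have T: "T x j (e # u) \<longleftrightarrow> x [] = i \<and> T (sh [e] x) (tgt e) u" if "x \<in> X0" for x
    unfolding T_Cons[OF e u] lab[OF that] ..
  let ?B = "\<lambda>x. if x [] = i then {[e]} else {}"
  have "depends {[]} ?B" unfolding depends_def by simp
  moreover have "stop_line {[]} {[e]}" using e by (simp add: stop_line_def)
  ultimately have H: "(\<integral>x. (if ?B x = {[e]} then 1 else 0 :: real) * (\<Prod>w\<in>{[e]}. if T (sh w x) (tgt e) u then 1 else 0) \<partial>Om) =
    (\<integral>x. (if ?B x = {[e]} then 1 else 0) \<partial>Om) * (\<Prod>w\<in>{[e]}. \<integral>x. (if T x (tgt e) u then 1 else 0) \<partial>Om)"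
    by (rule branch_integral_fixed(1)[where b = "{[e]}" and g = "\<lambda>_ x. if T x (tgt e) u then 1 else 0"])
      (use unit_funD[OF unit_fun_T[OF u]] in auto)
  have B: "?B x = {[e]} \<longleftrightarrow> x [] = i" for x by simp
  have "(\<integral>x. (if x [] = i then 1 else 0 :: real) * (if T (sh [e] x) (tgt e) u then 1 else 0) \<partial>Om) = \<pi> i * hits (tgt e) u"
    using H[unfolded B] by (simp add: integral_label i hits_def)
  moreover have "hits j (e # u) = (\<integral>x. (if x [] = i then 1 else 0) * (if T (sh [e] x) (tgt e) u then 1 else 0) \<partial>Om)"
    unfolding hits_def by (rule Bochner_Integration.integral_cong) (auto simp: T space_Om)
  ultimately show ?thesis by simp
qed

lemma word_path_hits:
  "word_path G j u es w \<Longrightarrow> u \<in> lists \<Lambda> \<Longrightarrow> es \<in> W \<and> endv j es = w \<and> hits j es > 0"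
proof (induction u arbitrary: j es)
  case Nil
  then show ?case by (cases es) auto
next
  case (Cons i u)
  then obtain e es' where es: "es = e # es'" by (cases es) auto
  have i: "i \<in> \<Lambda>" "e \<in> out_arcs (G i) j" "word_path G (head (G i) e) u es' w"
    using Cons.prems by (auto simp: es)
  have "tgt e = head (G i) e" using lab_eq[of i e] i by (simp add: tgt_def)
  then have IH: "es' \<in> W \<and> endv (tgt e) es' = w \<and> hits (tgt e) es' > 0"
    using Cons.IH[of "tgt e" es'] i Cons.prems(2) by simp
  have "e \<in> E" using i out_arcs_E by blast
  then show ?case using IH hits_Cons[OF i(1,2)] prob_pos[OF i(1)] by (simp add: es)
qed

lemma ex_return_paths:
  assumes "v0 \<in> V"
  shows "\<exists>es. \<forall>j\<in>V. es j \<in> W \<and> endv j (es j) = v0 \<and> hits j (es j) > 0"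
proof -
  have "\<forall>j\<in>V. \<exists>es. es \<in> W \<and> endv j es = v0 \<and> hits j es > 0"
  proof
    fix j assume "j \<in> V"
    then obtain u es where "u \<in> lists \<Lambda>" "word_path G j u es v0"
      using connected assms unfolding stochastically_strongly_connected_def by blast
    then show "\<exists>es. es \<in> W \<and> endv j es = v0 \<and> hits j es > 0" using word_path_hits by blast
  qed
  then show ?thesis by (rule bchoice)
qed

lemma finite_V: "finite V"
proof -
  obtain i where "i \<in> \<Lambda>" using \<Lambda>_ne by blast
  then show ?thesis using graphs fin_digraph.finite_verts by blast
qed

end

section \<open>The percolation on the tree of separated pieces\<close>

text \<open>
  In the assumption \<open>supercritical\<close> the summand besides \<open>1\<close> absorbs the nonlinearity of
  \<open>1 - (1 - z)\<^sup>n\<close>, through the lower bound \<open>n z / (1 + n z)\<close>.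
\<close>

locale separated_branching = random_recursive \<Lambda> V G \<pi> c S \<Delta>
  for \<Lambda> :: "'i set" and V :: "'v set" and G :: "'i \<Rightarrow> ('v, 'e) pre_digraph"
    and \<pi> :: "'i \<Rightarrow> real" and c :: "'e \<Rightarrow> real" and S :: "'e \<Rightarrow> 'a::euclidean_space \<Rightarrow> 'a"
    and \<Delta> :: "'a set" +
  fixes v0 :: 'v and es :: "'v \<Rightarrow> 'e list" and \<rho> p \<kappa> q :: real
  assumes v0: "v0 \<in> V"
    and es: "\<And>j. j \<in> V \<Longrightarrow> es j \<in> W" "\<And>j. j \<in> V \<Longrightarrow> endv j (es j) = v0"
      "\<And>j. j \<in> V \<Longrightarrow> \<kappa> \<le> hits j (es j)"
    and \<kappa>: "\<kappa> > 0"
    and \<rho>: "0 < \<rho>" "\<rho> < 1"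
    and p: "0 < p" "p \<le> 1"
    and q: "0 < q" "q \<le> 1"
    and supercritical: "1 + real (card (line \<rho>)) * (p * \<kappa> * q) \<le> p * \<kappa> * mean_sel \<rho> v0"
begin

text \<open>Follows the return path from j to \<open>v0\<close> before f is applied; an absent path
  counts as death. All offspring is thereby of the type \<open>v0\<close> again.\<close>

definition hit :: "(('e list \<Rightarrow> 'i) \<Rightarrow> real) \<Rightarrow> 'v \<Rightarrow> ('e list \<Rightarrow> 'i) \<Rightarrow> real" where
  "hit f j x = (if T x j (es j) then f (sh (es j) x) else 0)"

text \<open>
  If \<open>f\<close> gives the conditional probabilities of surviving \<open>n\<close> generations of the percolation in the
  tree rooted at \<open>v0\<close>, then \<open>survive f\<close> gives those of surviving \<open>n + 1\<close> generations.
\<close>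

definition survive :: "(('e list \<Rightarrow> 'i) \<Rightarrow> real) \<Rightarrow> ('e list \<Rightarrow> 'i) \<Rightarrow> real" where
  "survive f x = 1 - (\<Prod>w\<in>sel \<rho> v0 x. 1 - p * hit f (endv v0 w) (sh w x))"

primrec phi :: "nat \<Rightarrow> ('e list \<Rightarrow> 'i) \<Rightarrow> real" where
  "phi 0 = (\<lambda>_. 1)"
| "phi (Suc n) = survive (phi n)"

lemma \<kappa>_le_1: "\<kappa> \<le> 1"
proof -
  have "hits v0 (es v0) \<le> 1"
    unfolding hits_def by (rule integral_unit_fun(2)) (rule unit_fun_T[OF es(1)[OF v0]])
  then show ?thesis using es(3)[OF v0] by simp
qed

lemma sel_W: "w \<in> sel \<rho> v0 x \<Longrightarrow> w \<in> W"
  using sel_line[OF \<rho>(1)] line_W by blast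

lemma sel_endv: "w \<in> sel \<rho> v0 x \<Longrightarrow> endv v0 w \<in> V"
  using endv_V[OF sel_W v0] .

lemma line_endv: "w \<in> line \<rho> \<Longrightarrow> endv v0 w \<in> V"
  using endv_V[OF line_W v0] .

lemma unit_hit: "unit_fun f \<Longrightarrow> j \<in> V \<Longrightarrow> unit_fun (hit f j)"
  unfolding hit_def[abs_def] by (rule integral_path(2)[OF es(1)])

lemma integral_hit: "unit_fun f \<Longrightarrow> j \<in> V \<Longrightarrow> (\<integral>x. hit f j x \<partial>Om) = hits j (es j) * (\<integral>x. f x \<partial>Om)"
  unfolding hit_def[abs_def] by (rule integral_path(1)[OF es(1)])

lemma unit_one_minus_hit: 
  assumes "unit_fun f" "j \<in> V" shows "unit_fun (\<lambda>x. 1 - p * hit f j x)"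
  unfolding unit_fun_def
proof (intro conjI ballI)
  note h = unit_hit[OF assms]
  show "(\<lambda>x. 1 - p * hit f j x) \<in> borel_measurable Om" using unit_funD(1)[OF h] by measurable
  fix x assume "x \<in> X0"
  then have "0 \<le> hit f j x" "hit f j x \<le> 1" using unit_funD[OF h] by auto
  then show "0 \<le> 1 - p * hit f j x" "1 - p * hit f j x \<le> 1"
    using p mult_le_one[of p "hit f j x"] by auto
qed

lemma unit_survive:
  assumes "unit_fun f" shows "unit_fun (survive f)"
  unfolding unit_fun_def
proof (intro conjI ballI)
  note u = unit_one_minus_hit[OF assms]
  have "(\<lambda>x. \<Prod>w\<in>sel \<rho> v0 x. (\<lambda>y. 1 - p * hit f (endv v0 w) y) (sh w x)) \<in> borel_measurable Om"
    by (rule branch_measurable[OF depends_sel[OF \<rho>(1)] finite_line[OF \<rho>(1)] _ sel_line[OF \<rho>(1)]])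
       (auto simp: line_W intro!: unit_funD(1)[OF u] line_endv)
  then show "survive f \<in> borel_measurable Om"
    unfolding survive_def[abs_def] by measurable
  fix x assume x: "x \<in> X0"
  have w: "0 \<le> 1 - p * hit f (endv v0 w) (sh w x) \<and> 1 - p * hit f (endv v0 w) (sh w x) \<le> 1"
    if "w \<in> sel \<rho> v0 x" for w
    using unit_funD(2,3)[OF u[OF sel_endv[OF that]] sh_X0[OF x sel_W[OF that]]] by blast
  show "0 \<le> survive f x" unfolding survive_def using prod_le_1[OF w] by simp
  have "0 \<le> (\<Prod>w\<in>sel \<rho> v0 x. 1 - p * hit f (endv v0 w) (sh w x))"
    by (rule prod_nonneg) (use w in blast)
  then show "survive f x \<le> 1" unfolding survive_def by simp
qed

lemma unit_phi: "unit_fun (phi n)"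
proof (induction n)
  case 0
  then show ?case by (simp add: unit_fun_def)
qed (simp add: unit_survive)

lemma survive_mono:
  assumes f: "unit_fun f" "unit_fun g" "\<And>x. x \<in> X0 \<Longrightarrow> f x \<le> g x" and x: "x \<in> X0"
  shows "survive f x \<le> survive g x"
proof -
  have "(\<Prod>w\<in>sel \<rho> v0 x. 1 - p * hit g (endv v0 w) (sh w x)) \<le> (\<Prod>w\<in>sel \<rho> v0 x. 1 - p * hit f (endv v0 w) (sh w x))"
  proof (rule prod_mono)
    fix w assume w: "w \<in> sel \<rho> v0 x"
    have "hit f (endv v0 w) (sh w x) \<le> hit g (endv v0 w) (sh w x)"
      using f(3) sh_X0[OF sh_X0[OF x sel_W[OF w]] es(1)[OF sel_endv[OF w]]] by (simp add: hit_def)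
    moreover have "0 \<le> 1 - p * hit g (endv v0 w) (sh w x)"
      using unit_funD(2)[OF unit_one_minus_hit[OF f(2) sel_endv[OF w]] sh_X0[OF x sel_W[OF w]]] .
    ultimately show "0 \<le> 1 - p * hit g (endv v0 w) (sh w x) \<and>
        1 - p * hit g (endv v0 w) (sh w x) \<le> 1 - p * hit f (endv v0 w) (sh w x)"
      using p by (auto intro: mult_left_mono)
  qed
  then show ?thesis by (simp add: survive_def)
qed

lemma phi_Suc_le: "x \<in> X0 \<Longrightarrow> phi (Suc n) x \<le> phi n x"
proof (induction n arbitrary: x)
  case 0
  then show ?case using unit_funD(3)[OF unit_phi[of 1]] by simp
next
  case (Suc n)
  then show ?case using survive_mono[OF unit_phi[of "Suc n"] unit_phi[of n]] by simp
qed

text \<open>A selected word has a surviving continuation with probability at least z = p \<kappa> q.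
  Given n selected words, the chance that some survives is at least n z / (1 + n z). As n is at most
  the size L of the line, this is at least n z / (1 + L z), which is linear in n, so only the mean
  of n enters. Supercriticality makes the result at least q.\<close>

lemma integral_survive_ge:
  assumes f: "unit_fun f" and fq: "q \<le> (\<integral>x. f x \<partial>Om)"
  shows "q \<le> (\<integral>x. survive f x \<partial>Om)"
proof -
  define z where "z = p * \<kappa> * q"
  have "p * \<kappa> \<le> 1" using p \<kappa> \<kappa>_le_1 by (intro mult_le_one) auto
  then have z: "0 \<le> z" "z \<le> 1" using p q \<kappa> by (auto simp: z_def intro: mult_le_one)
  note u = unit_one_minus_hit[OF f]
  let ?P = "\<lambda>x. \<Prod>w\<in>sel \<rho> v0 x. 1 - p * hit f (endv v0 w) (sh w x)"
  let ?Q = "\<lambda>x. \<Prod>w\<in>sel \<rho> v0 x. \<integral>y. 1 - p * hit f (endv v0 w) y \<partial>Om"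
  let ?L = "real (card (line \<rho>))"
  have PQ: "(\<integral>x. ?P x \<partial>Om) = (\<integral>x. ?Q x \<partial>Om)"
    by (rule branch_integral[OF depends_sel[OF \<rho>(1)] stop_line_line[OF \<rho>(1)] sel_line[OF \<rho>(1)],
        where g = "\<lambda>w y. 1 - p * hit f (endv v0 w) y"])
       (use unit_funD[OF u[OF line_endv]] in auto)
  have h: "0 \<le> (\<integral>y. 1 - p * hit f (endv v0 w) y \<partial>Om) \<and> (\<integral>y. 1 - p * hit f (endv v0 w) y \<partial>Om) \<le> 1 - z"
    if "w \<in> line \<rho>" for w
  proof
    note j = line_endv[OF that]
    show "0 \<le> (\<integral>y. 1 - p * hit f (endv v0 w) y \<partial>Om)" by (rule integral_unit_fun(1)[OF u[OF j]])
    have "(\<integral>y. 1 - p * hit f (endv v0 w) y \<partial>Om) = 1 - p * (hits (endv v0 w) (es (endv v0 w)) * (\<integral>x. f x \<partial>Om))"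
      using integrable_unit_fun[OF unit_hit[OF f j]] by (simp add: integral_hit[OF f j] Om.prob_space)
    moreover have "\<kappa> * q \<le> hits (endv v0 w) (es (endv v0 w)) * (\<integral>x. f x \<partial>Om)"
      using es(3)[OF j] fq q \<kappa> by (intro mult_mono) auto
    ultimately show "(\<integral>y. 1 - p * hit f (endv v0 w) y \<partial>Om) \<le> 1 - z"
      using p by (simp add: z_def mult.assoc)
  qed
  have Q: "?Q x \<le> 1 - real (card (sel \<rho> v0 x)) * z / (1 + ?L * z)" for x
  proof -
    let ?n = "real (card (sel \<rho> v0 x))"
    have "?Q x \<le> (\<Prod>w\<in>sel \<rho> v0 x. 1 - z)"
      using h sel_line[OF \<rho>(1), of v0 x] by (intro prod_mono) blast
    also have "\<dots> = (1 - z) ^ card (sel \<rho> v0 x)" by simp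
    also have "\<dots> \<le> 1 - ?n * z / (1 + ?n * z)" using one_minus_power_ge[OF z, of "card (sel \<rho> v0 x)"] by linarith
    finally have "?Q x \<le> 1 - ?n * z / (1 + ?n * z)" .
    moreover have "?n * z / (1 + ?L * z) \<le> ?n * z / (1 + ?n * z)"
    proof (rule divide_left_mono)
      have "card (sel \<rho> v0 x) \<le> card (line \<rho>)"
        by (intro card_mono finite_line sel_line \<rho>)
      then show "1 + ?n * z \<le> 1 + ?L * z" using z by (simp add: mult_right_mono)
      show "0 < (1 + ?L * z) * (1 + ?n * z)"
        using z by (intro mult_pos_pos add_pos_nonneg mult_nonneg_nonneg) auto
    qed (use z in simp)
    ultimately show ?thesis by linarith
  qed
  have Qint: "integrable Om ?Q"
  proof (rule Om.integrable_const_bound[of _ 1])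
    show "?Q \<in> borel_measurable Om"
      by (rule measurable_fun_sel[OF \<rho>(1), of "\<lambda>B. \<Prod>w\<in>B. \<integral>y. 1 - p * hit f (endv v0 w) y \<partial>Om"])
    show "AE x in Om. norm (?Q x) \<le> 1"
    proof (rule AE_I2)
      fix x
      have b: "0 \<le> (\<integral>y. 1 - p * hit f (endv v0 w) y \<partial>Om) \<and> (\<integral>y. 1 - p * hit f (endv v0 w) y \<partial>Om) \<le> 1"
        if "w \<in> sel \<rho> v0 x" for w
        using h[of w] sel_line[OF \<rho>(1), of v0 x] that z by force
      have "0 \<le> ?Q x" by (rule prod_nonneg) (use b in blast)
      moreover have "?Q x \<le> 1" by (rule prod_le_1) (rule b)
      ultimately show "norm (?Q x) \<le> 1" by simp
    qed
  qed
  have Pint: "integrable Om ?P"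
  proof -
    have "integrable Om (\<lambda>x. 1 - survive f x)"
      using integrable_unit_fun[OF unit_survive[OF f]] by simp
    then show ?thesis by (simp add: survive_def)
  qed
  have "q * (1 + ?L * z) \<le> mean_sel \<rho> v0 * z"
    using mult_left_mono[OF supercritical, of q] q by (simp add: z_def algebra_simps)
  then have "q \<le> mean_sel \<rho> v0 * z / (1 + ?L * z)"
    using z by (subst pos_le_divide_eq) (auto intro!: add_pos_nonneg mult_nonneg_nonneg)
  also have "\<dots> = (\<integral>x. real (card (sel \<rho> v0 x)) * z / (1 + ?L * z) \<partial>Om)"
    by (simp add: mean_sel_def)
  also have "\<dots> \<le> (\<integral>x. 1 - ?Q x \<partial>Om)"
    using Q integrable_card_sel[OF \<rho>(1), of v0] Qint
    by (intro integral_mono) (auto simp: algebra_simps)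
  also have "\<dots> = 1 - (\<integral>x. ?Q x \<partial>Om)" using Qint by (simp add: Om.prob_space)
  also have "\<dots> = (\<integral>x. survive f x \<partial>Om)"
    unfolding survive_def PQ[symmetric] using Pint by (simp add: Om.prob_space)
  finally show ?thesis .
qed

lemma integral_phi_ge: "q \<le> (\<integral>x. phi n x \<partial>Om)"
proof (induction n)
  case 0
  then show ?case using q by (simp add: Om.prob_space)
next
  case (Suc n)
  then show ?case using integral_survive_ge[OF unit_phi] by simp
qed

definition A :: "('e list \<Rightarrow> 'i) set" where "A = {x \<in> X0. \<forall>n. q / 2 \<le> phi n x}"

text \<open>Since \<open>phi n\<close> is at most 1, its mean is at most q / 2 plus the probability
  that it is at least q / 2. The latter events decrease with n, so the bound passes to their
  intersection.\<close>

lemma A_sets: "A \<in> sets Om" and measure_A: "q / 2 \<le> measure Om A"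
proof -
  define B where "B = (\<lambda>n. {x \<in> space Om. q / 2 \<le> phi n x})"
  have B: "B n \<in> sets Om" for n
    unfolding B_def using unit_funD(1)[OF unit_phi[of n]] by measurable
  have A: "A = (\<Inter>n. B n)" by (auto simp: A_def B_def space_Om)
  then show "A \<in> sets Om" using B by auto
  have "q / 2 \<le> measure Om (B n)" for n
  proof -
    have int: "integrable Om (\<lambda>x. q / 2 + indicator (B n) x :: real)"
      by (intro Bochner_Integration.integrable_add Om.integrable_const integrable_real_indicator B)
        (simp add: Om.emeasure_eq_measure)
    have "q \<le> (\<integral>x. phi n x \<partial>Om)" by (rule integral_phi_ge)
    also have "\<dots> \<le> (\<integral>x. q / 2 + indicator (B n) x \<partial>Om)"
    proof (rule integral_mono[OF integrable_unit_fun[OF unit_phi] int])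
      fix x assume "x \<in> space Om"
      then show "phi n x \<le> q / 2 + indicator (B n) x"
        using unit_funD(3)[OF unit_phi, of x n] q by (cases "x \<in> B n") (auto simp: B_def space_Om)
    qed
    also have "\<dots> = q / 2 + measure Om (B n)"
      using B[of n] sets.sets_into_space[OF B[of n]]
      by (subst Bochner_Integration.integral_add)
        (auto simp: Om.prob_space Int_absorb1 Om.emeasure_eq_measure intro!: integrable_real_indicator)
    finally show ?thesis by simp
  qed
  moreover have "(\<lambda>n. measure Om (B n)) \<longlonglongrightarrow> measure Om (\<Inter>n. B n)"
  proof (rule Om.finite_Lim_measure_decseq)
    show "decseq B"
      by (rule decseq_SucI) (use phi_Suc_le in \<open>auto simp: B_def space_Om intro: order_trans simp del: phi.simps\<close>)
  qed (use B in auto)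
  ultimately show "q / 2 \<le> measure Om A"
    unfolding A by (intro LIMSEQ_le_const) auto
qed

definition phi_lim :: "('e list \<Rightarrow> 'i) \<Rightarrow> real" where "phi_lim x = (INF n. phi n x)"

lemma phi_tendsto:
  assumes "x \<in> X0" shows "(\<lambda>n. phi n x) \<longlonglongrightarrow> phi_lim x"
  unfolding phi_lim_def
proof (rule LIMSEQ_decseq_INF)
  show "bdd_below (range (\<lambda>n. phi n x))"
    by (rule bdd_belowI[of _ 0]) (use unit_funD(2)[OF unit_phi assms] in auto)
  show "decseq (\<lambda>n. phi n x)" by (rule decseq_SucI) (rule phi_Suc_le[OF assms])
qed

lemma phi_lim_bounds:
  assumes "x \<in> X0" shows "0 \<le> phi_lim x" "phi_lim x \<le> 1"
  using LIMSEQ_le_const[OF phi_tendsto[OF assms], of 0] LIMSEQ_le_const2[OF phi_tendsto[OF assms], of 1]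
    unit_funD(2,3)[OF unit_phi assms] by blast+

lemma hit_tendsto:
  assumes "x \<in> X0" "j \<in> V" shows "(\<lambda>n. hit (phi n) j x) \<longlonglongrightarrow> hit phi_lim j x"
  using phi_tendsto[OF sh_X0[OF assms(1) es(1)[OF assms(2)]]] by (simp add: hit_def)

text \<open>The union bound at every finite generation, followed by the limit. This is the
  inequality that \<open>tree_content\<close> asks of \<mu>.\<close>

lemma phi_lim_le:
  assumes x: "x \<in> X0"
  shows "phi_lim x \<le> p * (\<Sum>w\<in>sel \<rho> v0 x. hit phi_lim (endv v0 w) (sh w x))"
proof (rule LIMSEQ_le)
  show "(\<lambda>n. phi (Suc n) x) \<longlonglongrightarrow> phi_lim x"
    by (rule LIMSEQ_Suc[OF phi_tendsto[OF x]])
  show "(\<lambda>n. p * (\<Sum>w\<in>sel \<rho> v0 x. hit (phi n) (endv v0 w) (sh w x))) \<longlonglongrightarrow>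
      p * (\<Sum>w\<in>sel \<rho> v0 x. hit phi_lim (endv v0 w) (sh w x))"
    by (intro tendsto_intros hit_tendsto sh_X0 x sel_W sel_endv)
  have "phi (Suc n) x \<le> p * (\<Sum>w\<in>sel \<rho> v0 x. hit (phi n) (endv v0 w) (sh w x))" for n
  proof -
    have "1 - (\<Prod>w\<in>sel \<rho> v0 x. 1 - p * hit (phi n) (endv v0 w) (sh w x)) \<le>
        (\<Sum>w\<in>sel \<rho> v0 x. p * hit (phi n) (endv v0 w) (sh w x))"
    proof (rule one_minus_prod_le_sum[OF finite_sel[OF \<rho>(1)]])
      fix w assume w: "w \<in> sel \<rho> v0 x"
      show "0 \<le> p * hit (phi n) (endv v0 w) (sh w x) \<and> p * hit (phi n) (endv v0 w) (sh w x) \<le> 1"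
        using unit_funD(2,3)[OF unit_one_minus_hit[OF unit_phi[of n] sel_endv[OF w]] sh_X0[OF x sel_W[OF w]]]
        by simp
    qed
    then show ?thesis by (simp add: survive_def sum_distrib_left)
  qed
  then show "\<exists>N. \<forall>n\<ge>N. phi (Suc n) x \<le> p * (\<Sum>w\<in>sel \<rho> v0 x. hit (phi n) (endv v0 w) (sh w x))"
    by blast
qed

end

section \<open>From survival to a lower bound for the dimension\<close>

lemma (in random_recursive) cw_line_lower:
  assumes "u \<in> line \<rho>" "\<rho> > 0" obtains e where "e \<in> E" "\<rho> * c e \<le> cw u"
proof
  have u: "u \<noteq> []" "u \<in> W" "\<rho> < cw (butlast u)" using assms by (auto simp: line_def)
  then show e: "last u \<in> E" by (auto simp: W_def)
  have "cw u = cw (butlast u @ [last u])" using u by simp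
  also have "\<dots> = cw (butlast u) * c (last u)" by (simp del: append_butlast_last_id)
  finally show "\<rho> * c (last u) \<le> cw u" using u(3) c_E[OF e] by (simp add: mult_right_mono)
qed

context separated_branching
begin

text \<open>Applies \<open>tree_content\<close> to the tree whose nodes are the words built from w0
  by repeatedly appending a selected word and its return path, with \<open>phi_lim\<close> of the
  subtree as mass.\<close>

lemma dim_ge:
  assumes t: "t > 0" and cs: "0 < cs" "cs \<le> 1" "\<And>e j. e \<in> E \<Longrightarrow> j \<in> V \<Longrightarrow> cs \<le> c e * cw (es j)"
    and pt: "p = (\<rho> * cs) powr t"
    and x: "x \<in> X0" and w0: "w0 \<in> W" "T x v w0" "endv v w0 = v0" "sh w0 x \<in> A"
  shows "ereal t \<le> hausdorff_dim (attractor G S \<Delta> x v)"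
proof (rule hausdorff_dim_ge[OF t])
  \<comment> \<open>One generation multiplies the ratio by at least \<open>r\<close>. The number
    \<open>b\<close> is the separation at generation 0: a gap \<rho> scaled by the ratio of
    w0.\<close>
  define r where "r = \<rho> * cs"
  define b where "b = cw w0 * \<rho>"
  have r: "0 < r" "r < 1"
    using \<rho> cs mult_strict_mono[of \<rho> 1 cs 1] mult_less_le_imp_less[of \<rho> 1 cs 1] by (auto simp: r_def)
  have b: "0 < b" using cw_pos[OF w0(1)] \<rho> by (simp add: b_def)
  have "q / 2 \<le> phi_lim (sh w0 x)"
    using w0(4) sh_X0[OF x w0(1)] by (intro LIMSEQ_le_const[OF phi_tendsto]) (auto simp: A_def)
  then have phi0: "0 < phi_lim (sh w0 x)" using q by simp
  then show "0 < b powr t * phi_lim (sh w0 x)" using b by simp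
  fix U :: "nat \<Rightarrow> 'a set"
  assume U: "attractor G S \<Delta> x v \<subseteq> (\<Union>i. U i)" "\<And>i. bounded (U i)"
  define Bw where "Bw = (\<lambda>w. {u \<in> sel \<rho> v0 (sh w x). T (sh (w @ u) x) (endv v0 u) (es (endv v0 u))})"
  define nxt where "nxt = (\<lambda>w u. w @ u @ es (endv v0 u))"
  define child where "child = (\<lambda>m :: 'e list \<times> nat. (\<lambda>u. (nxt (fst m) u, Suc (snd m))) ` Bw (fst m))"
  \<comment> \<open>A node stores its generation, since a word does not display how many steps built
    it. The bound on the ratio yields the separation, and the bound on the length lets the limit
    point of a branch lie in every level of the attractor.\<close>
  define TT where "TT = {m :: 'e list \<times> nat. fst m \<in> W \<and> T x v (fst m) \<and> endv v (fst m) = v0 \<and>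
    cw w0 * r ^ snd m \<le> cw (fst m) \<and> snd m \<le> length (fst m)}"
  have Bw: "u \<in> line \<rho>" "u \<in> W" "endv v0 u \<in> V" "es (endv v0 u) \<in> W" "T (sh w x) v0 u" if "u \<in> Bw w" for u w
  proof -
    have u: "u \<in> sel \<rho> v0 (sh w x)" using that by (simp add: Bw_def)
    show "u \<in> line \<rho>" using u sel_line[OF \<rho>(1)] by blast
    show "u \<in> W" "endv v0 u \<in> V" using sel_W[OF u] sel_endv[OF u] .
    then show "es (endv v0 u) \<in> W" using es(1) by blast
    show "T (sh w x) v0 u" using sel_T[OF \<rho>(1) u] .
  qed
  \<comment> \<open>Selected words form a prefix-free set, so appending return paths cannot identify
    two of them.\<close>
  have inj: "inj_on (nxt w) (Bw w)" for w
  proof (rule inj_onI)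
    fix u u' assume u: "u \<in> Bw w" "u' \<in> Bw w" "nxt w u = nxt w u'"
    then have "u @ es (endv v0 u) = u' @ es (endv v0 u')" by (simp add: nxt_def)
    then show "u = u'"
      using stop_line_line[OF \<rho>(1)] Bw(1,4)[OF u(1)] Bw(1,4)[OF u(2)] unfolding stop_line_def by blast
  qed
  have prefix: "word_map S (nxt w u) ` \<Delta> \<subseteq> word_map S (w @ u) ` \<Delta>" if "u \<in> Bw w" for w u
    using word_map_prefix[OF Bw(4)[OF that], of "w @ u"] by (simp add: nxt_def)
  have "ennreal (b powr t * phi_lim (sh (fst (w0, 0::nat)) x)) \<le> (\<Sum>i. diam_pow t (U i))"
  proof (rule tree_content[where z = "(w0, 0)" and T = TT and depth = snd and child = child and r = r
        and P = "\<lambda>m. word_map S (fst m) ` \<Delta>" and \<mu> = "\<lambda>m. phi_lim (sh (fst m) x)", OF _ _ _ _ _ _ _ r t b _ U])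
    show "(w0, 0) \<in> TT" using w0 by (simp add: TT_def)
    show "snd (w0, 0) = 0" by simp
  next
    fix m d assume m: "m \<in> TT" "d \<in> child m"
    then obtain u where u: "u \<in> Bw (fst m)" "d = (nxt (fst m) u, Suc (snd m))" by (auto simp: child_def)
    let ?w = "fst m"
    note B = Bw[OF u(1)]
    have w: "?w \<in> W" "T x v ?w" "endv v ?w = v0" "cw w0 * r ^ snd m \<le> cw ?w" "snd m \<le> length ?w"
      using m by (auto simp: TT_def)
    have "T x v (?w @ u)" using w B by (simp add: T_append)
    then have "T x v ((?w @ u) @ es (endv v0 u))"
      using w B u(1) by (subst T_append) (auto simp: Bw_def)
    then have 1: "T x v (nxt ?w u)" by (simp add: nxt_def)
    have 2: "nxt ?w u \<in> W" "endv v (nxt ?w u) = v0" using w B es(2)[OF B(3)] by (simp_all add: nxt_def)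
    obtain e where e: "e \<in> E" "\<rho> * c e \<le> cw u" using cw_line_lower[OF B(1) \<rho>(1)] .
    have "r \<le> \<rho> * (c e * cw (es (endv v0 u)))" unfolding r_def using cs(3)[OF e(1) B(3)] \<rho> by (intro mult_left_mono) auto
    also have "\<dots> = (\<rho> * c e) * cw (es (endv v0 u))" by simp
    also have "\<dots> \<le> cw u * cw (es (endv v0 u))"
      using e(2) cw_pos[OF B(4)] by (intro mult_right_mono) auto
    finally have "(cw w0 * r ^ snd m) * r \<le> cw ?w * (cw u * cw (es (endv v0 u)))"
      using w(4) cw_pos[OF w(1)] r by (intro mult_mono) auto
    then have 3: "cw w0 * r ^ Suc (snd m) \<le> cw (nxt ?w u)" by (simp add: nxt_def mult_ac)
    have "u \<noteq> []" using B(1) by (simp add: line_def)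
    then have 4: "Suc (snd m) \<le> length (nxt ?w u)" using w(5) by (cases u) (auto simp: nxt_def)
    have 5: "word_map S (nxt ?w u) ` \<Delta> \<subseteq> word_map S ?w ` \<Delta>"
      using prefix[OF u(1)] word_map_prefix[OF B(2), of ?w] by blast
    show "d \<in> TT \<and> snd d = Suc (snd m) \<and> word_map S (fst d) ` \<Delta> \<subseteq> word_map S (fst m) ` \<Delta>"
      using 1 2 3 4 5 u(2) by (simp add: TT_def)
  next
    fix m assume m: "m \<in> TT"
    have fB: "finite (Bw (fst m))" unfolding Bw_def using finite_sel[OF \<rho>(1)] by simp
    then show "finite (child m)" by (simp add: child_def)
    let ?w = "fst m"
    have w: "?w \<in> W" using m by (simp add: TT_def)
    note xw = sh_X0[OF x w]
    have "phi_lim (sh ?w x) \<le> p * (\<Sum>u\<in>sel \<rho> v0 (sh ?w x). hit phi_lim (endv v0 u) (sh u (sh ?w x)))"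
      by (rule phi_lim_le[OF xw])
    also have "(\<Sum>u\<in>sel \<rho> v0 (sh ?w x). hit phi_lim (endv v0 u) (sh u (sh ?w x))) =
        (\<Sum>u\<in>sel \<rho> v0 (sh ?w x). if T (sh (?w @ u) x) (endv v0 u) (es (endv v0 u)) then phi_lim (sh (nxt ?w u) x) else 0)"
    proof (rule sum.cong[OF refl])
      fix u assume u: "u \<in> sel \<rho> v0 (sh ?w x)"
      show "hit phi_lim (endv v0 u) (sh u (sh ?w x)) =
          (if T (sh (?w @ u) x) (endv v0 u) (es (endv v0 u)) then phi_lim (sh (nxt ?w u) x) else 0)"
        using w sel_W[OF u] es(1)[OF sel_endv[OF u]] by (simp add: hit_def nxt_def sh_sh)
    qed
    also have "\<dots> = (\<Sum>u\<in>Bw ?w. phi_lim (sh (nxt ?w u) x))"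
      unfolding Bw_def using finite_sel[OF \<rho>(1)] by (intro sum.inter_filter[symmetric])
    also have "\<dots> = (\<Sum>d\<in>child m. phi_lim (sh (fst d) x))"
      unfolding child_def using inj[of ?w] by (subst sum.reindex) (auto simp: inj_on_def)
    finally show "0 \<le> phi_lim (sh ?w x) \<and> phi_lim (sh ?w x) \<le> 1 \<and>
        phi_lim (sh ?w x) \<le> r powr t * (\<Sum>d\<in>child m. phi_lim (sh (fst d) x))"
      using phi_lim_bounds[OF xw] by (simp add: pt r_def)
    show "compact (word_map S ?w ` \<Delta>) \<and> word_map S ?w ` \<Delta> \<noteq> {}"
      using compact_word_map[OF w] \<Delta>_ne by simp
  next
    fix m d d' y y'
    assume m: "m \<in> TT" and d: "d \<in> child m" "d' \<in> child m" "d \<noteq> d'"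
      and y: "y \<in> word_map S (fst d) ` \<Delta>" "y' \<in> word_map S (fst d') ` \<Delta>"
    let ?w = "fst m"
    have w: "?w \<in> W" "cw w0 * r ^ snd m \<le> cw ?w" using m by (auto simp: TT_def)
    obtain u u' where u: "u \<in> Bw ?w" "d = (nxt ?w u, Suc (snd m))" "u' \<in> Bw ?w" "d' = (nxt ?w u', Suc (snd m))"
      using d by (auto simp: child_def)
    have "y \<in> word_map S (?w @ u) ` \<Delta>" "y' \<in> word_map S (?w @ u') ` \<Delta>"
      using y prefix[OF u(1)] prefix[OF u(3)] u(2,4) by auto
    then obtain a a' where a: "a \<in> word_map S u ` \<Delta>" "a' \<in> word_map S u' ` \<Delta>"
        "y = word_map S ?w a" "y' = word_map S ?w a'"
      by (auto simp: word_map_append)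
    have "u \<noteq> u'" using d(3) u by auto
    then have "\<rho> < dist a a'"
      using sel_separated[OF \<rho>(1) _ _ _ a(1,2), of v0 "sh ?w x"] u by (simp add: Bw_def)
    have "b * r ^ snd m = (cw w0 * r ^ snd m) * \<rho>" by (simp add: b_def)
    also have "\<dots> \<le> cw ?w * \<rho>" using w(2) \<rho> by (intro mult_right_mono) auto
    also have "\<dots> < cw ?w * dist a a'" using \<open>\<rho> < dist a a'\<close> cw_pos[OF w(1)] by simp
    also have "\<dots> = dist y y'" using a by (simp add: dist_word_map[OF w(1)])
    finally show "b * r ^ snd m < dist y y'" .
  next
    fix f y assume f: "f 0 = (w0, 0)" "\<And>n. f n \<in> TT \<and> f (Suc n) \<in> child (f n)"
      and y: "\<And>n. y \<in> word_map S (fst (f n)) ` \<Delta>"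
    have depth: "snd (f n) = n" for n
    proof (induction n)
      case (Suc n)
      have "f (Suc n) \<in> child (f n)" using f(2) by blast
      then show ?case using Suc by (auto simp: child_def)
    qed (simp add: f(1))
    \<comment> \<open>A node of generation k has length at least k, so its prefix of length k is a
      word of level k whose piece contains y.\<close>
    have "y \<in> (\<Union>w\<in>{w. T x v w \<and> length w = k}. word_map S w ` \<Delta>)" for k
    proof -
      let ?w = "fst (f k)"
      have w: "?w \<in> W" "T x v ?w" "k \<le> length ?w" using f(2)[of k] depth[of k] by (auto simp: TT_def)
      have "y \<in> word_map S (take k ?w @ drop k ?w) ` \<Delta>" using y[of k] by simp
      then have "y \<in> word_map S (take k ?w) ` \<Delta>" using word_map_prefix[OF drop_W[OF w(1)]] by blast
      moreover have "T x v (take k ?w)" using T_prefix[OF w(2)] .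
      moreover have "length (take k ?w) = k" using w(3) by simp
      ultimately show ?thesis by blast
    qed
    then show "y \<in> attractor G S \<Delta> x v"
      using x by (subst attractor_eq) (auto simp: X0_D)
  qed
  then show "ennreal (b powr t * phi_lim (sh w0 x)) \<le> (\<Sum>i. diam_pow t (U i))" by simp
qed

end

section \<open>Strict convexity and the offspring generating function\<close>

text \<open>Convexity of a product along the segment from a to 1. Adjoining the factor of e leaves a
  surplus \<theta> (1 - \<theta>) (1 - a e) (1 - Q), where Q is the product of the other values of
  a. It is positive once another factor is present, because then Q < 1.\<close>

lemma prod_interp_le:
  fixes a :: "'b \<Rightarrow> real"
  assumes "finite A" "\<And>e. e \<in> A \<Longrightarrow> 0 \<le> a e \<and> a e < 1" "0 < \<theta>" "\<theta> < 1"
  shows "(\<Prod>e\<in>A. a e + \<theta> * (1 - a e)) \<le> (1 - \<theta>) * (\<Prod>e\<in>A. a e) + \<theta>"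
    and "card A \<ge> 2 \<Longrightarrow> (\<Prod>e\<in>A. a e + \<theta> * (1 - a e)) < (1 - \<theta>) * (\<Prod>e\<in>A. a e) + \<theta>"
proof -
  have step: "(a e + \<theta> * (1 - a e)) * R \<le> (1 - \<theta>) * (a e * Q) + \<theta> - \<theta> * (1 - \<theta>) * ((1 - a e) * (1 - Q))"
    if "e \<in> A" "R \<le> (1 - \<theta>) * Q + \<theta>" for e R Q
  proof -
    have "0 \<le> a e + \<theta> * (1 - a e)" using assms(2)[OF that(1)] assms(3) by simp
    then have "(a e + \<theta> * (1 - a e)) * R \<le> (a e + \<theta> * (1 - a e)) * ((1 - \<theta>) * Q + \<theta>)"
      using that(2) by (rule mult_left_mono[rotated])
    also have "\<dots> = (1 - \<theta>) * (a e * Q) + \<theta> - \<theta> * (1 - \<theta>) * ((1 - a e) * (1 - Q))"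
      by (simp add: algebra_simps)
    finally show ?thesis .
  qed
  have le: "(\<Prod>e\<in>B. a e + \<theta> * (1 - a e)) \<le> (1 - \<theta>) * (\<Prod>e\<in>B. a e) + \<theta>" if "B \<subseteq> A" for B
  proof -
    have "finite B" using that assms(1) finite_subset by blast
    then show ?thesis using that
    proof (induction B rule: finite_induct)
      case (insert e B)
      have "(\<Prod>e\<in>B. a e) \<le> 1" using insert.prems assms(2) by (intro prod_le_1) force
      then have "0 \<le> \<theta> * (1 - \<theta>) * ((1 - a e) * (1 - (\<Prod>e\<in>B. a e)))"
        using insert.prems assms(2)[of e] assms(3,4) by (intro mult_nonneg_nonneg) auto
      then show ?case using step[of e _ "\<Prod>e\<in>B. a e"] insert by fastforce
    qed simp
  qed
  then show "(\<Prod>e\<in>A. a e + \<theta> * (1 - a e)) \<le> (1 - \<theta>) * (\<Prod>e\<in>A. a e) + \<theta>" by simp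
  assume "card A \<ge> 2"
  then obtain e where "e \<in> A" by fastforce
  define B where "B = A - {e}"
  have A: "A = insert e B" "e \<notin> B" "finite B" using \<open>e \<in> A\<close> assms(1) by (auto simp: B_def)
  have "card B \<ge> 1" using \<open>card A \<ge> 2\<close> \<open>e \<in> A\<close> by (simp add: B_def)
  then obtain d where d: "d \<in> B" by fastforce
  have "(\<Prod>e\<in>B. a e) = a d * (\<Prod>e\<in>B - {d}. a e)" using d A by (simp add: prod.remove)
  also have "\<dots> \<le> a d * 1"
    using d A assms(2) by (intro mult_left_mono prod_le_1) force+
  finally have "(\<Prod>e\<in>B. a e) < 1" using assms(2)[of d] d A by auto
  then have "0 < \<theta> * (1 - \<theta>) * ((1 - a e) * (1 - (\<Prod>e\<in>B. a e)))"
    using assms(2)[of e] assms(3,4) A by (intro mult_pos_pos) auto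
  moreover have "(a e + \<theta> * (1 - a e)) * (\<Prod>e\<in>B. a e + \<theta> * (1 - a e)) \<le>
      (1 - \<theta>) * (a e * (\<Prod>e\<in>B. a e)) + \<theta> - \<theta> * (1 - \<theta>) * ((1 - a e) * (1 - (\<Prod>e\<in>B. a e)))"
    using A by (intro step le) auto
  ultimately have "(a e + \<theta> * (1 - a e)) * (\<Prod>e\<in>B. a e + \<theta> * (1 - a e)) <
      (1 - \<theta>) * (a e * (\<Prod>e\<in>B. a e)) + \<theta>" by linarith
  then show "(\<Prod>e\<in>A. a e + \<theta> * (1 - a e)) < (1 - \<theta>) * (\<Prod>e\<in>A. a e) + \<theta>"
    using A by simp
qed

context random_recursive
begin

text \<open>The offspring generating function of the multitype Galton-Watson process whose types are
  the vertices; its argument assigns a value to each type.\<close>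

definition gen :: "('v \<Rightarrow> real) \<Rightarrow> 'v \<Rightarrow> real" where
  "gen a v = (\<Sum>i\<in>\<Lambda>. \<pi> i * (\<Prod>e\<in>out_arcs (G i) v. a (tgt e)))"

lemma ex_two_arcs:
  assumes "v \<in> V" shows "\<exists>i\<in>\<Lambda>. card (out_arcs (G i) v) \<ge> 2"
proof (rule ccontr)
  assume "\<not> ?thesis"
  then have "card (out_arcs (G i) v) \<le> 1" if "i \<in> \<Lambda>" for i using that by force
  then have "(\<Sum>i\<in>\<Lambda>. \<pi> i * real (card (out_arcs (G i) v))) \<le> (\<Sum>i\<in>\<Lambda>. \<pi> i * 1)"
    using prob_pos by (intro sum_mono mult_left_mono) (auto intro: less_imp_le)
  then show False using offspring[OF assms] by (simp add: prob_sum)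
qed

lemma out_arcs_tgt: "i \<in> \<Lambda> \<Longrightarrow> e \<in> out_arcs (G i) v \<Longrightarrow> tgt e \<in> V"
  using out_arcs_E tgt_V by blast

text \<open>
  At a vertex where \<open>(g v - e v) / (1 - e v)\<close> is maximal, a positive maximum would contradict the
  strict convexity of \<open>gen\<close> along the segment from \<open>e\<close> to \<open>1\<close>.
\<close>

lemma gen_unique:
  assumes eg: "\<And>v. v \<in> V \<Longrightarrow> 0 \<le> e v \<and> e v \<le> g v \<and> g v < 1"
    and g: "\<And>v. v \<in> V \<Longrightarrow> g v \<le> gen g v" and e: "\<And>v. v \<in> V \<Longrightarrow> e v = gen e v"
    and v: "v \<in> V"
  shows "g v = e v"
proof (rule ccontr)
  assume "g v \<noteq> e v"
  let ?q = "\<lambda>v. (g v - e v) / (1 - e v)"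
  define \<theta> where "\<theta> = Max (?q ` V)"
  have "0 < ?q v" using eg[OF v] \<open>g v \<noteq> e v\<close> by auto
  moreover have le: "?q j \<le> \<theta>" if "j \<in> V" for j using finite_V that by (auto simp: \<theta>_def)
  ultimately have \<theta>0: "0 < \<theta>" using v by force
  have "\<theta> \<in> ?q ` V" unfolding \<theta>_def using finite_V V_ne by (intro Max_in) auto
  then obtain k where k: "k \<in> V" "\<theta> = ?q k" by blast
  have \<theta>1: "\<theta> < 1" using eg[OF k(1)] by (simp add: k(2))
  have gk: "g k = e k + \<theta> * (1 - e k)" using eg[OF k(1)] by (simp add: k(2))
  have gj: "g j \<le> e j + \<theta> * (1 - e j)" if "j \<in> V" for j
    using le[OF that] eg[OF that] by (simp add: pos_divide_le_eq)
  have e01: "0 \<le> e (tgt d) \<and> e (tgt d) < 1" if "i \<in> \<Lambda>" "d \<in> out_arcs (G i) k" for i d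
    using eg[OF out_arcs_tgt[OF that]] by auto
  let ?h = "\<lambda>i. \<Prod>d\<in>out_arcs (G i) k. e (tgt d) + \<theta> * (1 - e (tgt d))"
  let ?e = "\<lambda>i. \<Prod>d\<in>out_arcs (G i) k. e (tgt d)"
  have "g k \<le> gen g k" by (rule g[OF k(1)])
  also have "\<dots> \<le> (\<Sum>i\<in>\<Lambda>. \<pi> i * ?h i)"
    unfolding gen_def using gj eg out_arcs_tgt prob_pos
    by (intro sum_mono mult_left_mono prod_mono) (meson less_imp_le order_trans)+
  \<comment> \<open>Strictness comes from a label with at least two edges at k; the weak inequality
    holds for every label.\<close>
  also have "\<dots> < (\<Sum>i\<in>\<Lambda>. \<pi> i * ((1 - \<theta>) * ?e i + \<theta>))"
  proof (rule sum_strict_mono_ex1[OF fin_\<Lambda>])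
    show "\<forall>i\<in>\<Lambda>. \<pi> i * ?h i \<le> \<pi> i * ((1 - \<theta>) * ?e i + \<theta>)"
    proof
      fix i assume i: "i \<in> \<Lambda>"
      have "?h i \<le> (1 - \<theta>) * ?e i + \<theta>"
        by (rule prod_interp_le(1)[OF finite_out[OF i] e01[OF i] \<theta>0 \<theta>1])
      then show "\<pi> i * ?h i \<le> \<pi> i * ((1 - \<theta>) * ?e i + \<theta>)"
        using prob_pos[OF i] by (intro mult_left_mono) auto
    qed
    obtain i where i: "i \<in> \<Lambda>" "card (out_arcs (G i) k) \<ge> 2" using ex_two_arcs[OF k(1)] by blast
    have "?h i < (1 - \<theta>) * ?e i + \<theta>"
      by (rule prod_interp_le(2)[OF finite_out[OF i(1)] e01[OF i(1)] \<theta>0 \<theta>1 i(2)])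
    then show "\<exists>i\<in>\<Lambda>. \<pi> i * ?h i < \<pi> i * ((1 - \<theta>) * ?e i + \<theta>)"
      using prob_pos[OF i(1)] i(1) by (intro bexI[of _ i]) auto
  qed
  also have "\<dots> = (1 - \<theta>) * gen e k + \<theta> * (\<Sum>i\<in>\<Lambda>. \<pi> i)"
    by (simp add: gen_def sum_distrib_left sum.distrib[symmetric] algebra_simps)
  also have "\<dots> = g k" by (simp add: prob_sum e[OF k(1), symmetric] gk algebra_simps)
  finally show False by simp
qed

end

section \<open>The zero-one law\<close>

lemma prod_indicator_eq:
  "finite A \<Longrightarrow> (\<Prod>e\<in>A. indicator (H e) (y e) :: real) = (if \<forall>e\<in>A. y e \<in> H e then 1 else 0)"
  by (induction A rule: finite_induct) (auto simp: indicator_def)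

context random_recursive
begin

definition Ext :: "'v \<Rightarrow> ('e list \<Rightarrow> 'i) set" where
  "Ext v = {x \<in> X0. \<exists>n. \<forall>w\<in>W. length w = n \<longrightarrow> \<not> T x v w}"

text \<open>The trees in which no node, the root included, carries a subtree in C. The zero-one law
  compares this event with extinction.\<close>

definition avoid :: "('v \<Rightarrow> ('e list \<Rightarrow> 'i) set) \<Rightarrow> 'v \<Rightarrow> ('e list \<Rightarrow> 'i) set" where
  "avoid C v = {x \<in> X0. \<forall>w\<in>W. T x v w \<longrightarrow> sh w x \<notin> C (endv v w)}"

lemma sets_T:
  assumes "w \<in> W" shows "{x \<in> X0. T x v w} \<in> sets Om"
proof -
  have "(\<lambda>x. T x v w) \<in> Om \<rightarrow>\<^sub>M count_space UNIV"
    by (rule measurable_depends[OF depends_T[OF assms]]) simp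
  then show ?thesis unfolding space_Om[symmetric] by measurable
qed

lemma sets_sh:
  assumes "w \<in> W" "H \<in> sets Om" shows "{x \<in> X0. sh w x \<in> H} \<in> sets Om"
proof -
  have "{x \<in> X0. sh w x \<in> H} = sh w -` H \<inter> space Om" by (auto simp: space_Om)
  then show ?thesis using measurable_sets[OF measurable_sh[OF assms(1)] assms(2)] by simp
qed

lemma X0_sets: "X0 \<in> sets Om"
  using sets.top[of Om] by (simp add: space_Om)

lemma sets_Ext: "Ext v \<in> sets Om"
proof -
  have "Ext v = (\<Union>n. X0 - (\<Union>w\<in>{w \<in> W. length w = n}. {x \<in> X0. T x v w}))"
    by (auto simp: Ext_def)
  moreover have "(\<Union>w\<in>{w \<in> W. length w = n}. {x \<in> X0. T x v w}) \<in> sets Om" for n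
    by (intro sets.countable_UN') (auto intro!: sets_T countable_subset[OF _ countable_W])
  then have "(\<Union>n. X0 - (\<Union>w\<in>{w \<in> W. length w = n}. {x \<in> X0. T x v w})) \<in> sets Om"
    using X0_sets by (intro sets.countable_UN image_subsetI sets.Diff)
  ultimately show ?thesis by simp
qed

lemma sets_avoid:
  assumes C: "\<And>j. j \<in> V \<Longrightarrow> C j \<in> sets Om" and v: "v \<in> V"
  shows "avoid C v \<in> sets Om"
proof -
  have "avoid C v = X0 - (\<Union>w\<in>W. {x \<in> X0. T x v w} \<inter> {x \<in> X0. sh w x \<in> C (endv v w)})"
    by (auto simp: avoid_def)
  moreover have "(\<Union>w\<in>W. {x \<in> X0. T x v w} \<inter> {x \<in> X0. sh w x \<in> C (endv v w)}) \<in> sets Om"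
    by (intro sets.countable_UN' countable_W image_subsetI sets.Int sets_T sets_sh C endv_V v)
  ultimately show ?thesis using X0_sets by (simp add: sets.Diff)
qed

text \<open>Given the root label, the subtrees at the children are independent copies with roots
  \<open>tgt e\<close>; averaging over the root label produces \<open>gen\<close>.\<close>

lemma measure_children:
  assumes H: "\<And>j. j \<in> V \<Longrightarrow> H j \<in> sets Om"
  shows "{x \<in> X0. \<forall>e\<in>out_arcs (G (x [])) v. sh [e] x \<in> H (tgt e)} \<in> sets Om" (is "?A \<in> _")
    and "measure Om {x \<in> X0. \<forall>e\<in>out_arcs (G (x [])) v. sh [e] x \<in> H (tgt e)} = gen (\<lambda>j. measure Om (H j)) v"
proof -
  let ?B = "\<lambda>x. (\<lambda>e. [e]) ` out_arcs (G (x [])) v" and ?L = "(\<lambda>e. [e]) ` E"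
  let ?g = "\<lambda>w x. indicator (H (endv v w)) x :: real"
  have dep: "depends {[]} ?B" unfolding depends_def by simp
  have line: "stop_line {[]} ?L" unfolding stop_line_def using finite_E by auto
  have B: "?B x \<subseteq> ?L" if "x \<in> X0" for x using out_arcs_E[OF X0_D[OF that W_simps(1)]] by blast
  have L: "finite ?L" "?L \<subseteq> W" using finite_E by auto
  have g: "?g w \<in> borel_measurable Om" if "w \<in> ?L" for w
    using that H[of "endv v w"] tgt_V by auto
  have ind: "(\<Prod>w\<in>?B x. ?g w (sh w x)) = indicator ?A x" if "x \<in> X0" for x
  proof -
    have fin: "finite (out_arcs (G (x [])) v)" using finite_out[OF X0_D[OF that W_simps(1)]] .
    have "(\<Prod>w\<in>?B x. ?g w (sh w x)) = (\<Prod>e\<in>out_arcs (G (x [])) v. indicator (H (tgt e)) (sh [e] x))"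
      by (subst prod.reindex) (auto simp: inj_on_def)
    also have "\<dots> = (if \<forall>e\<in>out_arcs (G (x [])) v. sh [e] x \<in> H (tgt e) then 1 else 0)"
      by (rule prod_indicator_eq[OF fin])
    also have "\<dots> = indicator ?A x" using that by (simp add: indicator_def)
    finally show ?thesis .
  qed
  have "(\<lambda>x. \<Prod>w\<in>?B x. ?g w (sh w x)) \<in> borel_measurable Om"
    by (rule branch_measurable[where B = ?B and g = ?g, OF dep L]) (rule B g, assumption)+
  also have "?this \<longleftrightarrow> (indicator ?A :: _ \<Rightarrow> real) \<in> borel_measurable Om"
    by (rule measurable_cong) (simp add: ind space_Om)
  finally have "(indicator ?A :: _ \<Rightarrow> real) \<in> borel_measurable Om" .
  then have "?A \<inter> space Om \<in> sets Om" by (simp only: borel_measurable_indicator_iff)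
  moreover have "?A \<inter> space Om = ?A" by (auto simp: space_Om)
  ultimately show A: "?A \<in> sets Om" by simp
  let ?F = "\<lambda>i. \<Prod>e\<in>out_arcs (G i) v. measure Om (H (tgt e))"
  have lab: "integrable Om (\<lambda>x. if x [] = i then 1 else 0 :: real)" for i
  proof (rule integrable_unit_fun)
    have "depends {[]} (\<lambda>x. if x [] = i then 1 else 0 :: real)" unfolding depends_def by simp
    then show "unit_fun (\<lambda>x. if x [] = i then 1 else 0)"
      unfolding unit_fun_def by (auto intro: measurable_depends)
  qed
  have "measure Om ?A = (\<integral>x. indicator ?A x \<partial>Om)" using A by (simp add: Int_absorb1 sets.sets_into_space)
  also have "\<dots> = (\<integral>x. (\<Prod>w\<in>?B x. ?g w (sh w x)) \<partial>Om)"
    by (rule Bochner_Integration.integral_cong) (simp_all add: ind space_Om)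
  also have "\<dots> = (\<integral>x. (\<Prod>w\<in>?B x. \<integral>y. ?g w y \<partial>Om) \<partial>Om)"
    by (rule branch_integral[where B = ?B and g = ?g, OF dep line]) ((rule B g, assumption) | simp)+
  also have "\<dots> = (\<integral>x. (\<Sum>i\<in>\<Lambda>. (if x [] = i then 1 else 0) * ?F i) \<partial>Om)"
  proof (rule Bochner_Integration.integral_cong[OF refl])
    fix x assume "x \<in> space Om"
    then have x: "x [] \<in> \<Lambda>" using X0_D[of x "[]"] by (simp add: space_Om)
    have "(\<Prod>w\<in>?B x. \<integral>y. ?g w y \<partial>Om) = (\<Prod>e\<in>out_arcs (G (x [])) v. \<integral>y. ?g [e] y \<partial>Om)"
      by (subst prod.reindex) (auto simp: inj_on_def)
    also have "\<dots> = ?F (x [])"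
      using H[OF out_arcs_tgt[OF x]] by (intro prod.cong) (auto simp: Int_absorb2 sets.sets_into_space)
    also have "\<dots> = (\<Sum>i\<in>\<Lambda>. if x [] = i then ?F i else 0)"
      using x fin_\<Lambda> by (subst sum.delta') auto
    also have "\<dots> = (\<Sum>i\<in>\<Lambda>. (if x [] = i then 1 else 0) * ?F i)" by (intro sum.cong) auto
    finally show "(\<Prod>w\<in>?B x. \<integral>y. ?g w y \<partial>Om) = (\<Sum>i\<in>\<Lambda>. (if x [] = i then 1 else 0) * ?F i)" .
  qed
  also have "\<dots> = (\<Sum>i\<in>\<Lambda>. (\<integral>x. (if x [] = i then 1 else 0) * ?F i \<partial>Om))"
    by (rule Bochner_Integration.integral_sum) (intro integrable_mult_left lab)
  also have "\<dots> = gen (\<lambda>j. measure Om (H j)) v"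
    unfolding gen_def by (intro sum.cong refl) (simp add: integral_label)
  finally show "measure Om ?A = gen (\<lambda>j. measure Om (H j)) v" .
qed

lemma Ext_T:
  assumes "x \<in> Ext v" "w \<in> W" "T x v w" shows "sh w x \<in> Ext (endv v w)"
proof -
  obtain n where x: "x \<in> X0" and n: "\<And>w. w \<in> W \<Longrightarrow> length w = n \<Longrightarrow> \<not> T x v w"
    using assms(1) by (auto simp: Ext_def)
  have "\<not> T (sh w x) (endv v w) u" if u: "u \<in> W" "length u = n" for u
  proof
    assume "T (sh w x) (endv v w) u"
    then have "T x v (w @ u)" using assms u by (simp add: T_append)
    then have "T x v (take n (w @ u))" by (rule T_prefix)
    moreover have "take n (w @ u) \<in> W" using assms u by (intro take_W) simp
    ultimately show False using n u by simp
  qed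
  then show ?thesis using sh_X0[OF x assms(2)] by (auto simp: Ext_def)
qed

lemma Ext_children: "Ext v = {x \<in> X0. \<forall>e\<in>out_arcs (G (x [])) v. sh [e] x \<in> Ext (tgt e)}"
proof (intro equalityI subsetI)
  fix x assume x: "x \<in> Ext v"
  then have x0: "x \<in> X0" by (simp add: Ext_def)
  have "sh [e] x \<in> Ext (tgt e)" if e: "e \<in> out_arcs (G (x [])) v" for e
  proof -
    have "e \<in> E" using out_arcs_E[OF X0_D[OF x0 W_simps(1)]] e by blast
    then have "[e] \<in> W" by simp
    moreover have "T x v [e]" using T_snoc[of x v "[]" e] e by simp
    ultimately show ?thesis using Ext_T[OF x] by force
  qed
  then show "x \<in> {x \<in> X0. \<forall>e\<in>out_arcs (G (x [])) v. sh [e] x \<in> Ext (tgt e)}" using x0 by blast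
next
  fix x assume x: "x \<in> {x \<in> X0. \<forall>e\<in>out_arcs (G (x [])) v. sh [e] x \<in> Ext (tgt e)}"
  then have x0: "x \<in> X0" by blast
  note fin = finite_out[OF X0_D[OF x0 W_simps(1)], of v]
  have "\<forall>e\<in>out_arcs (G (x [])) v. \<exists>n. \<forall>w\<in>W. length w = n \<longrightarrow> \<not> T (sh [e] x) (tgt e) w"
    using x by (auto simp: Ext_def)
  then obtain n where n: "\<And>e w. e \<in> out_arcs (G (x [])) v \<Longrightarrow> w \<in> W \<Longrightarrow> length w = n e \<Longrightarrow> \<not> T (sh [e] x) (tgt e) w"
    by metis
  \<comment> \<open>Finitely many children die out at finitely many levels, so a common level
    exists; the entry 0 covers a root without children.\<close>
  define N where "N = Max (insert 0 (n ` out_arcs (G (x [])) v))"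
  have nN: "n e \<le> N" if "e \<in> out_arcs (G (x [])) v" for e
    unfolding N_def using fin that by (intro Max_ge) auto
  have "\<not> T x v w" if w: "w \<in> W" "length w = Suc N" for w
  proof
    assume T: "T x v w"
    obtain e u where eu: "w = e # u" "length u = N" using w(2) by (cases w) auto
    have "e \<in> E" "u \<in> W" using w eu by auto
    then have e: "e \<in> out_arcs (G (x [])) v" "T (sh [e] x) (tgt e) u"
      using T T_Cons[of e u x v] eu by auto
    have "T (sh [e] x) (tgt e) (take (n e) u)" using e(2) by (rule T_prefix)
    moreover have "length (take (n e) u) = n e" using nN[OF e(1)] eu by simp
    ultimately show False using n[OF e(1) take_W[OF \<open>u \<in> W\<close>]] by blast
  qed
  then show "x \<in> Ext v" using x0 by (auto simp: Ext_def)
qed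

text \<open>An inclusion only, since the right-hand side does not exclude that x itself lies in C v.
  Accordingly \<open>gen_unique\<close> asks only for an inequality on g.\<close>

lemma avoid_children: "avoid C v \<subseteq> {x \<in> X0. \<forall>e\<in>out_arcs (G (x [])) v. sh [e] x \<in> avoid C (tgt e)}"
proof
  fix x assume x: "x \<in> avoid C v"
  then have x0: "x \<in> X0" by (simp add: avoid_def)
  have "sh [e] x \<in> avoid C (tgt e)" if e: "e \<in> out_arcs (G (x [])) v" for e
  proof -
    have eE: "e \<in> E" using out_arcs_E[OF X0_D[OF x0 W_simps(1)]] e by blast
    have "sh u (sh [e] x) \<notin> C (endv (tgt e) u)" if u: "u \<in> W" "T (sh [e] x) (tgt e) u" for u
    proof -
      have "T x v (e # u)" using T_Cons[OF eE u(1), of x v] e u(2) by blast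
      moreover have "e # u \<in> W" using eE u(1) by simp
      ultimately have "sh (e # u) x \<notin> C (endv v (e # u))" using x unfolding avoid_def by blast
      then show ?thesis using sh_sh[of "[e]" u x] eE u(1) by simp
    qed
    then show ?thesis using sh_X0[OF x0, of "[e]"] eE unfolding avoid_def by simp
  qed
  then show "x \<in> {x \<in> X0. \<forall>e\<in>out_arcs (G (x [])) v. sh [e] x \<in> avoid C (tgt e)}" using x0 by blast
qed

text \<open>Extinction satisfies the fixed point equation of \<open>gen\<close>, avoidance of C the
  corresponding inequality, and both probabilities are below 1 because C has positive probability at
  every vertex. By \<open>gen_unique\<close> they agree, so avoidance without extinction is a null
  event.\<close>

lemma zero_one:
  assumes C: "\<And>j. j \<in> V \<Longrightarrow> C j \<in> sets Om" "\<And>j. j \<in> V \<Longrightarrow> 0 < measure Om (C j)"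
    "\<And>j. j \<in> V \<Longrightarrow> C j \<inter> Ext j = {}" and v: "v \<in> V"
  shows "AE x in Om. x \<in> Ext v \<or> (\<exists>w\<in>W. T x v w \<and> sh w x \<in> C (endv v w))"
proof -
  note av = sets_avoid[OF C(1)]
  have sub: "Ext j \<subseteq> avoid C j" if j: "j \<in> V" for j
    using Ext_T C(3)[OF endv_V[OF _ j]] unfolding avoid_def Ext_def by blast
  have eq: "measure Om (avoid C v) = measure Om (Ext v)"
  proof (rule gen_unique[OF _ _ _ v])
    fix j assume j: "j \<in> V"
    have "avoid C j \<subseteq> space Om - C j"
    proof
      fix x assume x: "x \<in> avoid C j"
      then have "x \<in> X0" "sh [] x \<notin> C (endv j [])" using W_simps(1) T_Nil unfolding avoid_def by blast+
      then show "x \<in> space Om - C j" by (simp add: sh_Nil space_Om)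
    qed
    then have "measure Om (avoid C j) \<le> measure Om (space Om - C j)"
      using C(1)[OF j] by (intro Om.finite_measure_mono) auto
    also have "\<dots> = 1 - measure Om (C j)" by (rule Om.prob_compl[OF C(1)[OF j]])
    finally show "0 \<le> measure Om (Ext j) \<and> measure Om (Ext j) \<le> measure Om (avoid C j) \<and> measure Om (avoid C j) < 1"
      using C(2)[OF j] Om.finite_measure_mono[OF sub[OF j] av[OF _ j]] by auto
    show "measure Om (Ext j) = gen (\<lambda>j. measure Om (Ext j)) j"
      by (subst Ext_children) (rule measure_children(2)[OF sets_Ext])
    have "measure Om (avoid C j) \<le> measure Om {x \<in> X0. \<forall>e\<in>out_arcs (G (x [])) j. sh [e] x \<in> avoid C (tgt e)}"
      by (rule Om.finite_measure_mono[OF avoid_children measure_children(1)[OF av]])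
    also have "\<dots> = gen (\<lambda>j. measure Om (avoid C j)) j"
      by (rule measure_children(2)[OF av])
    finally show "measure Om (avoid C j) \<le> gen (\<lambda>j. measure Om (avoid C j)) j" .
  qed
  have "measure Om (avoid C v - Ext v) = 0"
    using eq Om.finite_measure_Diff[OF av[OF _ v] sets_Ext sub[OF v]] by simp
  then have "avoid C v - Ext v \<in> null_sets Om"
    using av[OF _ v] sets_Ext[of v] by (intro null_setsI) (auto simp: Om.emeasure_eq_measure)
  then have "AE x in Om. x \<notin> avoid C v - Ext v" by (rule AE_not_in)
  then show ?thesis
  proof (rule AE_mp, intro AE_I2 impI)
    fix x assume "x \<in> space Om" "x \<notin> avoid C v - Ext v"
    then show "x \<in> Ext v \<or> (\<exists>w\<in>W. T x v w \<and> sh w x \<in> C (endv v w))"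
      unfolding avoid_def space_Om by blast
  qed
qed

lemma Ext_attractor:
  assumes "x \<in> Ext v" shows "attractor G S \<Delta> x v = {}"
proof -
  obtain n where x: "x \<in> X0" and n: "\<And>w. w \<in> W \<Longrightarrow> length w = n \<Longrightarrow> \<not> T x v w"
    using assms by (auto simp: Ext_def)
  have xs: "\<forall>u\<in>W. x u \<in> \<Lambda>" using x X0_D by blast
  \<comment> \<open>The empty word is always present, so n is one of the levels over which the
    attractor intersects.\<close>
  have "n \<noteq> 0" using n[of "[]"] by auto
  then have "n \<in> {1..}" by simp
  moreover have "{w. T x v w \<and> length w = n} = {}" using n T_W[OF xs] by blast
  then have "(\<Union>w\<in>{w. T x v w \<and> length w = n}. word_map S w ` \<Delta>) = {}" by (simp only: UN_empty)
  ultimately show ?thesis unfolding attractor_eq[OF xs] by blast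
qed

lemma bounded_attractor:
  assumes "x \<in> X0" shows "bounded (attractor G S \<Delta> x v)"
proof (rule bounded_subset[OF bounded_\<Delta>])
  have xs: "\<forall>u\<in>W. x u \<in> \<Lambda>" using assms X0_D by blast
  show "attractor G S \<Delta> x v \<subseteq> \<Delta>"
  proof
    fix y assume "y \<in> attractor G S \<Delta> x v"
    then have "y \<in> (\<Union>w\<in>{w. T x v w \<and> length w = 1}. word_map S w ` \<Delta>)"
      unfolding attractor_eq[OF xs] by (rule INT_D) simp
    then show "y \<in> \<Delta>" using T_W[OF xs] word_map_\<Delta> by blast
  qed
qed

section \<open>Choice of the constants and the dichotomy of the dimensions\<close>

lemma AE_hausdorff_dim_ge:
  assumes t: "0 < t1" "t1 < t" and v: "v \<in> V"
    and large: "\<And>\<rho>0. \<rho>0 > 0 \<Longrightarrow> \<exists>v0\<in>V. \<exists>\<rho>>0. \<rho> < \<rho>0 \<and> \<rho> powr (- t) < mean_sel \<rho> v0"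
  shows "AE x in Om. attractor G S \<Delta> x v = {} \<or> ereal t1 \<le> hausdorff_dim (attractor G S \<Delta> x v)"
proof -
  have "\<forall>v0\<in>V. \<exists>es. \<forall>j\<in>V. es j \<in> W \<and> endv j (es j) = v0 \<and> hits j (es j) > 0"
    using ex_return_paths by blast
  from bchoice[OF this] obtain es where path: "\<And>v0 j. v0 \<in> V \<Longrightarrow> j \<in> V \<Longrightarrow>
      es v0 j \<in> W \<and> endv j (es v0 j) = v0 \<and> hits j (es v0 j) > 0" by blast
  \<comment> \<open>The constants are minima over all possible v0, because \<rho>0 has to be fixed
    before \<open>large\<close> supplies v0 and \<rho>.\<close>
  define \<kappa> where "\<kappa> = Min ((\<lambda>(v0, j). hits j (es v0 j)) ` (V \<times> V))"
  have \<kappa>: "\<kappa> > 0" unfolding \<kappa>_def using finite_V V_ne path by (subst Min_gr_iff) auto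
  have \<kappa>_le: "\<kappa> \<le> hits j (es v0 j)" if "v0 \<in> V" "j \<in> V" for v0 j
    unfolding \<kappa>_def using finite_V that by (intro Min_le) auto
  define cs where "cs = Min ((\<lambda>(e, v0, j). c e * cw (es v0 j)) ` (E \<times> V \<times> V))"
  have cs: "cs > 0" unfolding cs_def using finite_V finite_E E_ne V_ne path c_E cw_pos by (subst Min_gr_iff) auto
  have cs_le: "cs \<le> c e * cw (es v0 j)" if "v0 \<in> V" "j \<in> V" "e \<in> E" for v0 j e
    unfolding cs_def using finite_V finite_E that by (intro Min_le) (auto intro!: image_eqI[of _ _ "(e, v0, j)"])
  have cs1: "cs \<le> 1"
  proof -
    obtain e where e: "e \<in> E" using E_ne by blast
    have "cs \<le> c e * cw (es v v)" by (rule cs_le[OF v v e])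
    also have "\<dots> \<le> 1" using c_E[OF e] cw_le_1 cw_pos path[OF v v] by (intro mult_le_one) (auto intro: less_imp_le)
    finally show ?thesis .
  qed
  \<comment> \<open>With p = (\<rho> cs) powr t1, the product p \<kappa> \<rho> powr (-t) equals m0
    \<rho> powr (t1 - t), and below \<rho>0 this is at least 1.\<close>
  define m0 where "m0 = \<kappa> * cs powr t1"
  have m0: "m0 > 0" using \<kappa> cs by (simp add: m0_def)
  define \<rho>0 where "\<rho>0 = min 1 (m0 powr (1 / (t - t1)))"
  have "\<rho>0 > 0" using m0 by (simp add: \<rho>0_def)
  then obtain v0 \<rho> where v0: "v0 \<in> V" and \<rho>: "\<rho> > 0" "\<rho> < \<rho>0" "\<rho> powr (- t) < mean_sel \<rho> v0"
    using large by blast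
  have \<rho>1: "\<rho> < 1" using \<rho>(2) by (simp add: \<rho>0_def)
  define p where "p = (\<rho> * cs) powr t1"
  have p0: "p > 0" using \<rho> cs by (simp add: p_def)
  have "\<rho> * cs \<le> 1" using \<rho> \<rho>1 cs cs1 by (intro mult_le_one) auto
  then have p1: "p \<le> 1" unfolding p_def using \<rho> cs t by (intro powr_le1) auto
  have "\<rho> powr (t - t1) \<le> (m0 powr (1 / (t - t1))) powr (t - t1)"
    using \<rho> t by (intro powr_mono2) (auto simp: \<rho>0_def)
  also have "\<dots> = m0" using m0 t by (simp add: powr_powr)
  finally have "\<rho> powr (t - t1) \<le> m0" .
  then have "1 \<le> m0 * \<rho> powr (t1 - t)"
    using \<rho> by (simp add: powr_diff field_simps)
  also have "\<dots> = p * \<kappa> * \<rho> powr (- t)"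
    using \<rho> cs by (simp add: p_def m0_def powr_mult powr_diff powr_minus divide_inverse)
  also have "\<dots> < p * \<kappa> * mean_sel \<rho> v0" using \<rho>(3) p0 \<kappa> by (intro mult_strict_left_mono) auto
  finally have m1: "1 < p * \<kappa> * mean_sel \<rho> v0" .
  let ?L = "real (card (line \<rho>))"
  \<comment> \<open>q is so small that the term L p \<kappa> q of \<open>supercritical\<close> fits
    into the excess of p \<kappa> times the mean over 1; the added 1 keeps the denominator
    positive.\<close>
  define q where "q = min 1 ((p * \<kappa> * mean_sel \<rho> v0 - 1) / (?L * (p * \<kappa>) + 1))"
  have Lpos: "?L * (p * \<kappa>) + 1 > 0" using p0 \<kappa> by (intro add_nonneg_pos mult_nonneg_nonneg) auto
  have q: "0 < q" "q \<le> 1" using m1 Lpos by (auto simp: q_def)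
  have "q * (?L * (p * \<kappa>) + 1) \<le> p * \<kappa> * mean_sel \<rho> v0 - 1"
    using Lpos by (simp add: pos_le_divide_eq[symmetric] q_def)
  then have sup: "1 + ?L * (p * \<kappa> * q) \<le> p * \<kappa> * mean_sel \<rho> v0"
    using q by (simp add: algebra_simps)
  interpret separated_branching \<Lambda> V G \<pi> c S \<Delta> v0 "es v0" \<rho> p \<kappa> q
    by unfold_locales (use v0 path \<kappa>_le \<kappa> \<rho> \<rho>1 p0 p1 q sup in auto)
  have dim: "ereal t1 \<le> hausdorff_dim (attractor G S \<Delta> x j)"
    if "x \<in> X0" "w \<in> W" "T x j w" "endv j w = v0" "sh w x \<in> A" for x j w
    using dim_ge[OF t(1) cs cs1 cs_le[OF v0] p_def that] by blast
  \<comment> \<open>Following the path from j to v0 first carries the positive probability of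
    \<open>A\<close> over to every vertex j.\<close>
  define C where "C = (\<lambda>j. {x \<in> X0. T x j (es v0 j)} \<inter> {x \<in> X0. sh (es v0 j) x \<in> A})"
  have C_sets: "C j \<in> sets Om" if "j \<in> V" for j
    unfolding C_def using path[OF v0 that] by (intro sets.Int sets_T sets_sh A_sets) auto
  have AE1: "AE x in Om. x \<in> Ext v \<or> (\<exists>w\<in>W. T x v w \<and> sh w x \<in> C (endv v w))"
  proof (rule zero_one[OF C_sets _ _ v])
    fix j assume j: "j \<in> V"
    note e = path[OF v0 j]
    have u: "unit_fun (indicator A)" using A_sets by (auto simp: unit_fun_def indicator_def)
    have "measure Om (C j) = (\<integral>x. indicator (C j) x \<partial>Om)"
      using C_sets[OF j] by (simp add: Int_absorb2 sets.sets_into_space)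
    also have "\<dots> = (\<integral>x. (if T x j (es v0 j) then indicator A (sh (es v0 j) x) else 0) \<partial>Om)"
      by (rule Bochner_Integration.integral_cong) (auto simp: C_def indicator_def space_Om)
    also have "\<dots> = hits j (es v0 j) * (\<integral>x. indicator A x \<partial>Om)"
      using e by (intro integral_path(1)[OF _ u]) auto
    also have "(\<integral>x. indicator A x \<partial>Om) = measure Om A"
      using A_sets by (simp add: Int_absorb2 sets.sets_into_space)
    finally show "0 < measure Om (C j)" using measure_A q e by simp
    \<comment> \<open>A tree in C j has an attractor of positive dimension, whereas an extinct tree
      has the empty attractor, of dimension 0.\<close>
    show "C j \<inter> Ext j = {}"
    proof (intro equals0I)
      fix x assume x: "x \<in> C j \<inter> Ext j"
      then have "ereal t1 \<le> hausdorff_dim (attractor G S \<Delta> x j)"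
        using e by (intro dim[of x "es v0 j"]) (auto simp: C_def)
      moreover have "attractor G S \<Delta> x j = {}" using x by (intro Ext_attractor) auto
      ultimately show False using t by (simp add: hausdorff_dim_empty)
    qed
  qed
  show ?thesis
    using AE1
  proof (rule AE_mp, intro AE_I2 impI)
    fix x assume "x \<in> space Om" and x: "x \<in> Ext v \<or> (\<exists>w\<in>W. T x v w \<and> sh w x \<in> C (endv v w))"
    then have x0: "x \<in> X0" by (simp add: space_Om)
    from x show "attractor G S \<Delta> x v = {} \<or> ereal t1 \<le> hausdorff_dim (attractor G S \<Delta> x v)"
    proof
      assume "x \<in> Ext v"
      then show ?thesis using Ext_attractor by blast
    next
      assume "\<exists>w\<in>W. T x v w \<and> sh w x \<in> C (endv v w)"
      then obtain w where w: "w \<in> W" "T x v w" "sh w x \<in> C (endv v w)" by blast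
      let ?u = "es v0 (endv v w)"
      have u: "?u \<in> W" "endv (endv v w) ?u = v0" using path[OF v0 endv_V[OF w(1) v]] by auto
      have "T (sh w x) (endv v w) ?u" "sh ?u (sh w x) \<in> A" using w(3) by (auto simp: C_def)
      then have "T x v (w @ ?u)" "sh (w @ ?u) x \<in> A" using w u by (auto simp: T_append sh_sh)
      then show ?thesis using dim[OF x0, of "w @ ?u" v] w(1) u by simp
    qed
  qed
qed

text \<open>The case distinction concerns the deterministic numbers \<open>mean_sel\<close>, not the
  realisation, so one of the two almost sure bounds holds outright. Failure of the uniform bound
  supplies a favourable vertex at arbitrarily small scales, possibly a different one at
  each.\<close>

lemma AE_dichotomy:
  assumes t: "0 < t1" "t1 < t2" and v: "v \<in> V"
  shows "AE x in Om. attractor G S \<Delta> x v = {} \<or> ereal t1 \<le> hausdorff_dim (attractor G S \<Delta> x v) \<or>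
    upper_box_dim (attractor G S \<Delta> x v) \<le> ereal t2"
proof -
  define t where "t = (t1 + t2) / 2"
  have t': "t1 < t" "t < t2" "0 \<le> t" using t by (auto simp: t_def)
  show ?thesis
  proof (cases "\<exists>\<rho>0>0. \<forall>v0\<in>V. \<forall>\<rho>>0. \<rho> < \<rho>0 \<longrightarrow> mean_sel \<rho> v0 \<le> \<rho> powr (- t)")
    case True
    then obtain \<rho>0 where *: "\<rho>0 > 0" "\<And>\<rho>. \<rho> > 0 \<Longrightarrow> \<rho> < \<rho>0 \<Longrightarrow> mean_sel \<rho> v \<le> \<rho> powr (- t)"
      using v by blast
    have "AE x in Om. upper_box_dim (attractor G S \<Delta> x v) \<le> ereal t2"
      using *(1) by (rule AE_upper_box_dim_le[OF t'(3,2)]) (rule *(2))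
    then show ?thesis by (rule AE_mp) (intro AE_I2, blast)
  next
    case False
    have *: "\<exists>v0\<in>V. \<exists>\<rho>>0. \<rho> < \<rho>0 \<and> \<rho> powr (- t) < mean_sel \<rho> v0" if "\<rho>0 > 0" for \<rho>0
      using False that by (auto simp: not_le)
    have "AE x in Om. attractor G S \<Delta> x v = {} \<or> ereal t1 \<le> hausdorff_dim (attractor G S \<Delta> x v)"
      by (rule AE_hausdorff_dim_ge[OF t(1) t'(1) v]) (rule *)
    then show ?thesis by (rule AE_mp) (intro AE_I2, blast)
  qed
qed

lemma AE_dims_eq:
  assumes v: "v \<in> V"
  shows "AE x in Om. let F = attractor G S \<Delta> x v in
    hausdorff_dim F = upper_box_dim F \<and> hausdorff_dim F = packing_dim F \<and> has_box_dim F (packing_dim F)"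
proof -
  have "AE x in Om. \<forall>ab :: rat \<times> rat. 0 < fst ab \<and> fst ab < snd ab \<longrightarrow>
    attractor G S \<Delta> x v = {} \<or> ereal (of_rat (fst ab)) \<le> hausdorff_dim (attractor G S \<Delta> x v) \<or>
    upper_box_dim (attractor G S \<Delta> x v) \<le> ereal (of_rat (snd ab))"
    unfolding AE_all_countable
  proof
    fix ab :: "rat \<times> rat"
    show "AE x in Om. 0 < fst ab \<and> fst ab < snd ab \<longrightarrow>
      attractor G S \<Delta> x v = {} \<or> ereal (of_rat (fst ab)) \<le> hausdorff_dim (attractor G S \<Delta> x v) \<or>
      upper_box_dim (attractor G S \<Delta> x v) \<le> ereal (of_rat (snd ab))"
    proof (cases "0 < fst ab \<and> fst ab < snd ab")
      case True
      then have "0 < (of_rat (fst ab) :: real)" "(of_rat (fst ab) :: real) < of_rat (snd ab)"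
        by (auto simp: of_rat_less)
      from AE_dichotomy[OF this v] show ?thesis by (rule AE_mp) (intro AE_I2, blast)
    next
      case False
      then show ?thesis by (intro AE_I2) blast
    qed
  qed
  then show ?thesis
  proof (rule AE_mp, intro AE_I2 impI)
    fix x assume "x \<in> space Om"
      and D: "\<forall>ab :: rat \<times> rat. 0 < fst ab \<and> fst ab < snd ab \<longrightarrow>
        attractor G S \<Delta> x v = {} \<or> ereal (of_rat (fst ab)) \<le> hausdorff_dim (attractor G S \<Delta> x v) \<or>
        upper_box_dim (attractor G S \<Delta> x v) \<le> ereal (of_rat (snd ab))"
    then have x: "x \<in> X0" by (simp add: space_Om)
    define F where "F = attractor G S \<Delta> x v"
    have F: "bounded F" unfolding F_def by (rule bounded_attractor[OF x])
    have le: "upper_box_dim F \<le> hausdorff_dim F" if ne: "F \<noteq> {}"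
    proof (rule ccontr)
      assume "\<not> ?thesis"
      then have less: "hausdorff_dim F < upper_box_dim F" by simp
      obtain b :: rat where b: "hausdorff_dim F < ereal (of_rat b)" "ereal (of_rat b) < upper_box_dim F"
        using ereal_dense3[OF less] by blast
      obtain a :: rat where a: "hausdorff_dim F < ereal (of_rat a)" "ereal (of_rat a) < ereal (of_rat b)"
        using ereal_dense3[OF b(1)] by blast
      \<comment> \<open>The lower exponent in the dichotomy must be positive; \<open>a\<close> is,
        since it exceeds a dimension.\<close>
      have "0 \<le> hausdorff_dim F" unfolding hausdorff_dim_def by (rule INF_greatest) auto
      then have "0 < ereal (of_rat a)" using a(1) by (rule order_le_less_trans)
      then have "0 < a \<and> a < b" using a(2) by (simp add: of_rat_less)
      then have "F = {} \<or> ereal (of_rat a) \<le> hausdorff_dim F \<or> upper_box_dim F \<le> ereal (of_rat b)"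
        using D[rule_format, of "(a, b)"] by (simp add: F_def)
      then show False using ne a(1) b(2) by auto
    qed
    have "hausdorff_dim F = upper_box_dim F \<and> hausdorff_dim F = packing_dim F \<and> has_box_dim F (packing_dim F)"
    proof (cases "F = {}")
      case True
      then show ?thesis
        using has_box_dim_empty[where 'a = 'a]
        by (simp add: hausdorff_dim_empty packing_dim_empty has_box_dim_def)
    next
      case False
      note le[OF False] hausdorff_dim_le_lower_box_dim[OF F] lower_box_dim_le_upper_box_dim[of F]
        hausdorff_dim_le_packing_dim[of F] packing_dim_le_upper_box_dim[OF F]
      then show ?thesis unfolding has_box_dim_def by (metis order_antisym order_trans)
    qed
    then show "let F = attractor G S \<Delta> x v in
      hausdorff_dim F = upper_box_dim F \<and> hausdorff_dim F = packing_dim F \<and> has_box_dim F (packing_dim F)"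
      unfolding Let_def F_def .
  qed
qed

end

section \<open>Transfer to an arbitrary iid family of labels\<close>

text \<open>By independence the joint law of the labels on \<open>W\<close> is \<open>Om\<close>, so
  the almost sure statement pulls back along X. The pull-back acts on null sets, so measurability of
  the dimensions as functions of the labels does not arise. The attractor reads labels of words in
  \<open>W\<close> only, hence is unchanged by the restriction to \<open>W\<close> in X.\<close>

lemma (in random_recursive) AE_dims_eq_iid_labels:
  fixes M :: "'w measure" and \<xi> :: "'e list \<Rightarrow> 'w \<Rightarrow> 'i"
  assumes prob_space: "prob_space M"
    and labels: "prob_space.iid_labels M \<Lambda> \<pi> (\<Union>i\<in>\<Lambda>. arcs (G i)) \<xi>"
    and v: "v \<in> V"
  shows "AE \<omega> in M.
           hausdorff_dim (attractor G S \<Delta> (\<lambda>w. \<xi> w \<omega>) v) = upper_box_dim (attractor G S \<Delta> (\<lambda>w. \<xi> w \<omega>) v) \<and>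
           hausdorff_dim (attractor G S \<Delta> (\<lambda>w. \<xi> w \<omega>) v) = packing_dim (attractor G S \<Delta> (\<lambda>w. \<xi> w \<omega>) v) \<and>
           has_box_dim (attractor G S \<Delta> (\<lambda>w. \<xi> w \<omega>) v) (packing_dim (attractor G S \<Delta> (\<lambda>w. \<xi> w \<omega>) v))"
proof -
  interpret M: prob_space M by (rule prob_space)
  have E_eq: "lists (\<Union>i\<in>\<Lambda>. arcs (G i)) = W" by (simp add: W_def E_def)
  have ind: "M.indep_vars (\<lambda>_. count_space \<Lambda>) \<xi> W"
    and prob: "\<And>w i. w \<in> W \<Longrightarrow> i \<in> \<Lambda> \<Longrightarrow> M.prob {\<omega> \<in> space M. \<xi> w \<omega> = i} = \<pi> i"
    using labels unfolding M.iid_labels_def E_eq by blast+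
  have rv: "\<xi> w \<in> M \<rightarrow>\<^sub>M count_space \<Lambda>" if "w \<in> W" for w
    using ind that by (auto simp: M.indep_vars_def)
  have dist: "distr M (count_space \<Lambda>) (\<xi> w) = D" if w: "w \<in> W" for w
  proof (rule measure_eqI_finite[where A = "\<Lambda>"])
    fix i assume i: "i \<in> \<Lambda>"
    have "emeasure (distr M (count_space \<Lambda>) (\<xi> w)) {i} = emeasure M (\<xi> w -` {i} \<inter> space M)"
      using i by (intro emeasure_distr rv[OF w]) auto
    also have "\<xi> w -` {i} \<inter> space M = {\<omega> \<in> space M. \<xi> w \<omega> = i}" by auto
    also have "emeasure M \<dots> = ennreal (\<pi> i)" by (simp add: M.emeasure_eq_measure prob[OF w i])
    finally show "emeasure (distr M (count_space \<Lambda>) (\<xi> w)) {i} = emeasure D {i}"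
      by (simp add: emeasure_D[OF i])
  qed (auto simp: fin_\<Lambda>)
  define X where "X = (\<lambda>\<omega>. \<lambda>w\<in>W. \<xi> w \<omega>)"
  have "W \<noteq> {}" using W_simps(1) by blast
  have "distr M (\<Pi>\<^sub>M w\<in>W. count_space \<Lambda>) X = (\<Pi>\<^sub>M w\<in>W. distr M (count_space \<Lambda>) (\<xi> w))"
    unfolding X_def
    using M.indep_vars_iff_distr_eq_PiM'[of W \<xi> "\<lambda>_. count_space \<Lambda>"] ind rv \<open>W \<noteq> {}\<close> by simp
  also have "\<dots> = Om" unfolding Om_def by (intro PiM_cong refl dist)
  finally have dX: "distr M (\<Pi>\<^sub>M w\<in>W. count_space \<Lambda>) X = Om" .
  have "X \<in> M \<rightarrow>\<^sub>M (\<Pi>\<^sub>M w\<in>W. count_space \<Lambda>)"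
    unfolding X_def by (intro measurable_restrict rv)
  from AE_distrD[OF this, unfolded dX, OF AE_dims_eq[OF v]]
  show ?thesis
  proof (rule AE_mp, intro AE_I2 impI)
    fix \<omega> assume \<omega>: "\<omega> \<in> space M"
      and dims: "let F = attractor G S \<Delta> (X \<omega>) v in
        hausdorff_dim F = upper_box_dim F \<and> hausdorff_dim F = packing_dim F \<and> has_box_dim F (packing_dim F)"
    have L: "\<forall>w\<in>W. \<xi> w \<omega> \<in> \<Lambda>" using measurable_space[OF rv \<omega>] by simp
    then have LX: "\<forall>w\<in>W. X \<omega> w \<in> \<Lambda>" by (simp add: X_def)
    have "T (X \<omega>) v w \<longleftrightarrow> T (\<lambda>w. \<xi> w \<omega>) v w" for w
    proof (cases "w \<in> W")
      case True
      then show ?thesis by (intro T_cong) (simp add: X_def take_W)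
    next
      case False
      then show ?thesis using T_W[OF L, of v w] T_W[OF LX, of v w] by blast
    qed
    then have eq: "attractor G S \<Delta> (\<lambda>w. \<xi> w \<omega>) v = attractor G S \<Delta> (X \<omega>) v"
      by (simp add: attractor_eq[OF L] attractor_eq[OF LX])
    show "hausdorff_dim (attractor G S \<Delta> (\<lambda>w. \<xi> w \<omega>) v) = upper_box_dim (attractor G S \<Delta> (\<lambda>w. \<xi> w \<omega>) v) \<and>
           hausdorff_dim (attractor G S \<Delta> (\<lambda>w. \<xi> w \<omega>) v) = packing_dim (attractor G S \<Delta> (\<lambda>w. \<xi> w \<omega>) v) \<and>
           has_box_dim (attractor G S \<Delta> (\<lambda>w. \<xi> w \<omega>) v) (packing_dim (attractor G S \<Delta> (\<lambda>w. \<xi> w \<omega>) v))"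
      using dims unfolding Let_def eq .
  qed
qed

theorem theorem3p5:
  fixes N :: nat
    and V :: "'v set"
    and G :: "nat \<Rightarrow> ('v, 'e) pre_digraph"
    and \<pi> :: "nat \<Rightarrow> real"
    and c :: "'e \<Rightarrow> real"
    and S :: "'e \<Rightarrow> 'a::euclidean_space \<Rightarrow> 'a"
    and \<Delta> :: "'a set"
    and M :: "'w measure"
    and \<xi> :: "'e list \<Rightarrow> 'w \<Rightarrow> nat"
    and v :: 'v
  assumes graphs: "\<And>i. i \<in> {1..N} \<Longrightarrow> fin_digraph (G i) \<and> verts (G i) = V"
    and distinct_letters: "disjoint_family_on (\<lambda>i. arcs (G i)) {1..N}"
    and prob_pos: "\<And>i. i \<in> {1..N} \<Longrightarrow> \<pi> i > 0"
    and prob_sum: "(\<Sum>i\<in>{1..N}. \<pi> i) = 1"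
    and similarities: "\<And>e. e \<in> (\<Union>i\<in>{1..N}. arcs (G i)) \<Longrightarrow> c e \<in> {0<..<1} \<and> similarity (c e) (S e)"
    and seed: "compact \<Delta>" "\<Delta> \<noteq> {}" "\<Delta> = closure (interior \<Delta>)"
    and seed_invariant: "\<And>e. e \<in> (\<Union>i\<in>{1..N}. arcs (G i)) \<Longrightarrow> S e ` \<Delta> \<subseteq> \<Delta>"
    and connected: "stochastically_strongly_connected {1..N} V G \<pi>"
    and surviving: "nontrivial_surviving {1..N} V G \<pi> S"
    and prob_space: "prob_space M"
    and labels: "prob_space.iid_labels M {1..N} \<pi> (\<Union>i\<in>{1..N}. arcs (G i)) \<xi>"
    and vertex: "v \<in> V"
  shows "AE \<omega> in M.
           hausdorff_dim (attractor G S \<Delta> (\<lambda>w. \<xi> w \<omega>) v) = upper_box_dim (attractor G S \<Delta> (\<lambda>w. \<xi> w \<omega>) v) \<and>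
           hausdorff_dim (attractor G S \<Delta> (\<lambda>w. \<xi> w \<omega>) v) = packing_dim (attractor G S \<Delta> (\<lambda>w. \<xi> w \<omega>) v) \<and>
           has_box_dim (attractor G S \<Delta> (\<lambda>w. \<xi> w \<omega>) v) (packing_dim (attractor G S \<Delta> (\<lambda>w. \<xi> w \<omega>) v))"
proof -
  interpret random_recursive "{1..N}" V G \<pi> c S \<Delta>
  proof
    show "(\<Sum>i\<in>{1..N}. \<pi> i * real (card (out_arcs (G i) v))) > 1" if "v \<in> V" for v
      using surviving that unfolding nontrivial_surviving_def by blast
    show "V \<noteq> {}" using vertex by blast
  qed (fact | simp)+
  show ?thesis by (rule AE_dims_eq_iid_labels[OF prob_space labels vertex])
qed

end
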